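(* Let $\tau$ be an infinite ordinal and let $\bigl(\{A_\alpha\},\{X_\alpha\},\{\pi_{\alpha,\beta}\}\bigr)$ $(0\le\alpha\le\beta\le\tau)$ be a system of root extensions, with $A_{\alpha+1}$ the $\mathscr{F}_\alpha$-extension of $A_\alpha$ for each $\alpha<\tau$. Let $I_0$ be a closed ideal in $A_0$, and set $S_0=\operatorname{hull}(I_0)$. For every $0\le\alpha\le\tau$, set $I_\alpha=T_{0,\alpha}^{-1}(I_0)$ and $S_\alpha=\pi_{0,\alpha}^{-1}(S_0)$. Suppose that $I_\alpha\supset\mathscr{F}_\alpha$ for every $0\le\alpha<\tau$. Then for every $0\le\alpha\le\tau$: (i) $\pi_{0,\alpha}$ takes $S_\alpha$ homeomorphically onto $S_0$. (ii) $\pi_{0,\alpha}^*$ induces an isometric isomorphism of $A_0|S_0$ onto $A_\alpha|S_\alpha$, given by $f|S_0\mapsto(\pi_{0,\alpha}^*f)|S_\alpha$ (with supremum norms on $S_0$ and $S_\alpha$). (iii) $I_\alpha$ is a closed ideal in $A_\alpha$ such that $\operatorname{hull}(I_\alpha)=S_\alpha$, such that $I_\alpha\cap\pi_{0,\alpha}^*(A_0)=\pi_{0,\alpha}^*(I_0)$, and such that $A_\alpha/I_\alpha$ is isometrically isomorphic as a Banach algebra to $A_0/I_0$. Consequently, there is an order-preserving bijective correspondence between the closed ideals of $A_\alpha$ containing $I_\alpha$ and the closed ideals of $A_0$ containing $I_0$.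
   Context: All spaces are Hausdorff. A uniform algebra on a compact space $X$ is a closed subalgebra of $C(X)$ (continuous complex-valued functions, supremum norm) containing the constants and separating the points of $X$. The hull of an ideal $I$ of a uniform algebra on $X$ is the common zero set in $X$ of the functions in $I$. $A|L$ denotes the set of restrictions to $L$ of functions in $A$. Single extension. Let $A$ be a uniform algebra on $X$ and $\mathscr{F}\subset A$ nonempty. Give $\mathbb{C}^{\mathscr{F}}$ the product topology; let $p_1:X\times\mathbb{C}^{\mathscr{F}}\to X$ and, for $f\in\mathscr{F}$, $p_f:X\times\mathbb{C}^{\mathscr{F}}\to\mathbb{C}$ be $p_1(x,(z_g)_g)=x$, $p_f(x,(z_g)_g)=z_f$. Let $X_{\mathscr{F}}=\{y\in X\times\mathbb{C}^{\mathscr{F}}: (p_f(y))^2=f(p_1(y))\text{ for all }f\in\mathscr{F}\}$ and let $A_{\mathscr{F}}$ be the uniform algebra on $X_{\mathscr{F}}$ generated by $\{f\circ p_1:f\in A\}\cup\{p_f:f\in\mathscr{F}\}$. $A_{\mathscr{F}}$ is the $\mathscr{F}$-extension of $A$, $\pi=p_1|X_{\mathscr{F}}$ is the associated (surjective) map onto $X$, and $\pi^*:A\to A_{\mathscr{F}}$, $\pi^*(f)=f\circ\pi$, is an isometric embedding. The operator $T:A_{\mathscr{F}}\to A$ is defined by $(Tg)(x)=\int_{\pi^{-1}(x)}g\,d\mu_x$, where $\mu_x$ is the unique probability measure on $\pi^{-1}(x)$ invariant under the action of $(\mathbb{Z}/2)^{\mathscr{F}}$ by sign changes of the coordinates $z_f$.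 (It is known that $T$ does map into $A$, that $\|T\|=1$, that $T\circ\pi^*$ is the identity, and that $T(\pi^*(f)p_{f_1}\cdots p_{f_r})=0$ for $f\in A$ and distinct $f_1,\dots,f_r\in\mathscr{F}$, $r\ge1$.) System of root extensions. For an infinite ordinal $\tau$, it consists of compact spaces $X_\alpha$, uniform algebras $A_\alpha$ on $X_\alpha$, and continuous surjections $\pi_{\alpha,\beta}:X_\beta\to X_\alpha$ $(0\le\alpha\le\beta\le\tau)$ such that: (1) $\pi_{\alpha,\beta}^*(f)=f\circ\pi_{\alpha,\beta}$ defines a homomorphism of $A_\alpha$ into $A_\beta$; (2) $\pi_{\alpha,\beta}\circ\pi_{\beta,\gamma}=\pi_{\alpha,\gamma}$ for $\alpha\le\beta\le\gamma$, and $\pi_{\alpha,\alpha}$ is the identity; (3) for each $\alpha<\tau$ there is a subset $\mathscr{F}_\alpha\subset A_\alpha$ such that $A_{\alpha+1}$ is the $\mathscr{F}_\alpha$-extension of $A_\alpha$ and $\pi_{\alpha,\alpha+1}$ is the associated surjection; (4) for $\gamma$ a limit ordinal, $X_\gamma$ is the inverse limit of $\{X_\alpha,\pi_{\alpha,\beta}\}_{\alpha\le\beta<\gamma}$ with the associated maps $\pi_{\alpha,\gamma}$, and $A_\gamma$ is the closure in $C(X_\gamma)$ of $\bigcup_{\alpha<\gamma}\pi_{\alpha,\gamma}^*(A_\alpha)$. Operators $T_{\alpha,\beta}:A_\beta\to A_\alpha$ $(\alpha\le\beta)$. For fixed $\alpha$, they are defined by transfinite recursion on $\beta$: $T_{\alpha,\alpha}$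 is the identity; if $\beta=\delta+1$, then $T_{\alpha,\beta}=T_{\alpha,\delta}\circ T$ with $T:A_{\delta+1}\to A_\delta$ the operator of the single extension; if $\beta$ is a limit ordinal, $T_{\alpha,\beta}$ is the unique continuous linear operator with $T_{\alpha,\beta}(\pi_{\delta,\beta}^*f)=T_{\alpha,\delta}f$ for all $\alpha\le\delta<\beta$, $f\in A_\delta$. These are well-defined norm-one operators. *)

theory Defs
  imports
    "HOL-Probability.Probability_Measure"
    "HOL-Algebra.QuotRing"
    "HOL-Algebra.Module"
begin

section \<open>Normed algebras of functions, their quotients and isomorphisms\<close>

text \<open>
  A complex-valued function on a set \<open>S\<close> is represented by a total function that is
  \<^const>\<open>undefined\<close> outside \<open>S\<close>, that is, by an element of \<^term>\<open>extensional S\<close>; this is the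
  convention of the metric space \<^term>\<open>cfunspace X euclidean_metric\<close>, which for compact \<open>X\<close> is
  \<open>C(X)\<close> with the supremum metric.  Composition with a map is \<^const>\<open>compose\<close>, and restriction
  to a subset is \<^const>\<open>restrict\<close>.
\<close>

record 'b nalg = "(complex, 'b) module" +
  nrm :: "'b \<Rightarrow> real"

text \<open>\<^term>\<open>Sup {} :: real\<close> is an unspecified number, whence the case distinction.\<close>

definition supnorm :: "'x set \<Rightarrow> ('x \<Rightarrow> complex) \<Rightarrow> real" where
  "supnorm S f = (if S = {} then 0 else (SUP x\<in>S. cmod (f x)))"

definition fun_nalg :: "'x set \<Rightarrow> ('x \<Rightarrow> complex) set \<Rightarrow> ('x \<Rightarrow> complex) nalg" where
  "fun_nalg S B =
    \<lparr>carrier = B,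
     mult = (\<lambda>f g. \<lambda>x\<in>S. f x * g x),
     one = (\<lambda>x\<in>S. 1),
     zero = (\<lambda>x\<in>S. 0),
     add = (\<lambda>f g. \<lambda>x\<in>S. f x + g x),
     smult = (\<lambda>c f. \<lambda>x\<in>S. c * f x),
     nrm = supnorm S\<rparr>"

definition quot_nalg :: "'b nalg \<Rightarrow> 'b set \<Rightarrow> 'b set nalg" where
  "quot_nalg B I =
    \<lparr>carrier = carrier (B Quot I),
     mult = mult (B Quot I),
     one = one (B Quot I),
     zero = zero (B Quot I),
     add = add (B Quot I),
     smult = (\<lambda>c K. \<Union>f\<in>K. I +>\<^bsub>B\<^esub> (c \<odot>\<^bsub>B\<^esub> f)),
     nrm = (\<lambda>K. INF f\<in>K. nrm B f)\<rparr>"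

definition lin_map :: "'b nalg \<Rightarrow> 'c nalg \<Rightarrow> ('b \<Rightarrow> 'c) \<Rightarrow> bool" where
  "lin_map B C L \<longleftrightarrow>
    L \<in> carrier B \<rightarrow> carrier C \<and>
    (\<forall>f\<in>carrier B. \<forall>g\<in>carrier B. L (f \<oplus>\<^bsub>B\<^esub> g) = L f \<oplus>\<^bsub>C\<^esub> L g) \<and>
    (\<forall>c. \<forall>f\<in>carrier B. L (c \<odot>\<^bsub>B\<^esub> f) = c \<odot>\<^bsub>C\<^esub> L f)"

definition alg_hom :: "'b nalg \<Rightarrow> 'c nalg \<Rightarrow> ('b \<Rightarrow> 'c) \<Rightarrow> bool" where
  "alg_hom B C \<phi> \<longleftrightarrow> \<phi> \<in> ring_hom B C \<and> lin_map B C \<phi>"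

definition isometric_iso :: "'b nalg \<Rightarrow> 'c nalg \<Rightarrow> ('b \<Rightarrow> 'c) \<Rightarrow> bool" where
  "isometric_iso B C \<phi> \<longleftrightarrow>
    alg_hom B C \<phi> \<and> bij_betw \<phi> (carrier B) (carrier C) \<and>
    (\<forall>f\<in>carrier B. nrm C (\<phi> f) = nrm B f)"


section \<open>Uniform algebras\<close>

definition unif_top :: "'x topology \<Rightarrow> ('x \<Rightarrow> complex) topology" where
  "unif_top X = mtopology_of (cfunspace X euclidean_metric)"

definition closed_subalgebra :: "'x topology \<Rightarrow> ('x \<Rightarrow> complex) set \<Rightarrow> bool" where
  "closed_subalgebra X A \<longleftrightarrow>
    closedin (unif_top X) A \<and>
    (\<forall>c. (\<lambda>x\<in>topspace X. c) \<in> A) \<and>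
    (\<forall>f\<in>A. \<forall>g\<in>A. (\<lambda>x\<in>topspace X. f x + g x) \<in> A \<and> (\<lambda>x\<in>topspace X. f x * g x) \<in> A)"

definition uniform_algebra :: "'x topology \<Rightarrow> ('x \<Rightarrow> complex) set \<Rightarrow> bool" where
  "uniform_algebra X A \<longleftrightarrow>
    compact_space X \<and> Hausdorff_space X \<and> closed_subalgebra X A \<and>
    (\<forall>x\<in>topspace X. \<forall>y\<in>topspace X. x \<noteq> y \<longrightarrow> (\<exists>f\<in>A. f x \<noteq> f y))"

definition generated_algebra ::
    "'x topology \<Rightarrow> ('x \<Rightarrow> complex) set \<Rightarrow> ('x \<Rightarrow> complex) set" where
  "generated_algebra X G = \<Inter>{B. closed_subalgebra X B \<and> G \<subseteq> B}"

abbreviation ualg :: "'x topology \<Rightarrow> ('x \<Rightarrow> complex) set \<Rightarrow> ('x \<Rightarrow> complex) nalg" where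
  "ualg X A \<equiv> fun_nalg (topspace X) A"

definition closed_ideal ::
    "'x topology \<Rightarrow> ('x \<Rightarrow> complex) set \<Rightarrow> ('x \<Rightarrow> complex) set \<Rightarrow> bool" where
  "closed_ideal X A I \<longleftrightarrow> ideal I (ualg X A) \<and> closedin (subtopology (unif_top X) A) I"

definition zero_hull :: "'x topology \<Rightarrow> ('x \<Rightarrow> complex) set \<Rightarrow> 'x set" where
  "zero_hull X I = {x \<in> topspace X. \<forall>f\<in>I. f x = 0}"

definition restrictions :: "('x \<Rightarrow> complex) set \<Rightarrow> 'x set \<Rightarrow> ('x \<Rightarrow> complex) set" where
  "restrictions A S = (\<lambda>f. restrict f S) ` A"

definition pullback :: "'y topology \<Rightarrow> ('y \<Rightarrow> 'x) \<Rightarrow> ('x \<Rightarrow> complex) \<Rightarrow> 'y \<Rightarrow> complex" where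
  "pullback Y p f = compose (topspace Y) f p"


section \<open>The single extension\<close>

type_synonym 'x ext_point = "'x \<times> (('x \<Rightarrow> complex) \<Rightarrow> complex)"

definition ext_space :: "'x topology \<Rightarrow> ('x \<Rightarrow> complex) set \<Rightarrow> 'x ext_point topology" where
  "ext_space X F =
    subtopology (prod_topology X (product_topology (\<lambda>f. euclidean) F))
      {y. \<forall>f\<in>F. (snd y f)\<^sup>2 = f (fst y)}"

definition ext_algebra ::
    "'x topology \<Rightarrow> ('x \<Rightarrow> complex) set \<Rightarrow> ('x \<Rightarrow> complex) set \<Rightarrow> ('x ext_point \<Rightarrow> complex) set"
where
  "ext_algebra X A F =
    generated_algebra (ext_space X F)
      (pullback (ext_space X F) fst ` A \<union> (\<lambda>f. \<lambda>y\<in>topspace (ext_space X F). snd y f) ` F)"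

definition ext_fibre :: "'x topology \<Rightarrow> ('x \<Rightarrow> complex) set \<Rightarrow> 'x \<Rightarrow> 'x ext_point set" where
  "ext_fibre X F x = {y \<in> topspace (ext_space X F). fst y = x}"

text \<open>
  The fibres are compact Hausdorff but need not be metrizable, so ``the unique invariant
  probability measure'' requires a choice of \<open>\<sigma>\<close>-algebra.  We take the Baire \<open>\<sigma>\<close>-algebra, the
  least one for which all continuous real functions are measurable: a Baire probability measure
  on a compact Hausdorff space extends uniquely to a regular Borel one, and the two assign the
  same integrals to continuous functions.
\<close>

definition baire_of :: "'y topology \<Rightarrow> 'y measure" where
  "baire_of Y =
    sigma (topspace Y)
      {u -` U \<inter> topspace Y |u U. continuous_map Y euclideanreal u \<and> open U}"

definition sign_change ::
    "('x \<Rightarrow> complex) set \<Rightarrow> (('x \<Rightarrow> complex) \<Rightarrow> complex) \<Rightarrow> 'x ext_point \<Rightarrow> 'x ext_point" where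
  "sign_change F s y = (fst y, \<lambda>f\<in>F. s f * snd y f)"

definition invariant_prob ::
    "'x topology \<Rightarrow> ('x \<Rightarrow> complex) set \<Rightarrow> 'x \<Rightarrow> 'x ext_point measure \<Rightarrow> bool" where
  "invariant_prob X F x \<mu> \<longleftrightarrow>
    prob_space \<mu> \<and>
    space \<mu> = ext_fibre X F x \<and>
    sets \<mu> = sets (baire_of (subtopology (ext_space X F) (ext_fibre X F x))) \<and>
    (\<forall>s \<in> F \<rightarrow> {1, -1}. distr \<mu> \<mu> (sign_change F s) = \<mu>)"

definition fibre_measure ::
    "'x topology \<Rightarrow> ('x \<Rightarrow> complex) set \<Rightarrow> 'x \<Rightarrow> 'x ext_point measure" where
  "fibre_measure X F x = (THE \<mu>. invariant_prob X F x \<mu>)"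

definition avg_op ::
    "'x topology \<Rightarrow> ('x \<Rightarrow> complex) set \<Rightarrow> ('x ext_point \<Rightarrow> complex) \<Rightarrow> 'x \<Rightarrow> complex" where
  "avg_op X F g = (\<lambda>x\<in>topspace X. \<integral>y. g y \<partial>fibre_measure X F x)"


section \<open>Ordinals as elements of a well-ordered type\<close>

definition ord_zero :: "'i::wellorder" where
  "ord_zero = (LEAST \<alpha>. True)"

definition ord_succ :: "'i::wellorder \<Rightarrow> 'i" where
  "ord_succ \<alpha> = (LEAST \<beta>. \<alpha> < \<beta>)"

text \<open>The condition \<open>\<delta> < \<beta>\<close> excludes the meaningless successor of a greatest element.\<close>

definition is_succ_of :: "'i::wellorder \<Rightarrow> 'i \<Rightarrow> bool" where
  "is_succ_of \<beta> \<delta> \<longleftrightarrow> \<delta> < \<beta> \<and> \<beta> = ord_succ \<delta>"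

definition is_limit :: "'i::wellorder \<Rightarrow> bool" where
  "is_limit \<gamma> \<longleftrightarrow> \<gamma> \<noteq> ord_zero \<and> (\<nexists>\<delta>. is_succ_of \<gamma> \<delta>)"

definition ord_pred :: "'i::wellorder \<Rightarrow> 'i" where
  "ord_pred \<beta> = (THE \<delta>. is_succ_of \<beta> \<delta>)"

lemma ord_succ_least: "\<alpha> < \<beta> \<Longrightarrow> \<alpha> < ord_succ \<alpha> \<and> ord_succ \<alpha> \<le> \<beta>"
  unfolding ord_succ_def by (metis LeastI Least_le)

lemma is_succ_of_unique:
  assumes "is_succ_of \<beta> \<delta>" "is_succ_of \<beta> \<epsilon>"
  shows "\<delta> = \<epsilon>"
  using assms unfolding is_succ_of_def by (metis leD linorder_neqE ord_succ_least)

lemma ord_pred_eq: "is_succ_of \<beta> \<delta> \<Longrightarrow> ord_pred \<beta> = \<delta>"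
  unfolding ord_pred_def by (blast intro: is_succ_of_unique)

lemma ord_pred_less: "is_succ_of \<beta> \<delta> \<Longrightarrow> ord_pred \<beta> < \<beta>"
  using ord_pred_eq is_succ_of_def by metis


section \<open>Systems of root extensions\<close>

definition inverse_limit_space ::
    "('i::wellorder \<Rightarrow> 'x topology) \<Rightarrow> ('i \<Rightarrow> 'i \<Rightarrow> 'x \<Rightarrow> 'x) \<Rightarrow> 'i \<Rightarrow> ('i \<Rightarrow> 'x) topology" where
  "inverse_limit_space X p \<gamma> =
    subtopology (product_topology X {..<\<gamma>})
      {z. \<forall>\<alpha> \<beta>. \<alpha> \<le> \<beta> \<and> \<beta> < \<gamma> \<longrightarrow> p \<alpha> \<beta> (z \<beta>) = z \<alpha>}"

text \<open>
  The spaces \<open>X \<alpha>\<close> share one underlying type, so at successor and limit stages they agree with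
  \<^const>\<open>ext_space\<close> and the inverse limit only up to homeomorphism.  At a limit
  the homeomorphism is the canonical one; at a successor it is a datum \<open>h \<delta>\<close>, because the sign
  changes, and hence the averaging operator, depend on the coordinates it provides.
\<close>

locale root_system =
  fixes \<tau> :: "'i::wellorder"
    and X :: "'i \<Rightarrow> 'x topology"
    and A :: "'i \<Rightarrow> ('x \<Rightarrow> complex) set"
    and p :: "'i \<Rightarrow> 'i \<Rightarrow> 'x \<Rightarrow> 'x"
    and F :: "'i \<Rightarrow> ('x \<Rightarrow> complex) set"
    and h :: "'i \<Rightarrow> 'x \<Rightarrow> 'x ext_point"
  assumes infinite_ordinal: "infinite {..<\<tau>}"
    and algebras: "\<alpha> \<le> \<tau> \<Longrightarrow> uniform_algebra (X \<alpha>) (A \<alpha>)"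
    and maps_continuous: "\<alpha> \<le> \<beta> \<Longrightarrow> \<beta> \<le> \<tau> \<Longrightarrow> continuous_map (X \<beta>) (X \<alpha>) (p \<alpha> \<beta>)"
    and maps_onto: "\<alpha> \<le> \<beta> \<Longrightarrow> \<beta> \<le> \<tau> \<Longrightarrow> p \<alpha> \<beta> ` topspace (X \<beta>) = topspace (X \<alpha>)"
    and pullback_hom: "\<alpha> \<le> \<beta> \<Longrightarrow> \<beta> \<le> \<tau> \<Longrightarrow>
      alg_hom (ualg (X \<alpha>) (A \<alpha>)) (ualg (X \<beta>) (A \<beta>)) (pullback (X \<beta>) (p \<alpha> \<beta>))"
    and maps_comp: "\<alpha> \<le> \<beta> \<Longrightarrow> \<beta> \<le> \<gamma> \<Longrightarrow> \<gamma> \<le> \<tau> \<Longrightarrow> x \<in> topspace (X \<gamma>) \<Longrightarrow>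
      p \<alpha> \<beta> (p \<beta> \<gamma> x) = p \<alpha> \<gamma> x"
    and maps_id: "\<alpha> \<le> \<tau> \<Longrightarrow> x \<in> topspace (X \<alpha>) \<Longrightarrow> p \<alpha> \<alpha> x = x"
    and succ_functions: "\<delta> < \<tau> \<Longrightarrow> F \<delta> \<subseteq> A \<delta> \<and> F \<delta> \<noteq> {}"
    and succ_space: "\<delta> < \<tau> \<Longrightarrow>
      homeomorphic_map (X (ord_succ \<delta>)) (ext_space (X \<delta>) (F \<delta>)) (h \<delta>)"
    and succ_map: "\<delta> < \<tau> \<Longrightarrow> x \<in> topspace (X (ord_succ \<delta>)) \<Longrightarrow>
      p \<delta> (ord_succ \<delta>) x = fst (h \<delta> x)"
    and succ_algebra: "\<delta> < \<tau> \<Longrightarrow>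
      A (ord_succ \<delta>) = pullback (X (ord_succ \<delta>)) (h \<delta>) ` ext_algebra (X \<delta>) (A \<delta>) (F \<delta>)"
    and limit_space: "is_limit \<gamma> \<Longrightarrow> \<gamma> \<le> \<tau> \<Longrightarrow>
      homeomorphic_map (X \<gamma>) (inverse_limit_space X p \<gamma>) (\<lambda>x. \<lambda>\<alpha>\<in>{..<\<gamma>}. p \<alpha> \<gamma> x)"
    and limit_algebra: "is_limit \<gamma> \<Longrightarrow> \<gamma> \<le> \<tau> \<Longrightarrow>
      A \<gamma> = unif_top (X \<gamma>) closure_of (\<Union>\<alpha>\<in>{..<\<gamma>}. pullback (X \<gamma>) (p \<alpha> \<gamma>) ` A \<alpha>)"


section \<open>The operators from the algebra at stage \<open>\<beta>\<close> to the one at stage \<open>\<alpha>\<close>\<close>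

definition step_op ::
    "('i::wellorder \<Rightarrow> 'x topology) \<Rightarrow> ('i \<Rightarrow> ('x \<Rightarrow> complex) set) \<Rightarrow> ('i \<Rightarrow> 'x \<Rightarrow> 'x ext_point) \<Rightarrow>
     'i \<Rightarrow> ('x \<Rightarrow> complex) \<Rightarrow> 'x \<Rightarrow> complex" where
  "step_op X F h \<delta> g =
    avg_op (X \<delta>) (F \<delta>)
      (pullback (ext_space (X \<delta>) (F \<delta>)) (inv_into (topspace (X (ord_succ \<delta>))) (h \<delta>)) g)"

text \<open>\<open>R \<delta>\<close> stands for the operator from stage \<open>\<delta>\<close> to stage \<open>\<alpha>\<close>.\<close>

definition limit_op ::
    "('i::wellorder \<Rightarrow> 'x topology) \<Rightarrow> ('i \<Rightarrow> ('x \<Rightarrow> complex) set) \<Rightarrow> ('i \<Rightarrow> 'i \<Rightarrow> 'x \<Rightarrow> 'x) \<Rightarrow>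
     'i \<Rightarrow> 'i \<Rightarrow> ('i \<Rightarrow> ('x \<Rightarrow> complex) \<Rightarrow> 'x \<Rightarrow> complex) \<Rightarrow> ('x \<Rightarrow> complex) \<Rightarrow> 'x \<Rightarrow> complex" where
  "limit_op X A p \<alpha> \<beta> R =
    (THE L. L \<in> extensional (A \<beta>) \<and>
       lin_map (ualg (X \<beta>) (A \<beta>)) (ualg (X \<alpha>) (A \<alpha>)) L \<and>
       continuous_map (subtopology (unif_top (X \<beta>)) (A \<beta>)) (unif_top (X \<alpha>)) L \<and>
       (\<forall>\<delta>\<in>{\<alpha>..<\<beta>}. \<forall>f\<in>A \<delta>. L (pullback (X \<beta>) (p \<delta> \<beta>) f) = R \<delta> f))"

lemma limit_op_cong [fundef_cong]:
  assumes "X = X'" "A = A'" "p = p'" "\<alpha> = \<alpha>'" "\<beta> = \<beta>'"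
    and "\<And>\<delta>. \<delta> < \<beta>' \<Longrightarrow> R \<delta> = R' \<delta>"
  shows "limit_op X A p \<alpha> \<beta> R = limit_op X' A' p' \<alpha>' \<beta>' R'"
  using assms by (simp add: limit_op_def)

text \<open>Only the values at \<open>\<alpha> \<le> \<beta> \<le> \<tau>\<close> and on the algebra at stage \<open>\<beta>\<close> are meaningful.\<close>

function tower_op ::
    "('i::wellorder \<Rightarrow> 'x topology) \<Rightarrow> ('i \<Rightarrow> ('x \<Rightarrow> complex) set) \<Rightarrow> ('i \<Rightarrow> 'i \<Rightarrow> 'x \<Rightarrow> 'x) \<Rightarrow>
     ('i \<Rightarrow> ('x \<Rightarrow> complex) set) \<Rightarrow> ('i \<Rightarrow> 'x \<Rightarrow> 'x ext_point) \<Rightarrow>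
     'i \<Rightarrow> 'i \<Rightarrow> ('x \<Rightarrow> complex) \<Rightarrow> 'x \<Rightarrow> complex" where
  "tower_op X A p F h \<alpha> \<beta> =
    (if \<beta> \<le> \<alpha> then (\<lambda>g. g)
     else if \<exists>\<delta>. is_succ_of \<beta> \<delta>
       then tower_op X A p F h \<alpha> (ord_pred \<beta>) \<circ> step_op X F h (ord_pred \<beta>)
     else limit_op X A p \<alpha> \<beta> (\<lambda>\<delta>. tower_op X A p F h \<alpha> \<delta>))"
  by pat_completeness auto
termination
  by (relation "inv_image {(\<delta>, \<beta>). \<delta> < \<beta>} (\<lambda>(X, A, p, F, h, \<alpha>, \<beta>). \<beta>)")
     (auto simp: wf intro: ord_pred_less)

declare tower_op.simps [simp del]

definition tower_ideal ::
    "('i::wellorder \<Rightarrow> 'x topology) \<Rightarrow> ('i \<Rightarrow> ('x \<Rightarrow> complex) set) \<Rightarrow> ('i \<Rightarrow> 'i \<Rightarrow> 'x \<Rightarrow> 'x) \<Rightarrow>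
     ('i \<Rightarrow> ('x \<Rightarrow> complex) set) \<Rightarrow> ('i \<Rightarrow> 'x \<Rightarrow> 'x ext_point) \<Rightarrow>
     ('x \<Rightarrow> complex) set \<Rightarrow> 'i \<Rightarrow> ('x \<Rightarrow> complex) set" where
  "tower_ideal X A p F h I\<^sub>0 \<alpha> = {g \<in> A \<alpha>. tower_op X A p F h ord_zero \<alpha> g \<in> I\<^sub>0}"

definition tower_hull ::
    "('i::wellorder \<Rightarrow> 'x topology) \<Rightarrow> ('i \<Rightarrow> 'i \<Rightarrow> 'x \<Rightarrow> 'x) \<Rightarrow> 'x set \<Rightarrow> 'i \<Rightarrow> 'x set" where
  "tower_hull X p S\<^sub>0 \<alpha> = {x \<in> topspace (X \<alpha>). p ord_zero \<alpha> x \<in> S\<^sub>0}"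

end

theory Submission
  imports Defs "HOL-Probability.Infinite_Product_Measure"
begin

text \<open>
  Let \<open>T\<close> be a linear contraction of \<open>B\<close> onto \<open>A\<close> with \<open>T (f \<circ> p) = f\<close> which is multiplicative
  modulo a closed ideal \<open>I\<close> of \<open>A\<close>, that is \<open>T (g k) - T g T k \<in> I\<close>, and which is evaluation
  over the hull of \<open>I\<close>, that is \<open>(T g) (p y) = g y\<close> whenever \<open>p y\<close> lies in the hull.  Then \<open>T\<close>
  and \<open>f \<mapsto> f \<circ> p\<close> induce mutually inverse isometries of the quotients, a bijection of the
  closed ideals and a homeomorphism of the hulls.  Hence it suffices that these properties pass
  up the tower.  At a successor, the extension algebra is the closed span of the monomials
  \<open>(a \<circ> \<pi>) p\<^sub>f\<^sub>1 \<cdots> p\<^sub>f\<^sub>r\<close> with distinct \<open>f\<^sub>i\<close>; averaging over the sign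
  changes kills those with \<open>r > 0\<close>, and since \<open>p\<^sub>f\<^sup>2 = f \<circ> \<pi>\<close> with \<open>f\<close> in the
  ideal, averaging is multiplicative modulo the ideal.  Over the hull all \<open>f\<close> vanish, so the fibres
  are single points.  At a limit everything extends from the dense union by continuity.
\<close>

section \<open>Uniform approximation\<close>

text \<open>Averaging is not multiplicative, only multiplicative up to an error in the ideal. Two
  such maps compose to another one when the upper map is taken modulo the preimage of the lower
  ideal. That preimage is the \<open>tower_ideal\<close> of the stage, so the hypothesis on
  \<open>F\<close> enters one stage at a time. The fibre measure and the operator at a limit stage
  are definite descriptions, so nothing is known of them before existence and uniqueness are proved.
  For the measure, a fibre is identified with a product of root sets: the product of the uniform
  distributions is invariant, invariance forces the mass of every finite cylinder, and compactness
  shows that cylinders determine all Baire sets, even for uncountable \<open>F\<close>. For the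
  limit operator, the operators of the lower stages must be known to be compatible, so compatibility
  is carried through the induction. Closedness is tested throughout by pointwise estimates. This
  also yields that a fibre average is continuous in the base point: it is a uniform limit of
  averages of monomials, which are explicit elements of the lower algebra.\<close>

definition cfun :: "'x topology \<Rightarrow> ('x \<Rightarrow> complex) set" where
  "cfun X = {f \<in> extensional (topspace X). continuous_map X euclidean f}"

text \<open>The bounds are nonstrict and pointwise, so that no supremum has to be handled.
  Continuity of \<open>f\<close> is not built in, which allows the notion to be applied to functions
  whose continuity is still to be derived.\<close>

definition unif_approx :: "'x topology \<Rightarrow> ('x \<Rightarrow> complex) set \<Rightarrow> ('x \<Rightarrow> complex) \<Rightarrow> bool" where
  "unif_approx X B f \<longleftrightarrow> (\<forall>e>0. \<exists>b\<in>B. \<forall>x\<in>topspace X. cmod (f x - b x) \<le> e)"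

abbreviation fadd :: "'x topology \<Rightarrow> ('x \<Rightarrow> complex) \<Rightarrow> ('x \<Rightarrow> complex) \<Rightarrow> 'x \<Rightarrow> complex" where
  "fadd X f g \<equiv> (\<lambda>x\<in>topspace X. f x + g x)"

abbreviation fmul :: "'x topology \<Rightarrow> ('x \<Rightarrow> complex) \<Rightarrow> ('x \<Rightarrow> complex) \<Rightarrow> 'x \<Rightarrow> complex" where
  "fmul X f g \<equiv> (\<lambda>x\<in>topspace X. f x * g x)"

abbreviation fconst :: "'x topology \<Rightarrow> complex \<Rightarrow> 'x \<Rightarrow> complex" where
  "fconst X c \<equiv> (\<lambda>x\<in>topspace X. c)"

abbreviation fscale :: "'x topology \<Rightarrow> complex \<Rightarrow> ('x \<Rightarrow> complex) \<Rightarrow> 'x \<Rightarrow> complex" where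
  "fscale X c f \<equiv> (\<lambda>x\<in>topspace X. c * f x)"

lemma cfun_bounded:
  assumes "compact_space X" "f \<in> cfun X"
  obtains C where "0 \<le> C" "\<And>x. x \<in> topspace X \<Longrightarrow> cmod (f x) \<le> C"
proof -
  have "compactin euclidean (f ` topspace X)"
    using assms image_compactin unfolding cfun_def compact_space_def by blast
  then have "bounded (f ` topspace X)"
    by (simp add: compact_imp_bounded)
  then obtain C where "\<forall>x\<in>topspace X. cmod (f x) \<le> C"
    by (auto simp: bounded_iff)
  then have "\<And>x. x \<in> topspace X \<Longrightarrow> cmod (f x) \<le> max C 0"
    by (simp add: le_max_iff_disj)
  then show ?thesis
    using that[of "max C 0"] by simp
qed

lemma mspace_cfunspace_euclidean:
  assumes "compact_space X"
  shows "mspace (cfunspace X euclidean_metric) = cfun X"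
  using assms unfolding cfun_def by (subst compactin_mspace_cfunspace) (auto simp: compact_space_def)

lemma topspace_unif_top: "compact_space X \<Longrightarrow> topspace (unif_top X) = cfun X"
  unfolding unif_top_def topspace_mtopology_of by (rule mspace_cfunspace_euclidean)

lemma Hausdorff_unif_top: "Hausdorff_space (unif_top X)"
  unfolding unif_top_def mtopology_of_def
  by (rule Metric_space.Hausdorff_space_mtopology) (rule Metric_space_mspace_mdist)

lemma closure_of_unif_top:
  assumes X: "compact_space X" and B: "B \<subseteq> cfun X"
  shows "unif_top X closure_of B = {f \<in> cfun X. unif_approx X B f}"
proof -
  let ?m = "cfunspace X euclidean_metric :: ('a \<Rightarrow> complex) metric"
  interpret M: Metric_space "mspace ?m" "mdist ?m"
    by (rule Metric_space_mspace_mdist)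
  have le: "mdist ?m f g \<le> e \<longleftrightarrow> (\<forall>x\<in>topspace X. cmod (f x - g x) \<le> e)"
    if "f \<in> cfun X" "g \<in> cfun X" "e > 0" for f g :: "'a \<Rightarrow> complex" and e :: real
  \<comment> \<open>On the empty space the right-hand side is vacuous, and the left-hand side holds
    because \<open>e\<close> is positive.\<close>
  proof (cases "topspace X = {}")
    case True
    then have "mdist ?m f g \<le> e"
      using that mdist_cfunspace_le[of e X euclidean_metric f g] by simp
    then show ?thesis using True by simp
  next
    case False
    with that show ?thesis
      using cfunspace_mdist_le[of f X euclidean_metric g e]
      unfolding mspace_cfunspace_euclidean[OF X] by (simp add: dist_norm)
  qed
  have "unif_top X closure_of B = {f \<in> mspace ?m. \<forall>r>0. \<exists>b\<in>B. b \<in> M.mcball f r}"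
    unfolding unif_top_def mtopology_of_def by (rule M.metric_closure_of_alt)
  also have "\<dots> = {f \<in> cfun X. \<forall>r>0. \<exists>b\<in>B. mdist ?m f b \<le> r}"
  proof -
    have "b \<in> M.mcball f r \<longleftrightarrow> mdist ?m f b \<le> r" if "f \<in> cfun X" "b \<in> B" for f b r
      using that B by (subst M.in_mcball) (auto simp: mspace_cfunspace_euclidean[OF X] simp del: mspace_cfunspace)
    then show ?thesis unfolding mspace_cfunspace_euclidean[OF X] by (intro Collect_cong conj_cong refl) blast
  qed
  also have "\<dots> = {f \<in> cfun X. unif_approx X B f}"
  proof (intro Collect_cong conj_cong refl)
    fix f assume "f \<in> cfun X"
    then have "mdist ?m f b \<le> e \<longleftrightarrow> (\<forall>x\<in>topspace X. cmod (f x - b x) \<le> e)" if "e > 0" "b \<in> B" for e b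
      using le[of f b e] that B by blast
    then show "(\<forall>r>0. \<exists>b\<in>B. mdist ?m f b \<le> r) \<longleftrightarrow> unif_approx X B f"
      unfolding unif_approx_def by auto
  qed
  finally show ?thesis .
qed

lemma closedin_unif_top:
  assumes X: "compact_space X"
  shows "closedin (unif_top X) B \<longleftrightarrow>
    B \<subseteq> cfun X \<and> (\<forall>f\<in>cfun X. unif_approx X B f \<longrightarrow> f \<in> B)"
proof (cases "B \<subseteq> cfun X")
  case True
  have "closedin (unif_top X) B \<longleftrightarrow> unif_top X closure_of B = B"
    by (simp add: closure_of_eq)
  also have "\<dots> \<longleftrightarrow> unif_top X closure_of B \<subseteq> B"
    using True closure_of_subset[of B "unif_top X"] topspace_unif_top[OF X] by auto
  finally show ?thesis
    using True unfolding closure_of_unif_top[OF X True] by auto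
next
  case False
  then show ?thesis
    using closedin_subset[of "unif_top X" B] topspace_unif_top[OF X] by auto
qed

lemma closedin_subtopology_unif_top:
  assumes X: "compact_space X" and A: "closedin (unif_top X) A"
  shows "closedin (subtopology (unif_top X) A) I \<longleftrightarrow>
    I \<subseteq> A \<and> (\<forall>f\<in>A. unif_approx X I f \<longrightarrow> f \<in> I)"
proof -
  have *: "I \<subseteq> A \<Longrightarrow> f \<in> cfun X \<Longrightarrow> unif_approx X I f \<Longrightarrow> f \<in> A" for f
    using A unfolding closedin_unif_top[OF X] unif_approx_def by (meson subsetD)
  show ?thesis
  proof (cases "I \<subseteq> A")
    case True
    then have "closedin (subtopology (unif_top X) A) I \<longleftrightarrow> closedin (unif_top X) I"
      using closedin_closed_subtopology[OF A] by blast
    also have "\<dots> \<longleftrightarrow> (\<forall>f\<in>cfun X. unif_approx X I f \<longrightarrow> f \<in> I)"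
      using True A unfolding closedin_unif_top[OF X] by auto
    also have "\<dots> \<longleftrightarrow> (\<forall>f\<in>A. unif_approx X I f \<longrightarrow> f \<in> I)"
      using *[OF True] A unfolding closedin_unif_top[OF X] by auto
    finally show ?thesis using True by simp
  qed (auto simp: closedin_closed_subtopology[OF A])
qed

lemma unif_approx_mono: "unif_approx X B f \<Longrightarrow> B \<subseteq> C \<Longrightarrow> unif_approx X C f"
  unfolding unif_approx_def by (meson subsetD)

lemma unif_approx_self: "f \<in> B \<Longrightarrow> unif_approx X B f"
  unfolding unif_approx_def by force

text \<open>A Lipschitz estimate between \<open>f\<close> and its approximants is all that is needed
  to carry approximability through \<open>R\<close>. Linearity is not involved, so products and
  multiplicativity defects can be treated in the same way as operators.\<close>

lemma unif_approx_image:
  assumes "unif_approx X B f" and C: "0 \<le> C"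
    and "\<And>b e. b \<in> B \<Longrightarrow> 0 \<le> e \<Longrightarrow> \<forall>x\<in>topspace X. cmod (f x - b x) \<le> e
           \<Longrightarrow> R b \<in> D \<and> (\<forall>y\<in>topspace Y. cmod (R f y - R b y) \<le> C * e)"
  shows "unif_approx Y D (R f)"
  unfolding unif_approx_def
proof (intro allI impI)
  fix e :: real assume e: "e > 0"
  \<comment> \<open>Dividing by \<open>C + 1\<close> instead of \<open>C\<close> covers the case
    \<open>C = 0\<close>.\<close>
  then have "e / (C + 1) > 0" using C by simp
  then obtain b where b: "b \<in> B" "\<forall>x\<in>topspace X. cmod (f x - b x) \<le> e / (C + 1)"
    using assms(1) unfolding unif_approx_def by meson
  have "C * (e / (C + 1)) \<le> e"
    using C e by (simp add: field_simps)
  with assms(3)[OF b(1) _ b(2)] e C show "\<exists>b\<in>D. \<forall>y\<in>topspace Y. cmod (R f y - b y) \<le> e"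
    by (meson \<open>e / (C + 1) > 0\<close> less_imp_le order_trans)
qed

text \<open>Completeness in explicit form: the pointwise limits exist, letting \<open>m\<close> tend
  to infinity in the Cauchy estimate keeps the rate \<open>r n\<close>, and the resulting uniform
  convergence gives continuity. The rate is kept in the conclusion because the limit stage of the
  tower computes with it.\<close>

lemma unif_approx_limit:
  assumes X: "compact_space X" and A: "closedin (unif_top X) A"
    and fA: "\<And>n. f n \<in> A"
    and cau: "\<And>m n x. n \<le> m \<Longrightarrow> x \<in> topspace X \<Longrightarrow> cmod (f m x - f n x) \<le> r n"
    and r: "r \<longlonglongrightarrow> 0"
  obtains k where "k \<in> A" "\<And>n x. x \<in> topspace X \<Longrightarrow> cmod (k x - f n x) \<le> r n"
proof -
  have conv: "\<exists>l. (\<lambda>n. f n x) \<longlonglongrightarrow> l" if x: "x \<in> topspace X" for x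
  proof -
    have "Cauchy (\<lambda>n. f n x)"
    proof (rule metric_CauchyI)
      fix e :: real assume "e > 0"
      then obtain N where N: "\<And>n. n \<ge> N \<Longrightarrow> \<bar>r n\<bar> < e / 2"
        using LIMSEQ_D[OF r, of "e / 2"] by auto
      show "\<exists>M. \<forall>m\<ge>M. \<forall>n\<ge>M. dist (f m x) (f n x) < e"
      proof (intro exI[of _ N] allI impI)
        fix m n assume mn: "m \<ge> N" "n \<ge> N"
        have "dist (f m x) (f n x) \<le> cmod (f m x - f N x) + cmod (f n x - f N x)"
          by (metis dist_commute dist_norm dist_triangle)
        also have "\<dots> < e"
          using cau[OF mn(1) x] cau[OF mn(2) x] N[of N] by simp
        finally show "dist (f m x) (f n x) < e" .
      qed
    qed
    then show ?thesis
      by (simp add: Cauchy_convergent_iff convergent_def)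
  qed
  define k where "k = (\<lambda>x\<in>topspace X. lim (\<lambda>n. f n x))"
  have lim: "(\<lambda>n. f n x) \<longlonglongrightarrow> k x" if "x \<in> topspace X" for x
    using conv[OF that] that by (auto simp: k_def limI)
  have near: "cmod (k x - f n x) \<le> r n" if "x \<in> topspace X" for n x
  proof -
    have "(\<lambda>m. cmod (f m x - f n x)) \<longlonglongrightarrow> cmod (k x - f n x)"
      by (intro tendsto_intros lim that)
    then show ?thesis
      by (rule LIMSEQ_le_const2) (use cau that in blast)
  qed
  have cf: "f n \<in> cfun X" for n
    using fA A closedin_unif_top[OF X] by blast
  have ev: "\<forall>\<^sub>F n in sequentially. \<forall>x\<in>topspace X. cmod (k x - f n x) \<le> e" if e: "e > 0" for e
  proof -
    have "\<forall>\<^sub>F n in sequentially. r n < e"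
      using order_tendstoD(2)[OF r e] .
    then show ?thesis
    proof (rule eventually_mono, intro ballI)
      fix n x assume "r n < e" "x \<in> topspace X"
      then show "cmod (k x - f n x) \<le> e" using near[of x n] by simp
    qed
  qed
  have "continuous_map X euclidean k"
  proof (rule Metric_space.continuous_map_uniform_limit[OF Met_TC.Metric_space_axioms, where X = X and F = sequentially and f = f and g = k, unfolded mtopology_is_euclidean])
    show "\<forall>\<^sub>F n in sequentially. continuous_map X euclidean (f n)"
      using cf by (simp add: cfun_def)
    fix e :: real assume "e > 0"
    then have "\<forall>\<^sub>F n in sequentially. \<forall>x\<in>topspace X. cmod (k x - f n x) \<le> e / 2"
      by (intro ev) simp
    then show "\<forall>\<^sub>F n in sequentially. \<forall>x\<in>topspace X. k x \<in> UNIV \<and> dist (f n x) (k x) < e"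
    proof (rule eventually_mono, intro ballI)
      fix n x assume "\<forall>x\<in>topspace X. cmod (k x - f n x) \<le> e / 2" "x \<in> topspace X"
      then have "dist (f n x) (k x) \<le> e / 2" by (simp add: dist_norm norm_minus_commute)
      then show "k x \<in> UNIV \<and> dist (f n x) (k x) < e" using \<open>e > 0\<close> by simp
    qed
  qed simp
  then have kc: "k \<in> cfun X"
    by (simp add: cfun_def k_def)
  have "unif_approx X A k"
    unfolding unif_approx_def
  proof (intro allI impI)
    fix e :: real assume "e > 0"
    from eventually_happens'[OF _ ev[OF this]] obtain n
      where "\<forall>x\<in>topspace X. cmod (k x - f n x) \<le> e" by auto
    then show "\<exists>b\<in>A. \<forall>x\<in>topspace X. cmod (k x - b x) \<le> e" using fA by blast
  qed
  then have "k \<in> A"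
    using A kc closedin_unif_top[OF X] by blast
  then show ?thesis using that near by blast
qed

lemma cfun_extensional: "f \<in> cfun X \<Longrightarrow> f \<in> extensional (topspace X)"
  by (simp add: cfun_def)

lemma closed_subalgebraD:
  assumes "closed_subalgebra X A"
  shows "closedin (unif_top X) A"
    and "fconst X c \<in> A"
    and "f \<in> A \<Longrightarrow> g \<in> A \<Longrightarrow> fadd X f g \<in> A"
    and "f \<in> A \<Longrightarrow> g \<in> A \<Longrightarrow> fmul X f g \<in> A"
    and "f \<in> A \<Longrightarrow> fscale X c f \<in> A"
proof -
  show 1: "closedin (unif_top X) A" "fconst X c \<in> A"
    and "f \<in> A \<Longrightarrow> g \<in> A \<Longrightarrow> fadd X f g \<in> A"
    and 2: "f \<in> A \<Longrightarrow> g \<in> A \<Longrightarrow> fmul X f g \<in> A" for f g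
    using assms unfolding closed_subalgebra_def by blast+
  have "fmul X (fconst X c) f = fscale X c f"
    by (auto simp: restrict_def)
  then show "f \<in> A \<Longrightarrow> fscale X c f \<in> A"
    using 2[OF 1(2), of f] by simp
qed

lemma closed_subalgebra_subset_cfun:
  "compact_space X \<Longrightarrow> closed_subalgebra X A \<Longrightarrow> A \<subseteq> cfun X"
  using closedin_unif_top closed_subalgebraD(1) by blast

lemma closed_subalgebra_approx:
  "compact_space X \<Longrightarrow> closed_subalgebra X A \<Longrightarrow> f \<in> cfun X \<Longrightarrow> unif_approx X A f \<Longrightarrow> f \<in> A"
  using closedin_unif_top closed_subalgebraD(1) by blast

lemma uniform_algebraD:
  assumes "uniform_algebra X A"
  shows "compact_space X" "Hausdorff_space X" "closed_subalgebra X A" "A \<subseteq> cfun X"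
  using assms closed_subalgebra_subset_cfun unfolding uniform_algebra_def by blast+

lemma pullback_apply [simp]: "y \<in> topspace Y \<Longrightarrow> pullback Y p f y = f (p y)"
  by (simp add: pullback_def compose_def)

lemma pullback_in_extensional [simp]: "pullback Y p f \<in> extensional (topspace Y)"
  by (simp add: pullback_def)

lemma pullback_cfun:
  assumes "continuous_map Y X p" "f \<in> cfun X"
  shows "pullback Y p f \<in> cfun Y"
proof -
  have "continuous_map Y euclidean (f \<circ> p)"
    using assms by (auto simp: cfun_def intro: continuous_map_compose)
  then have "continuous_map Y euclidean (pullback Y p f)"
    by (rule continuous_map_eq) simp
  then show ?thesis by (simp add: cfun_def)
qed

lemma cfun_ops:
  shows "f \<in> cfun X \<Longrightarrow> g \<in> cfun X \<Longrightarrow> fadd X f g \<in> cfun X"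
    and "f \<in> cfun X \<Longrightarrow> g \<in> cfun X \<Longrightarrow> fmul X f g \<in> cfun X"
    and "fconst X c \<in> cfun X"
proof -
  have *: "f \<in> extensional (topspace X) \<Longrightarrow> continuous_map X euclidean g
      \<Longrightarrow> (\<And>x. x \<in> topspace X \<Longrightarrow> f x = g x) \<Longrightarrow> f \<in> cfun X" for f g
    unfolding cfun_def by (auto intro: continuous_map_eq)
  show "f \<in> cfun X \<Longrightarrow> g \<in> cfun X \<Longrightarrow> fadd X f g \<in> cfun X"
    by (rule *[of _ "\<lambda>x. f x + g x"]) (auto simp: cfun_def intro: continuous_map_add)
  show "fconst X c \<in> cfun X"
    by (rule *[of _ "\<lambda>x. c"]) auto
  show "fmul X f g \<in> cfun X" if "f \<in> cfun X" "g \<in> cfun X"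
  proof (rule *[of _ "\<lambda>x. f x * g x"])
    have "continuous_map X euclidean ((\<lambda>z. fst z * snd z) \<circ> (\<lambda>x. (f x, g x)))"
    proof (rule continuous_map_compose)
      show "continuous_map X (prod_topology euclidean euclidean) (\<lambda>x. (f x, g x))"
        using that by (intro continuous_map_pairedI) (auto simp: cfun_def)
      show "continuous_map (prod_topology euclidean euclidean) euclidean (\<lambda>z::complex \<times> complex. fst z * snd z)"
        unfolding euclidean_product_topology by (simp add: continuous_on_mult continuous_on_fst continuous_on_snd)
    qed
    then show "continuous_map X euclidean (\<lambda>x. f x * g x)" by (simp add: o_def)
  qed auto
qed

section \<open>Retractions that are multiplicative modulo an ideal\<close>

text \<open>Negatives and scalar multiples need no clause of their own: they are products with
  constants, which lie in \<open>A\<close>.\<close>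

definition unif_ideal :: "'x topology \<Rightarrow> ('x \<Rightarrow> complex) set \<Rightarrow> ('x \<Rightarrow> complex) set \<Rightarrow> bool" where
  "unif_ideal X A I \<longleftrightarrow> I \<subseteq> A \<and> fconst X 0 \<in> I \<and>
     (\<forall>f\<in>I. \<forall>g\<in>I. fadd X f g \<in> I) \<and> (\<forall>f\<in>I. \<forall>g\<in>A. fmul X f g \<in> I) \<and>
     (\<forall>f\<in>A. unif_approx X I f \<longrightarrow> f \<in> I)"

section \<open>Uniform algebras as rings, and their closed ideals\<close>

lemma carrier_ualg [simp]: "carrier (fun_nalg S A) = A"
  and mult_ualg [simp]: "f \<otimes>\<^bsub>fun_nalg S A\<^esub> g = (\<lambda>x\<in>S. f x * g x)"
  and one_ualg [simp]: "\<one>\<^bsub>fun_nalg S A\<^esub> = (\<lambda>x\<in>S. 1)"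
  and zero_ualg [simp]: "\<zero>\<^bsub>fun_nalg S A\<^esub> = (\<lambda>x\<in>S. 0)"
  and add_ualg [simp]: "f \<oplus>\<^bsub>fun_nalg S A\<^esub> g = (\<lambda>x\<in>S. f x + g x)"
  and smult_ualg [simp]: "c \<odot>\<^bsub>fun_nalg S A\<^esub> f = (\<lambda>x\<in>S. c * f x)"
  and nrm_ualg [simp]: "nrm (fun_nalg S A) = supnorm S"
  by (simp_all add: fun_nalg_def)

lemma cring_ualg:
  assumes X: "compact_space X" and A: "closed_subalgebra X A"
  shows "cring (ualg X A)"
proof -
  have ext: "f \<in> A \<Longrightarrow> f \<in> extensional (topspace X)" for f
    using closed_subalgebra_subset_cfun[OF X A] cfun_extensional by blast
  note D = closed_subalgebraD[OF A]
  show ?thesis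
  proof (rule cringI)
    show "abelian_group (ualg X A)"
    proof (rule abelian_groupI)
      fix f assume f: "f \<in> carrier (ualg X A)"
      show "\<exists>g\<in>carrier (ualg X A). g \<oplus>\<^bsub>ualg X A\<^esub> f = \<zero>\<^bsub>ualg X A\<^esub>"
        using D(5)[of f "-1"] f by (intro bexI[of _ "fscale X (-1) f"]) auto
      show "\<zero>\<^bsub>ualg X A\<^esub> \<oplus>\<^bsub>ualg X A\<^esub> f = f"
        using ext[of f] f by (auto simp: extensional_def)
    qed (auto simp: D(2-5) algebra_simps)
    show "comm_monoid (ualg X A)"
    proof (rule comm_monoidI)
      fix f assume f: "f \<in> carrier (ualg X A)"
      show "\<one>\<^bsub>ualg X A\<^esub> \<otimes>\<^bsub>ualg X A\<^esub> f = f"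
        using ext[of f] f by (auto simp: extensional_def)
    qed (auto simp: D(2-5) algebra_simps)
  qed (auto simp: algebra_simps)
qed

lemma closed_ideal_iff:
  assumes X: "compact_space X" and A: "closed_subalgebra X A"
  shows "closed_ideal X A I \<longleftrightarrow> unif_ideal X A I"
proof -
  interpret cring "ualg X A" by (rule cring_ualg[OF X A])
  have cl: "closedin (subtopology (unif_top X) A) I \<longleftrightarrow> I \<subseteq> A \<and> (\<forall>f\<in>A. unif_approx X I f \<longrightarrow> f \<in> I)"
    by (rule closedin_subtopology_unif_top[OF X closed_subalgebraD(1)[OF A]])
  show ?thesis
  proof
    assume "closed_ideal X A I"
    then have I: "ideal I (ualg X A)" and c: "I \<subseteq> A" "\<forall>f\<in>A. unif_approx X I f \<longrightarrow> f \<in> I"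
      unfolding closed_ideal_def cl by auto
    have "fconst X 0 \<in> I"
      using additive_subgroup.zero_closed[OF ideal.axioms(1)[OF I]] by simp
    moreover have "fadd X f g \<in> I" if "f \<in> I" "g \<in> I" for f g
      using additive_subgroup.a_closed[OF ideal.axioms(1)[OF I] that] by simp
    moreover have "fmul X f g \<in> I" if "f \<in> I" "g \<in> A" for f g
      using ideal.I_r_closed[OF I that(1)] that(2) by simp
    ultimately show "unif_ideal X A I" using c unfolding unif_ideal_def by blast
  next
    assume I: "unif_ideal X A I"
    have "ideal I (ualg X A)"
    proof (rule idealI)
      show "ring (ualg X A)" by (rule ring_axioms)
      show "subgroup I (add_monoid (ualg X A))"
      proof (rule add.subgroupI)
        show "I \<subseteq> carrier (ualg X A)" "I \<noteq> {}" using I unfolding unif_ideal_def by auto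
        fix f assume f: "f \<in> I"
        then have fA: "f \<in> A" using I unfolding unif_ideal_def by auto
        have "\<ominus>\<^bsub>ualg X A\<^esub> f = fmul X f (fconst X (-1))"
        proof (rule minus_equality)
          show "fmul X f (fconst X (- 1)) \<oplus>\<^bsub>ualg X A\<^esub> f = \<zero>\<^bsub>ualg X A\<^esub>" by auto
          show "f \<in> carrier (ualg X A)" using fA by simp
          show "fmul X f (fconst X (- 1)) \<in> carrier (ualg X A)"
            unfolding carrier_ualg by (intro closed_subalgebraD(2,4)[OF A] fA)
        qed
        also have "\<dots> \<in> I" using I f closed_subalgebraD(2)[OF A] unfolding unif_ideal_def by blast
        finally show "\<ominus>\<^bsub>ualg X A\<^esub> f \<in> I" .
        fix g assume "g \<in> I"
        with f show "f \<oplus>\<^bsub>ualg X A\<^esub> g \<in> I" using I unfolding unif_ideal_def by simp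
      qed
      fix f g assume fg: "f \<in> I" "g \<in> carrier (ualg X A)"
      then show "f \<otimes>\<^bsub>ualg X A\<^esub> g \<in> I" using I unfolding unif_ideal_def by simp
      have "g \<otimes>\<^bsub>ualg X A\<^esub> f = fmul X f g" by (auto simp: mult.commute)
      then show "g \<otimes>\<^bsub>ualg X A\<^esub> f \<in> I" using I fg unfolding unif_ideal_def by simp
    qed
    then show "closed_ideal X A I" using I unfolding closed_ideal_def cl unif_ideal_def by blast
  qed
qed

lemma unif_idealD:
  assumes "unif_ideal X A I"
  shows "f \<in> I \<Longrightarrow> f \<in> A" "fconst X 0 \<in> I"
    "f \<in> I \<Longrightarrow> g \<in> I \<Longrightarrow> fadd X f g \<in> I" "f \<in> I \<Longrightarrow> g \<in> A \<Longrightarrow> fmul X f g \<in> I"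
    "f \<in> A \<Longrightarrow> unif_approx X I f \<Longrightarrow> f \<in> I"
  using assms unfolding unif_ideal_def by blast+

text \<open>Contractivity is stated through pointwise bounds, so that it covers empty spaces and can
  be applied before any supremum norm is computed. The two conditions that mention \<open>I\<close>
  are the ones that have to be re-established at each stage of the tower with the ideal of that
  stage.\<close>

locale ideal_retraction =
  fixes X :: "'x topology" and A :: "('x \<Rightarrow> complex) set"
    and Y :: "'y topology" and B :: "('y \<Rightarrow> complex) set"
    and p :: "'y \<Rightarrow> 'x" and T :: "('y \<Rightarrow> complex) \<Rightarrow> 'x \<Rightarrow> complex"
    and I :: "('x \<Rightarrow> complex) set"
  assumes A: "uniform_algebra X A" and B: "uniform_algebra Y B"
    and p: "continuous_map Y X p" and onto: "p ` topspace Y = topspace X"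
    and pb: "f \<in> A \<Longrightarrow> pullback Y p f \<in> B"
    and T: "g \<in> B \<Longrightarrow> T g \<in> A"
    and T_add: "g \<in> B \<Longrightarrow> k \<in> B \<Longrightarrow> T (fadd Y g k) = fadd X (T g) (T k)"
    and T_scale: "g \<in> B \<Longrightarrow> T (fscale Y c g) = fscale X c (T g)"
    and T_bound: "g \<in> B \<Longrightarrow> \<forall>y\<in>topspace Y. cmod (g y) \<le> e \<Longrightarrow> x \<in> topspace X \<Longrightarrow> cmod (T g x) \<le> e"
    and T_pb: "f \<in> A \<Longrightarrow> T (pullback Y p f) = f"
    and I: "closed_ideal X A I"
    and T_mult: "g \<in> B \<Longrightarrow> k \<in> B \<Longrightarrow> (\<lambda>x\<in>topspace X. T (fmul Y g k) x - T g x * T k x) \<in> I"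
    and T_hull: "g \<in> B \<Longrightarrow> y \<in> topspace Y \<Longrightarrow> p y \<in> zero_hull X I \<Longrightarrow> T g (p y) = g y"
begin

section \<open>Ideals and hulls under a retraction\<close>

lemmas cX = uniform_algebraD(1)[OF A] and cY = uniform_algebraD(1)[OF B]
lemmas subA = uniform_algebraD(3)[OF A] and subB = uniform_algebraD(3)[OF B]
lemmas opA = closed_subalgebraD(2-5)[OF subA] and opB = closed_subalgebraD(2-5)[OF subB]

lemma idI: "unif_ideal X A I"
  using I closed_ideal_iff[OF cX subA] by simp

lemma extA: "f \<in> A \<Longrightarrow> f \<in> extensional (topspace X)"
  using uniform_algebraD(4)[OF A] cfun_extensional by blast

lemma extB: "f \<in> B \<Longrightarrow> f \<in> extensional (topspace Y)"
  using uniform_algebraD(4)[OF B] cfun_extensional by blast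

lemma pY: "y \<in> topspace Y \<Longrightarrow> p y \<in> topspace X"
  using onto by blast

abbreviation hullY where "hullY \<equiv> {y \<in> topspace Y. p y \<in> zero_hull X I}"

text \<open>Preimages under \<open>T\<close> and, for \<open>drop\<close>, under the pullback. Since
  \<open>T\<close> undoes the pullback, \<open>drop\<close> always undoes \<open>lift\<close>; the
  other order works only above \<open>lift I\<close>, which absorbs the kernel of
  \<open>T\<close>.\<close>

definition lift :: "('x \<Rightarrow> complex) set \<Rightarrow> ('y \<Rightarrow> complex) set" where
  "lift K = {g \<in> B. T g \<in> K}"

definition drop :: "('y \<Rightarrow> complex) set \<Rightarrow> ('x \<Rightarrow> complex) set" where
  "drop J = {f \<in> A. pullback Y p f \<in> J}"

lemma T_diff:
  assumes "g \<in> B" "k \<in> B"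
  shows "(\<lambda>y\<in>topspace Y. g y - k y) \<in> B" "T (\<lambda>y\<in>topspace Y. g y - k y) = (\<lambda>x\<in>topspace X. T g x - T k x)"
proof -
  have *: "(\<lambda>y\<in>topspace Y. g y - k y) = fadd Y g (fscale Y (-1) k)"
    by auto
  show "(\<lambda>y\<in>topspace Y. g y - k y) \<in> B"
    unfolding * using assms opB by blast
  show "T (\<lambda>y\<in>topspace Y. g y - k y) = (\<lambda>x\<in>topspace X. T g x - T k x)"
  proof -
    have "T (fadd Y g (fscale Y (-1) k)) = fadd X (T g) (T (fscale Y (-1) k))"
      by (intro T_add assms opB)
    also have "\<dots> = fadd X (T g) (fscale X (-1) (T k))"
      by (simp only: T_scale[OF assms(2)])
    finally show ?thesis unfolding * by auto
  qed
qed

lemma T_contract: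
  assumes "g \<in> B" "k \<in> B" "\<forall>y\<in>topspace Y. cmod (g y - k y) \<le> e" "x \<in> topspace X"
  shows "cmod (T g x - T k x) \<le> e"
  using T_bound[OF T_diff(1)[OF assms(1,2)], of e x] assms by (simp add: T_diff(2))

lemma T_zero: "T (fconst Y 0) = fconst X 0"
proof -
  have "pullback Y p (fconst X 0) = fconst Y 0"
    by (auto simp: pullback_def compose_def pY)
  then show ?thesis using T_pb[OF opA(1)[of 0]] by simp
qed

text \<open>Although \<open>T\<close> is no homomorphism, \<open>T (g k)\<close> is the sum of the
  defect \<open>T (g k) - T g T k\<close>, which lies in \<open>I\<close> and hence in
  \<open>K\<close>, and of \<open>T g T k\<close>, which lies in \<open>K\<close> as soon as
  \<open>T g\<close> does. Contractivity of \<open>T\<close> gives closedness.\<close>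

lemma closed_ideal_lift:
  assumes K: "closed_ideal X A K" and IK: "I \<subseteq> K"
  shows "closed_ideal Y B (lift K)"
proof -
  have iK: "unif_ideal X A K" using K closed_ideal_iff[OF cX subA] by simp
  note K = unif_idealD[OF iK]
  have "fmul Y g k \<in> lift K" if "g \<in> lift K" "k \<in> B" for g k
  proof -
    have g: "g \<in> B" "T g \<in> K" using that by (auto simp: lift_def)
    have "fmul X (T g) (T k) \<in> K" using K(4) g T that by blast
    moreover have "(\<lambda>x\<in>topspace X. T (fmul Y g k) x - T g x * T k x) \<in> K"
      using T_mult[OF g(1) that(2)] IK by blast
    ultimately have "fadd X (\<lambda>x\<in>topspace X. T (fmul Y g k) x - T g x * T k x) (fmul X (T g) (T k)) \<in> K"
      using K(3) by blast
    also have "fadd X (\<lambda>x\<in>topspace X. T (fmul Y g k) x - T g x * T k x) (fmul X (T g) (T k))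
        = T (fmul Y g k)"
      using extA[OF T, of "fmul Y g k"] opB(3)[OF g(1) that(2)] by (auto simp: extensional_def)
    finally show ?thesis using opB(3)[OF g(1) that(2)] by (simp add: lift_def)
  qed
  moreover have "fadd Y g k \<in> lift K" if "g \<in> lift K" "k \<in> lift K" for g k
    using that opB(2) K(3) by (simp add: lift_def T_add)
  moreover have "fconst Y 0 \<in> lift K"
    using opB(1) K(2) by (simp add: lift_def T_zero)
  moreover have "g \<in> lift K" if g: "g \<in> B" "unif_approx Y (lift K) g" for g
  proof -
    have "unif_approx X K (T g)"
    proof (rule unif_approx_image[OF g(2), of 1])
      fix b e assume "b \<in> lift K" "\<forall>y\<in>topspace Y. cmod (g y - b y) \<le> e"
      then show "T b \<in> K \<and> (\<forall>x\<in>topspace X. cmod (T g x - T b x) \<le> 1 * e)"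
        using T_contract[OF g(1)] by (simp add: lift_def)
    qed simp
    then show ?thesis using K(5) g T by (simp add: lift_def)
  qed
  ultimately have "unif_ideal Y B (lift K)"
    unfolding unif_ideal_def by (auto simp: lift_def)
  then show ?thesis using closed_ideal_iff[OF cY subB] by simp
qed

lemma closed_ideal_drop:
  assumes J: "closed_ideal Y B J"
  shows "closed_ideal X A (drop J)"
proof -
  have iJ: "unif_ideal Y B J" using J closed_ideal_iff[OF cY subB] by simp
  note J = unif_idealD[OF iJ]
  have ops: "pullback Y p (fadd X f g) = fadd Y (pullback Y p f) (pullback Y p g)"
     "pullback Y p (fmul X f g) = fmul Y (pullback Y p f) (pullback Y p g)"
     "pullback Y p (fconst X c) = fconst Y c" for f g c
    by (auto simp: pullback_def compose_def pY)
  have "f \<in> drop J" if f: "f \<in> A" "unif_approx X (drop J) f" for f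
  proof -
    have "unif_approx Y J (pullback Y p f)"
      by (rule unif_approx_image[OF f(2), of 1]) (auto simp: drop_def pY)
    then show ?thesis using J(5) pb f by (simp add: drop_def)
  qed
  then have "unif_ideal X A (drop J)"
    using J opA pb unfolding unif_ideal_def by (auto simp: drop_def ops)
  then show ?thesis using closed_ideal_iff[OF cX subA] by simp
qed

lemma drop_lift: "K \<subseteq> A \<Longrightarrow> drop (lift K) = K"
  by (auto simp: drop_def lift_def T_pb pb)

text \<open>\<open>g\<close> and the pullback of \<open>T g\<close> have the same image under
  \<open>T\<close>. Their difference is therefore in the kernel of \<open>T\<close>, hence in
  \<open>lift I\<close> and in \<open>J\<close>, so one of them is in \<open>J\<close> if and only
  if the other is.\<close>

lemma lift_drop:
  assumes J: "closed_ideal Y B J" and IJ: "lift I \<subseteq> J"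
  shows "lift (drop J) = J"
proof -
  have iJ: "unif_ideal Y B J" using J closed_ideal_iff[OF cY subB] by simp
  note J = unif_idealD[OF iJ]
  have "pullback Y p (T g) \<in> J \<longleftrightarrow> g \<in> J" if g: "g \<in> B" for g
  proof -
    let ?h = "pullback Y p (T g)"
    have h: "?h \<in> B" using pb T g by blast
    have d: "(\<lambda>y\<in>topspace Y. g y - k y) \<in> J" if "g \<in> B" "k \<in> B" "T g = T k" for g k
    proof -
      have "T (\<lambda>y\<in>topspace Y. g y - k y) = fconst X 0"
        using T_diff(2)[OF that(1,2)] that(3) by auto
      then show ?thesis
        using IJ T_diff(1)[OF that(1,2)] unif_idealD(2)[OF idI] by (auto simp: lift_def)
    qed
    have e: "g \<in> J" if "g \<in> B" "k \<in> B" "T g = T k" "k \<in> J" for g k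
    proof -
      have "fadd Y (\<lambda>y\<in>topspace Y. g y - k y) k \<in> J"
        using J(3) d that by blast
      also have "fadd Y (\<lambda>y\<in>topspace Y. g y - k y) k = g"
        using extB[OF that(1)] by (auto simp: extensional_def)
      finally show ?thesis .
    qed
    show ?thesis using e[of g ?h] e[of ?h g] h g T_pb T by auto
  qed
  then show ?thesis using J(1) T by (auto simp: lift_def drop_def)
qed

text \<open>One inclusion tests with pullbacks of elements of \<open>I\<close>. The other is the
  evaluation property: over the hull, \<open>g y\<close> is the value at \<open>p y\<close> of
  \<open>T g\<close>, which belongs to \<open>I\<close>.\<close>

lemma zero_hull_lift: "zero_hull Y (lift I) = hullY"
proof (intro equalityI subsetI)
  fix y assume y: "y \<in> zero_hull Y (lift I)"
  then have yY: "y \<in> topspace Y" by (simp add: zero_hull_def)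
  have "f (p y) = 0" if "f \<in> I" for f
  proof -
    have "pullback Y p f \<in> lift I"
      using that unif_idealD(1)[OF idI] pb T_pb by (auto simp: lift_def)
    then have "pullback Y p f y = 0" using y unfolding zero_hull_def by blast
    then show ?thesis using yY by simp
  qed
  then show "y \<in> hullY" using yY pY by (simp add: zero_hull_def)
next
  fix y assume y: "y \<in> hullY"
  have "g y = 0" if "g \<in> lift I" for g
  proof -
    have "g \<in> B" "T g \<in> I" using that by (auto simp: lift_def)
    then have "T g (p y) = g y" "T g (p y) = 0"
      using T_hull[of g y] y unfolding zero_hull_def by blast+
    then show ?thesis by simp
  qed
  then show "y \<in> zero_hull Y (lift I)"
    using y unfolding zero_hull_def by blast
qed

lemma lift_Int_pullback: "lift I \<inter> pullback Y p ` A = pullback Y p ` I"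
proof -
  have "pullback Y p f \<in> lift I \<longleftrightarrow> f \<in> I" if "f \<in> A" for f
    using that by (simp add: lift_def T_pb pb)
  moreover have "I \<subseteq> A"
    using unif_idealD(1)[OF idI] by blast
  ultimately show ?thesis by blast
qed

lemma p_hullY: "p ` hullY = zero_hull X I"
proof
  show "zero_hull X I \<subseteq> p ` hullY"
  proof
    fix x assume x: "x \<in> zero_hull X I"
    then have "x \<in> p ` topspace Y" unfolding onto zero_hull_def by simp
    then show "x \<in> p ` hullY" using x by blast
  qed
qed blast

text \<open>Over the hull, \<open>g y\<close> depends only on \<open>p y\<close> for every
  \<open>g\<close> in \<open>B\<close>, and \<open>B\<close> separates points.\<close>

lemma inj_on_hullY: "inj_on p hullY"
proof (rule inj_onI)
  fix y y' assume y: "y \<in> hullY" "y' \<in> hullY" "p y = p y'"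
  then have "g y = g y'" if "g \<in> B" for g
    using T_hull[OF that] by (metis (no_types, lifting) mem_Collect_eq)
  then show "y = y'" using B y unfolding uniform_algebra_def by blast
qed

text \<open>A continuous bijection from a compact space onto a Hausdorff space is a homeomorphism;
  compactness of the domain comes from closedness of the hull.\<close>

lemma homeomorphic_hull:
  "homeomorphic_map (subtopology Y hullY) (subtopology X (zero_hull X I)) p"
proof (rule continuous_imp_homeomorphic_map)
  have "closedin X (zero_hull X I)"
  proof -
    have "closedin X {x \<in> topspace X. f x \<in> {0}}" if "f \<in> I" for f
      using that unif_idealD(1)[OF idI] uniform_algebraD(4)[OF A]
      by (intro closedin_continuous_map_preimage[of X euclidean]) (auto simp: cfun_def)
    \<comment> \<open>The zero function is in \<open>I\<close>, so this is an intersection of a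
      nonempty family and stays inside the space.\<close>
    then have "closedin X (\<Inter>f\<in>I. {x \<in> topspace X. f x \<in> {0}})"
      using unif_idealD(2)[OF idI] by (intro closedin_INT) auto
    also have "(\<Inter>f\<in>I. {x \<in> topspace X. f x \<in> {0}}) = zero_hull X I"
      using unif_idealD(2)[OF idI] by (auto simp: zero_hull_def)
    finally show ?thesis .
  qed
  then have "closedin Y hullY"
    by (rule closedin_continuous_map_preimage[OF p])
  then show "compact_space (subtopology Y hullY)"
    using cY closedin_compact_space compact_space_subtopology by blast
  show "Hausdorff_space (subtopology X (zero_hull X I))"
    using uniform_algebraD(2)[OF A] Hausdorff_space_subtopology by blast
  show "continuous_map (subtopology Y hullY) (subtopology X (zero_hull X I)) p"
    using p by (auto simp: continuous_map_in_subtopology continuous_map_from_subtopology)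
  have "topspace Y \<inter> hullY = hullY" "topspace X \<inter> zero_hull X I = zero_hull X I"
    by (auto simp: zero_hull_def)
  then show "p ` topspace (subtopology Y hullY) = topspace (subtopology X (zero_hull X I))"
    "inj_on p (topspace (subtopology Y hullY))"
    using p_hullY inj_on_hullY by auto
qed

end

section \<open>Restriction algebras and quotient algebras\<close>

lemma supnorm_props:
  assumes "compact_space X" "f \<in> cfun X"
  shows "x \<in> topspace X \<Longrightarrow> cmod (f x) \<le> supnorm (topspace X) f"
    and "0 \<le> c \<Longrightarrow> (\<And>x. x \<in> topspace X \<Longrightarrow> cmod (f x) \<le> c) \<Longrightarrow> supnorm (topspace X) f \<le> c"
    and "0 \<le> supnorm (topspace X) f"
proof -
  obtain C where C: "0 \<le> C" "\<And>x. x \<in> topspace X \<Longrightarrow> cmod (f x) \<le> C"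
    using cfun_bounded[OF assms] by blast
  then have bdd: "bdd_above ((\<lambda>x. cmod (f x)) ` topspace X)"
    by (intro bdd_aboveI[of _ C]) auto
  show 1: "cmod (f x) \<le> supnorm (topspace X) f" if "x \<in> topspace X" for x
    using cSUP_upper[OF that bdd] that by (auto simp: supnorm_def)
  show "0 \<le> c \<Longrightarrow> (\<And>x. x \<in> topspace X \<Longrightarrow> cmod (f x) \<le> c) \<Longrightarrow> supnorm (topspace X) f \<le> c"
    unfolding supnorm_def by (auto intro: cSUP_least)
  show "0 \<le> supnorm (topspace X) f"
  proof (cases "topspace X = {}")
    case False
    then obtain x where "x \<in> topspace X" by blast
    then show ?thesis using 1 norm_ge_zero order_trans by blast
  qed (simp add: supnorm_def)
qed

lemma coset_iff:
  assumes X: "compact_space X" and A: "closed_subalgebra X A" and J: "unif_ideal X A J" and g: "g \<in> A"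
  shows "f \<in> J +>\<^bsub>ualg X A\<^esub> g \<longleftrightarrow> f \<in> A \<and> (\<lambda>x\<in>topspace X. f x - g x) \<in> J"
proof -
  have ext: "f \<in> A \<Longrightarrow> f \<in> extensional (topspace X)" for f
    using closed_subalgebra_subset_cfun[OF X A] cfun_extensional by blast
  show ?thesis
  proof
    assume "f \<in> J +>\<^bsub>ualg X A\<^esub> g"
    then obtain j where j: "j \<in> J" "f = fadd X j g"
      by (auto simp: a_r_coset_def')
    have "(\<lambda>x\<in>topspace X. f x - g x) = j"
      using j ext[OF unif_idealD(1)[OF J j(1)]] by (auto simp: extensional_def)
    then show "f \<in> A \<and> (\<lambda>x\<in>topspace X. f x - g x) \<in> J"
      using j closed_subalgebraD(3)[OF A unif_idealD(1)[OF J j(1)] g] by simp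
  next
    assume f: "f \<in> A \<and> (\<lambda>x\<in>topspace X. f x - g x) \<in> J"
    have "f = fadd X (\<lambda>x\<in>topspace X. f x - g x) g"
      using f ext[of f] by (auto simp: extensional_def)
    then show "f \<in> J +>\<^bsub>ualg X A\<^esub> g"
      using f unfolding a_r_coset_def' add_ualg by blast
  qed
qed

text \<open>This reduces the quotient structure to computations with representatives. The scalar
  multiple in \<open>quot_nalg\<close> is a union over all representatives \<open>k\<close> of a
  coset; all members of this union coincide because \<open>c k - c f\<close> is the product of
  \<open>k - f\<close> with a constant and so lies in \<open>J\<close>.\<close>

lemma quot_nalg_cosets:
  assumes X: "compact_space X" and A: "closed_subalgebra X A" and J: "closed_ideal X A J"
  defines "Q \<equiv> quot_nalg (ualg X A) J" and "r \<equiv> \<lambda>f. J +>\<^bsub>ualg X A\<^esub> f"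
  shows "carrier Q = r ` A"
    and "\<one>\<^bsub>Q\<^esub> = r (fconst X 1)"
    and "f \<in> A \<Longrightarrow> g \<in> A \<Longrightarrow> r f \<otimes>\<^bsub>Q\<^esub> r g = r (fmul X f g)"
    and "f \<in> A \<Longrightarrow> g \<in> A \<Longrightarrow> r f \<oplus>\<^bsub>Q\<^esub> r g = r (fadd X f g)"
    and "f \<in> A \<Longrightarrow> c \<odot>\<^bsub>Q\<^esub> r f = r (fscale X c f)"
    and "f \<in> A \<Longrightarrow> g \<in> A \<Longrightarrow> r f = r g \<longleftrightarrow> (\<lambda>x\<in>topspace X. f x - g x) \<in> J"
    and "f \<in> A \<Longrightarrow> f \<in> r f"
proof -
  interpret J: ideal J "ualg X A" using J by (simp add: closed_ideal_def)
  interpret cring "ualg X A" by (rule cring_ualg[OF X A])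
  have iJ: "unif_ideal X A J" using J closed_ideal_iff[OF X A] by simp
  note mem = coset_iff[OF X A iJ]
  note D = closed_subalgebraD[OF A]
  show "carrier Q = r ` A"
    by (auto simp: Q_def quot_nalg_def FactRing_def A_RCOSETS_def' r_def)
  show "\<one>\<^bsub>Q\<^esub> = r (fconst X 1)"
    by (simp add: Q_def quot_nalg_def FactRing_def r_def)
  show self: "f \<in> A \<Longrightarrow> f \<in> r f" for f
    using mem[of f f] unif_idealD(2)[OF iJ] by (simp add: r_def)
  have indep: "r k = r f" if "k \<in> r f" "f \<in> A" for f k
    using J.a_repr_independence'[of k f] that by (simp add: r_def)
  show "r f = r g \<longleftrightarrow> (\<lambda>x\<in>topspace X. f x - g x) \<in> J" if "f \<in> A" "g \<in> A" for f g
    using indep[of f g] self[of f] mem[of g f] that by (auto simp: r_def)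
  show "f \<in> A \<Longrightarrow> g \<in> A \<Longrightarrow> r f \<otimes>\<^bsub>Q\<^esub> r g = r (fmul X f g)"
    using J.rcoset_mult_add[of f g] by (simp add: Q_def quot_nalg_def FactRing_def r_def)
  show "f \<in> A \<Longrightarrow> g \<in> A \<Longrightarrow> r f \<oplus>\<^bsub>Q\<^esub> r g = r (fadd X f g)"
    using J.a_rcos_sum[of f g] by (simp add: Q_def quot_nalg_def FactRing_def r_def)
  show "c \<odot>\<^bsub>Q\<^esub> r f = r (fscale X c f)" if f: "f \<in> A"
  proof -
    have "r (fscale X c k) = r (fscale X c f)" if k: "k \<in> r f" for k
    proof (rule indep)
      have k': "k \<in> A" "(\<lambda>x\<in>topspace X. k x - f x) \<in> J"
        using k mem[OF f] by (auto simp: r_def)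
      have "(\<lambda>x\<in>topspace X. fscale X c k x - fscale X c f x)
          = fmul X (\<lambda>x\<in>topspace X. k x - f x) (fconst X c)"
        by (auto simp: algebra_simps)
      also have "\<dots> \<in> J"
        using unif_idealD(4)[OF iJ k'(2)] D(2) by blast
      finally show "fscale X c k \<in> r (fscale X c f)"
        unfolding r_def using mem[OF D(5)[OF f]] D(5)[OF k'(1)] by blast
      show "fscale X c f \<in> A" using D(5) f by blast
    qed
    then have "(\<Union>k\<in>r f. r (fscale X c k)) = r (fscale X c f)"
      using self[OF f] by blast
    then show ?thesis
      by (simp add: Q_def quot_nalg_def r_def)
  qed
qed

context ideal_retraction begin

lemma restriction_iso:
  defines "\<Phi> \<equiv> \<lambda>k :: 'x \<Rightarrow> complex. \<lambda>y\<in>hullY. k (p y)"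
  shows "isometric_iso (fun_nalg (zero_hull X I) (restrictions A (zero_hull X I)))
           (fun_nalg hullY (restrictions B hullY)) \<Phi>" (is ?iso)
    and "f \<in> A \<Longrightarrow> \<Phi> (restrict f (zero_hull X I)) = restrict (pullback Y p f) hullY"
proof -
  let ?H = "zero_hull X I"
  show pb': "\<Phi> (restrict f ?H) = restrict (pullback Y p f) hullY" for f
    by (auto simp: \<Phi>_def restrict_def)
  have ops: "\<Phi> (\<lambda>x\<in>?H. f x * g x) = (\<lambda>y\<in>hullY. \<Phi> f y * \<Phi> g y)"
    "\<Phi> (\<lambda>x\<in>?H. f x + g x) = (\<lambda>y\<in>hullY. \<Phi> f y + \<Phi> g y)"
    "\<Phi> (\<lambda>x\<in>?H. c * f x) = (\<lambda>y\<in>hullY. c * \<Phi> f y)"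
    "\<Phi> (\<lambda>x\<in>?H. 1) = (\<lambda>y\<in>hullY. 1)" for f g c
    by (auto simp: \<Phi>_def restrict_def)
  have mem: "\<Phi> k \<in> restrictions B hullY" if "k \<in> restrictions A ?H" for k
  proof -
    obtain f where f: "f \<in> A" "k = restrict f ?H"
      using \<open>k \<in> restrictions A ?H\<close> by (auto simp: restrictions_def)
    show ?thesis
      unfolding f(2) pb' restrictions_def using pb[OF f(1)] by (rule imageI)
  qed
  have hom: "alg_hom (fun_nalg ?H (restrictions A ?H)) (fun_nalg hullY (restrictions B hullY)) \<Phi>"
    unfolding alg_hom_def lin_map_def
    by (intro conjI ring_hom_memI ballI allI funcsetI;
        simp only: carrier_ualg mult_ualg add_ualg one_ualg smult_ualg)
      (rule mem ops | assumption)+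
  have inj: "inj_on \<Phi> (restrictions A ?H)"
  proof (rule inj_onI)
    fix k l assume kl: "k \<in> restrictions A ?H" "l \<in> restrictions A ?H" "\<Phi> k = \<Phi> l"
    show "k = l"
    proof (rule extensionalityI[of _ ?H])
      show "k \<in> extensional ?H" "l \<in> extensional ?H" using kl by (auto simp: restrictions_def)
      fix x assume "x \<in> ?H"
      then obtain y where y: "y \<in> hullY" "x = p y" using p_hullY by blast
      then have "\<Phi> k y = k x" "\<Phi> l y = l x" by (simp_all add: \<Phi>_def)
      then show "k x = l x" using kl(3) by simp
    qed
  qed
  have "restrictions B hullY \<subseteq> \<Phi> ` restrictions A ?H"
  proof
    fix k assume "k \<in> restrictions B hullY"
    then obtain g where g: "g \<in> B" "k = restrict g hullY" by (auto simp: restrictions_def)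
    \<comment> \<open>Surjectivity: over the hull, \<open>g\<close> is the composition of
      \<open>T g\<close> with \<open>p\<close>.\<close>
    have "k = \<Phi> (restrict (T g) ?H)"
      unfolding g(2) \<Phi>_def
    proof (rule restrict_ext)
      fix y assume "y \<in> hullY"
      then show "g y = restrict (T g) ?H (p y)" using T_hull[OF g(1), of y] by simp
    qed
    then show "k \<in> \<Phi> ` restrictions A ?H"
      unfolding restrictions_def using T[OF g(1)] by blast
  qed
  then have bij: "bij_betw \<Phi> (restrictions A ?H) (restrictions B hullY)"
    using inj mem by (auto simp: bij_betw_def)
  have nrm: "supnorm hullY (\<Phi> k) = supnorm ?H k" for k
  proof -
    have "(\<lambda>y. cmod (\<Phi> k y)) ` hullY = (\<lambda>x. cmod (k x)) ` (p ` hullY)"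
      unfolding image_image by (rule image_cong) (auto simp: \<Phi>_def)
    moreover have "hullY = {} \<longleftrightarrow> ?H = {}"
      using image_is_empty[of p hullY] unfolding p_hullY by (rule sym)
    ultimately show ?thesis
      unfolding supnorm_def p_hullY by (simp only:)
  qed
  show ?iso
    unfolding isometric_iso_def using hom bij nrm by simp
qed

lemma cfA: "f \<in> A \<Longrightarrow> f \<in> cfun X" and cfB: "g \<in> B \<Longrightarrow> g \<in> cfun Y"
  using uniform_algebraD(4) A B by blast+

lemma T_supnorm: "g \<in> B \<Longrightarrow> supnorm (topspace X) (T g) \<le> supnorm (topspace Y) g"
  using supnorm_props[OF cY cfB, of g] supnorm_props(2)[OF cX cfA[OF T]]
    T_bound[of g "supnorm (topspace Y) g"] by blast

lemma pb_supnorm: "f \<in> A \<Longrightarrow> supnorm (topspace Y) (pullback Y p f) \<le> supnorm (topspace X) f"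
  by (rule supnorm_props(2)[OF cY cfB[OF pb]])
    (auto simp: pY intro: supnorm_props[OF cX cfA])

lemma closed_ideal_lift_I: "closed_ideal Y B (lift I)"
  using closed_ideal_lift[OF I] by simp

lemma lift_I_diff:
  assumes "g \<in> B" "k \<in> B"
  shows "(\<lambda>y\<in>topspace Y. g y - k y) \<in> lift I \<longleftrightarrow> (\<lambda>x\<in>topspace X. T g x - T k x) \<in> I"
  using T_diff[OF assms] by (simp add: lift_def)

text \<open>The isomorphism takes a coset to its image under \<open>T\<close>, which is a full coset
  because \<open>T\<close> undoes the pullback. \<open>T\<close> and the pullback both carry
  representatives to representatives without increasing the norm, so each of the two quotient norms
  bounds the other.\<close>

lemma quotient_iso:
  "isometric_iso (quot_nalg (ualg Y B) (lift I)) (quot_nalg (ualg X A) I) ((`) T)"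
proof -
  let ?Q = "quot_nalg (ualg Y B) (lift I)" and ?R = "quot_nalg (ualg X A) I"
  define q where "q g = lift I +>\<^bsub>ualg Y B\<^esub> g" for g
  define r where "r f = I +>\<^bsub>ualg X A\<^esub> f" for f
  note Q = quot_nalg_cosets[OF cY subB closed_ideal_lift_I, folded q_def]
  note R = quot_nalg_cosets[OF cX subA I, folded r_def]
  have iL: "unif_ideal Y B (lift I)"
    using closed_ideal_lift_I closed_ideal_iff[OF cY subB] by simp
  note memq = coset_iff[OF cY subB iL, folded q_def]
  note memr = coset_iff[OF cX subA idI, folded r_def]
  have pbq: "pullback Y p f \<in> q g" if "f \<in> r (T g)" "g \<in> B" for f g
  proof -
    have f: "f \<in> A" "(\<lambda>x\<in>topspace X. f x - T g x) \<in> I"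
      using that memr[OF T[OF that(2)]] by auto
    then show ?thesis
      using memq[OF that(2)] lift_I_diff[OF pb[OF f(1)] that(2)] pb[OF f(1)] by (simp add: T_pb)
  qed
  have Tr: "T k \<in> r (T g)" if "k \<in> q g" "g \<in> B" for k g
  proof -
    have k: "k \<in> B" "(\<lambda>y\<in>topspace Y. k y - g y) \<in> lift I"
      using that memq by auto
    then show ?thesis
      using memr[OF T[OF that(2)]] lift_I_diff[OF k(1) that(2)] T by simp
  qed
  have Tq: "T ` q g = r (T g)" if g: "g \<in> B" for g
  proof
    show "T ` q g \<subseteq> r (T g)" using Tr g by blast
    show "r (T g) \<subseteq> T ` q g"
    proof
      fix f assume f: "f \<in> r (T g)"
      then have "f = T (pullback Y p f)"
        using T_pb memr[OF T[OF g]] by simp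
      then show "f \<in> T ` q g" using pbq[OF f g] by blast
    qed
  qed
  have memb: "T ` K \<in> carrier ?R" if "K \<in> carrier ?Q" for K
    using that Tq T unfolding Q(1) R(1) by blast
  have addh: "T ` (K \<oplus>\<^bsub>?Q\<^esub> L) = T ` K \<oplus>\<^bsub>?R\<^esub> T ` L"
    if KL: "K \<in> carrier ?Q" "L \<in> carrier ?Q" for K L
  proof -
    obtain g k where gk: "g \<in> B" "k \<in> B" "K = q g" "L = q k"
      using KL Q(1) by auto
    show ?thesis
      unfolding gk(3,4) Q(4)[OF gk(1,2)] Tq[OF gk(1)] Tq[OF gk(2)] Tq[OF opB(2)[OF gk(1,2)]]
        R(4)[OF T[OF gk(1)] T[OF gk(2)]] T_add[OF gk(1,2)] by (rule refl)
  qed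
  have sch: "T ` (c \<odot>\<^bsub>?Q\<^esub> K) = c \<odot>\<^bsub>?R\<^esub> T ` K" if K: "K \<in> carrier ?Q" for c K
  proof -
    obtain g where g: "g \<in> B" "K = q g"
      using K Q(1) by auto
    show ?thesis
      unfolding g(2) Q(5)[OF g(1)] Tq[OF g(1)] Tq[OF opB(4)[OF g(1)]]
        R(5)[OF T[OF g(1)]] T_scale[OF g(1)] by (rule refl)
  qed
  have mulh: "T ` (K \<otimes>\<^bsub>?Q\<^esub> L) = T ` K \<otimes>\<^bsub>?R\<^esub> T ` L"
    if KL: "K \<in> carrier ?Q" "L \<in> carrier ?Q" for K L
  proof -
    \<comment> \<open>The only point where multiplicativity modulo \<open>I\<close> is needed: the
      defect vanishes in the quotient.\<close>
    obtain g k where gk: "g \<in> B" "k \<in> B" "K = q g" "L = q k"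
      using KL Q(1) by auto
    have "(\<lambda>x\<in>topspace X. T (fmul Y g k) x - fmul X (T g) (T k) x)
        = (\<lambda>x\<in>topspace X. T (fmul Y g k) x - T g x * T k x)" by auto
    then have "(\<lambda>x\<in>topspace X. T (fmul Y g k) x - fmul X (T g) (T k) x) \<in> I"
      using T_mult[OF gk(1,2)] by simp
    then have "r (T (fmul Y g k)) = r (fmul X (T g) (T k))"
      using R(6)[OF T[OF opB(3)[OF gk(1,2)]] opA(3)[OF T[OF gk(1)] T[OF gk(2)]]] by blast
    then show ?thesis
      unfolding gk(3,4) Q(3)[OF gk(1,2)] Tq[OF gk(1)] Tq[OF gk(2)] Tq[OF opB(3)[OF gk(1,2)]]
        R(3)[OF T[OF gk(1)] T[OF gk(2)]] .
  qed
  have oneh: "T ` \<one>\<^bsub>?Q\<^esub> = \<one>\<^bsub>?R\<^esub>"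
  proof -
    have "pullback Y p (fconst X 1) = fconst Y 1"
      by (auto simp: pullback_def compose_def pY)
    then have "T (fconst Y 1) = fconst X 1" using T_pb[OF opA(1)[of 1]] by simp
    then show ?thesis
      unfolding Q(2) R(2) Tq[OF opB(1)] by (rule arg_cong)
  qed
  have hom: "alg_hom ?Q ?R ((`) T)"
    unfolding alg_hom_def lin_map_def
    by (intro conjI ring_hom_memI ballI allI funcsetI) (assumption | rule memb addh sch mulh oneh)+
  have "inj_on ((`) T) (q ` B)"
  proof (rule inj_onI)
    fix K L assume "K \<in> q ` B" "L \<in> q ` B" and eq: "T ` K = T ` L"
    then obtain g k where gk: "g \<in> B" "k \<in> B" "K = q g" "L = q k" by auto
    then have "r (T g) = r (T k)" using eq Tq by simp
    then show "K = L"
      unfolding gk(3,4) Q(6)[OF gk(1,2)] lift_I_diff[OF gk(1,2)] R(6)[OF T[OF gk(1)] T[OF gk(2)]] .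
  qed
  moreover have "(`) T ` q ` B = r ` A"
  proof -
    have "(`) T ` q ` B = r ` (T ` B)"
      unfolding image_image using Tq by (rule image_cong[OF refl])
    also have "T ` B = A"
    proof
      show "A \<subseteq> T ` B"
      proof
        fix f assume "f \<in> A"
        then show "f \<in> T ` B" using T_pb[of f, symmetric] pb[of f] by blast
      qed
    qed (use T in blast)
    finally show ?thesis .
  qed
  ultimately have bij: "bij_betw ((`) T) (carrier ?Q) (carrier ?R)"
    unfolding Q(1) R(1) bij_betw_def by blast
  have nrm: "nrm ?R (T ` K) = nrm ?Q K" if K: "K \<in> carrier ?Q" for K
  proof -
    obtain g where g: "g \<in> B" "K = q g" using K Q(1) by auto
    let ?N = "supnorm (topspace X)" and ?M = "supnorm (topspace Y)"
    have rA: "r (T g) \<subseteq> A" and qB: "q g \<subseteq> B"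
      using memr[OF T[OF g(1)]] memq[OF g(1)] by auto
    have ne: "q g \<noteq> {}" "r (T g) \<noteq> {}" using Q(7)[OF g(1)] R(7)[OF T[OF g(1)]] by auto
    have bN: "bdd_below (?N ` r (T g))" and bM: "bdd_below (?M ` q g)"
      using rA qB supnorm_props(3)[OF cX cfA] supnorm_props(3)[OF cY cfB]
      by (auto intro!: bdd_belowI[of _ 0])
    have "(INF f\<in>r (T g). ?N f) \<le> (INF k\<in>q g. ?M k)"
    proof (rule cINF_mono[OF ne(1) bN])
      fix k assume "k \<in> q g"
      then show "\<exists>f\<in>r (T g). ?N f \<le> ?M k" using Tr[OF _ g(1)] T_supnorm qB by blast
    qed
    moreover have "(INF k\<in>q g. ?M k) \<le> (INF f\<in>r (T g). ?N f)"
    proof (rule cINF_mono[OF ne(2) bM])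
      fix f assume "f \<in> r (T g)"
      then show "\<exists>k\<in>q g. ?M k \<le> ?N f" using pbq[OF _ g(1)] pb_supnorm rA by blast
    qed
    ultimately show ?thesis
      unfolding g(2) Tq[OF g(1)] by (simp add: quot_nalg_def)
  qed
  show ?thesis
    unfolding isometric_iso_def using hom bij nrm by blast
qed

text \<open>Order is also reflected: applying the monotone \<open>lift\<close> to
  \<open>drop J \<subseteq> drop K\<close> gives back \<open>J \<subseteq> K\<close>.\<close>

lemma ideal_correspondence:
  "bij_betw drop {J. closed_ideal Y B J \<and> lift I \<subseteq> J} {K. closed_ideal X A K \<and> I \<subseteq> K}"
  "closed_ideal Y B J \<and> lift I \<subseteq> J \<and> closed_ideal Y B K \<and> lift I \<subseteq> K \<Longrightarrow>
    J \<subseteq> K \<longleftrightarrow> drop J \<subseteq> drop K"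
proof -
  have sub: "K \<subseteq> A" if "closed_ideal X A K" for K
    using that closed_ideal_iff[OF cX subA] unif_idealD(1) by blast
  have mono: "J \<subseteq> K \<Longrightarrow> drop J \<subseteq> drop K" "M \<subseteq> L \<Longrightarrow> lift M \<subseteq> lift L" for J K L M
    by (auto simp: drop_def lift_def)
  show "bij_betw drop {J. closed_ideal Y B J \<and> lift I \<subseteq> J} {K. closed_ideal X A K \<and> I \<subseteq> K}"
  proof (rule bij_betw_byWitness[where f' = lift])
    show "\<forall>J\<in>{J. closed_ideal Y B J \<and> lift I \<subseteq> J}. lift (drop J) = J" using lift_drop by blast
    show "\<forall>K\<in>{K. closed_ideal X A K \<and> I \<subseteq> K}. drop (lift K) = K" using drop_lift sub by blast
    show "drop ` {J. closed_ideal Y B J \<and> lift I \<subseteq> J} \<subseteq> {K. closed_ideal X A K \<and> I \<subseteq> K}"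
      using closed_ideal_drop mono(1)[of "lift I"] drop_lift[OF sub[OF I]] by auto
    show "lift ` {K. closed_ideal X A K \<and> I \<subseteq> K} \<subseteq> {J. closed_ideal Y B J \<and> lift I \<subseteq> J}"
      using closed_ideal_lift mono(2) by auto
  qed
  show "J \<subseteq> K \<longleftrightarrow> drop J \<subseteq> drop K"
    if "closed_ideal Y B J \<and> lift I \<subseteq> J \<and> closed_ideal Y B K \<and> lift I \<subseteq> K"
    using that mono lift_drop by metis
qed

end

section \<open>The invariant measure on a fibre\<close>

text \<open>The fibre of the extension over \<open>x\<close> is the product over \<open>f\<close> of
  the sets \<open>sqroots (f x)\<close>. Such a set has two elements, or one when
  \<open>f x = 0\<close>.\<close>

definition sqroots :: "complex \<Rightarrow> complex set" where
  "sqroots c = {w. w\<^sup>2 = c}"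

text \<open>The image of Haar measure on the group of sign changes under any orbit map. At a
  coordinate with \<open>c i = 0\<close> the factor is a point mass.\<close>

definition root_measure :: "'i set \<Rightarrow> ('i \<Rightarrow> complex) \<Rightarrow> ('i \<Rightarrow> complex) measure" where
  "root_measure I c = PiM I (\<lambda>i. uniform_count_measure (sqroots (c i)))"

definition flip :: "'i set \<Rightarrow> ('i \<Rightarrow> complex) \<Rightarrow> ('i \<Rightarrow> complex) \<Rightarrow> 'i \<Rightarrow> complex" where
  "flip I s w = (\<lambda>i\<in>I. s i * w i)"

lemma sqroots_eq: "w \<in> sqroots c \<Longrightarrow> sqroots c = {w, - w}"
  by (auto simp: sqroots_def power2_eq_iff)

lemma sqroots_nonempty: "sqroots c \<noteq> {}"
  using power2_csqrt[of c] by (auto simp: sqroots_def simp del: power2_csqrt)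

lemma finite_sqroots: "finite (sqroots c)"
  by (metis sqroots_eq finite.emptyI finite.insertI ex_in_conv)

lemma sqroots_sign: "s \<in> {1, -1} \<Longrightarrow> s * w \<in> sqroots c \<longleftrightarrow> w \<in> sqroots c"
  by (auto simp: sqroots_def)

lemma space_root_measure: "space (root_measure I c) = (\<Pi>\<^sub>E i\<in>I. sqroots (c i))"
  by (simp add: root_measure_def space_PiM space_uniform_count_measure)

lemma product_prob_space_sqroots: "product_prob_space (\<lambda>i. uniform_count_measure (sqroots (c i)))"
proof -
  have "prob_space (uniform_count_measure (sqroots (c i)))" for i
    by (intro prob_space_uniform_count_measure finite_sqroots sqroots_nonempty)
  then show ?thesis
    by (simp add: product_prob_space_def product_prob_space_axioms_def product_sigma_finite_def
        prob_space_imp_sigma_finite)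
qed

lemma prob_space_root_measure: "prob_space (root_measure I c)"
  unfolding root_measure_def
  by (intro prob_space_PiM prob_space_uniform_count_measure finite_sqroots sqroots_nonempty)

lemma measurable_flip:
  assumes s: "s \<in> I \<rightarrow> {1, -1}"
  shows "flip I s \<in> measurable (root_measure I c) (root_measure I c)"
  unfolding root_measure_def flip_def
proof (rule measurable_restrict)
  fix i assume i: "i \<in> I"
  have "(\<lambda>z. s i * z) \<in> measurable (uniform_count_measure (sqroots (c i))) (uniform_count_measure (sqroots (c i)))"
    using sqroots_sign[of "s i"] s i
    by (auto simp: measurable_def space_uniform_count_measure sets_uniform_count_measure)
  then show "(\<lambda>w. s i * w i) \<in> measurable (PiM I (\<lambda>i. uniform_count_measure (sqroots (c i))))
      (uniform_count_measure (sqroots (c i)))"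
    by (rule measurable_compose[OF measurable_component_singleton[OF i]])
qed

text \<open>It suffices to look at cylinders. Their preimages under a sign change are again
  cylinders, whose sides have the same cardinality and thus the same uniform measure.\<close>

lemma root_measure_flip:
  assumes s: "s \<in> I \<rightarrow> {1, -1}"
  shows "distr (root_measure I c) (root_measure I c) (flip I s) = root_measure I c"
proof -
  let ?M = "\<lambda>i. uniform_count_measure (sqroots (c i))"
  interpret product_prob_space ?M I by (rule product_prob_space_sqroots)
  note meas = measurable_flip[OF s, of c]
  show ?thesis
    unfolding root_measure_def
  proof (rule PiM_eq)
    show "sets (distr (PiM I ?M) (PiM I ?M) (flip I s)) = sets (PiM I ?M)" by simp
    fix J E assume J: "finite J" "J \<subseteq> I" and E: "\<And>j. j \<in> J \<Longrightarrow> E j \<in> sets (?M j)"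
    let ?E = "\<lambda>j. {w \<in> sqroots (c j). s j * w \<in> E j}"
    have E': "E j \<subseteq> sqroots (c j)" if "j \<in> J" for j
      using E[OF that] by (simp add: sets_uniform_count_measure)
    have sj: "s j \<in> {1, -1}" if "j \<in> J" for j using s J that by auto
    have cyl: "prod_emb I ?M J (Pi\<^sub>E J E) \<in> sets (PiM I ?M)"
      using J E by (intro sets_PiM_I) auto
    have "flip I s -` prod_emb I ?M J (Pi\<^sub>E J E) \<inter> space (PiM I ?M) = prod_emb I ?M J (Pi\<^sub>E J ?E)"
    proof (rule Set.set_eqI)
      fix w
      have "flip I s w \<in> space (PiM I ?M)" if "w \<in> space (PiM I ?M)"
        using measurable_space[OF meas] that by (simp add: root_measure_def)
      then show "w \<in> flip I s -` prod_emb I ?M J (Pi\<^sub>E J E) \<inter> space (PiM I ?M) \<longleftrightarrow> w \<in> prod_emb I ?M J (Pi\<^sub>E J ?E)"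
        using J(2) by (auto simp: prod_emb_def space_PiM space_uniform_count_measure flip_def PiE_iff subset_eq)
    qed
    then have "emeasure (distr (PiM I ?M) (PiM I ?M) (flip I s)) (prod_emb I ?M J (Pi\<^sub>E J E))
        = emeasure (PiM I ?M) (prod_emb I ?M J (Pi\<^sub>E J ?E))"
      using emeasure_distr[OF meas[unfolded root_measure_def] cyl] by simp
    also have "\<dots> = (\<Prod>j\<in>J. emeasure (?M j) (?E j))"
      using J by (intro emeasure_PiM_emb) (auto simp: sets_uniform_count_measure)
    also have "\<dots> = (\<Prod>j\<in>J. emeasure (?M j) (E j))"
    proof (rule prod.cong[OF refl])
      fix j assume j: "j \<in> J"
      \<comment> \<open>Multiplication by a sign is its own inverse.\<close>
      have "bij_betw (\<lambda>w. s j * w) (?E j) (E j)"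
        using sj[OF j] E'[OF j] sqroots_sign[OF sj[OF j]]
        by (intro bij_betw_byWitness[where f' = "\<lambda>w. s j * w"]) auto
      then have "card (?E j) = card (E j)" by (rule bij_betw_same_card)
      then show "emeasure (?M j) (?E j) = emeasure (?M j) (E j)"
        using E'[OF j] emeasure_uniform_count_measure[OF finite_sqroots, of "?E j" "c j"]
          emeasure_uniform_count_measure[OF finite_sqroots, of "E j" "c j"] by simp
    qed
    finally show "emeasure (distr (PiM I ?M) (PiM I ?M) (flip I s)) (prod_emb I ?M J (Pi\<^sub>E J E))
        = (\<Prod>j\<in>J. emeasure (?M j) (E j))" .
  qed
qed

text \<open>The sign changes permute the cylinders over a finite set of coordinates transitively, so an
  invariant probability gives all of them the same mass.\<close>

lemma flip_invariant_cylinder: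
  assumes \<nu>: "prob_space \<nu>" and sets: "sets \<nu> = sets (root_measure I c)"
    and inv: "\<And>s. s \<in> I \<rightarrow> {1, -1} \<Longrightarrow> distr \<nu> \<nu> (flip I s) = \<nu>"
    and J: "finite J" "J \<subseteq> I" and E: "\<And>j. j \<in> J \<Longrightarrow> E j \<subseteq> sqroots (c j)"
  defines "M \<equiv> \<lambda>i. uniform_count_measure (sqroots (c i))" and "R \<equiv> \<lambda>i. sqroots (c i)"
  shows "measure \<nu> (prod_emb I M J (Pi\<^sub>E J E)) = card (Pi\<^sub>E J E) / card (Pi\<^sub>E J R)"
proof -
  interpret prob_space \<nu> by (rule \<nu>)
  have space: "space \<nu> = Pi\<^sub>E I R"
    using sets_eq_imp_space_eq[OF sets] by (simp add: space_root_measure R_def)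
  define C where "C w = {z \<in> Pi\<^sub>E I R. \<forall>j\<in>J. z j = w j}" for w
  have C_eq: "C w = prod_emb I M J (\<Pi>\<^sub>E j\<in>J. {w j})" if "w \<in> Pi\<^sub>E J R" for w
    using J(2) by (auto simp: C_def prod_emb_def space_PiM space_uniform_count_measure R_def M_def PiE_iff
        extensional_def subset_eq restrict_def)
  have C_sets: "C w \<in> sets \<nu>" if "w \<in> Pi\<^sub>E J R" for w
    unfolding C_eq[OF that] sets root_measure_def M_def
    using J that by (intro sets_PiM_I) (auto simp: sets_uniform_count_measure R_def)
  have same: "measure \<nu> (C w) = measure \<nu> (C w')" if w: "w \<in> Pi\<^sub>E J R" "w' \<in> Pi\<^sub>E J R" for w w'
  proof -
    \<comment> \<open>The sign is -1 exactly at the coordinates of \<open>J\<close> where the two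
      roots differ and hence are negatives of each other. This sign change interchanges the
      cylinders through \<open>w\<close> and \<open>w'\<close>.\<close>
    define s where "s j = (if j \<in> J \<and> w j \<noteq> w' j then -1 else 1 :: complex)" for j
    have s: "s \<in> I \<rightarrow> {1, -1}" by (auto simp: s_def)
    have neg: "w' j = s j * w j" "w j = s j * w' j" if "j \<in> J" for j
    proof -
      have "w j \<in> sqroots (c j)" "w' j \<in> sqroots (c j)" using w that by (auto simp: R_def)
      then have "w' j = w j \<or> w' j = - w j" using sqroots_eq by blast
      then show "w' j = s j * w j" "w j = s j * w' j" using that by (auto simp: s_def)
    qed
    have sq: "s j * (s j * a) = a" for j a by (simp add: s_def)
    have R: "s j * a \<in> R j \<longleftrightarrow> a \<in> R j" for j a
      unfolding R_def by (rule sqroots_sign) (simp add: s_def)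
    have pre: "flip I s -` C w' \<inter> space \<nu> = C w"
    proof (rule Set.set_eqI)
      fix z
      have "s j * z j = w' j \<longleftrightarrow> z j = w j" if "j \<in> J" for j
        using neg[OF that] sq by metis
      then show "z \<in> flip I s -` C w' \<inter> space \<nu> \<longleftrightarrow> z \<in> C w"
        using J(2) R by (auto simp: C_def flip_def space PiE_iff subset_eq)
    qed
    have meas: "flip I s \<in> measurable \<nu> \<nu>"
      using measurable_flip[OF s, of c] measurable_cong_sets[OF sets sets] by blast
    have "measure \<nu> (C w') = measure (distr \<nu> \<nu> (flip I s)) (C w')"
      using inv[OF s] by simp
    also have "\<dots> = measure \<nu> (C w)"
      using measure_distr[OF meas C_sets[OF w(2)]] pre by simp
    finally show ?thesis by simp
  qed
  have finR: "finite (Pi\<^sub>E J R)"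
    using J by (intro finite_PiE) (auto simp: R_def finite_sqroots)
  have neR: "Pi\<^sub>E J R \<noteq> {}" by (auto simp: PiE_eq_empty_iff R_def sqroots_nonempty)
  then obtain w0 where w0: "w0 \<in> Pi\<^sub>E J R" by blast
  have disj: "disjoint_family_on C (Pi\<^sub>E J R)"
    unfolding disjoint_family_on_def
  proof (intro ballI impI)
    fix w w' assume w: "w \<in> Pi\<^sub>E J R" "w' \<in> Pi\<^sub>E J R" "w \<noteq> w'"
    then obtain j where "j \<in> J" "w j \<noteq> w' j" by (meson PiE_ext)
    then show "C w \<inter> C w' = {}" by (auto simp: C_def)
  qed
  have union: "measure \<nu> (\<Union>w\<in>Pi\<^sub>E J D. C w) = card (Pi\<^sub>E J D) * measure \<nu> (C w0)"
    if D: "\<And>j. j \<in> J \<Longrightarrow> D j \<subseteq> R j" for D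
  proof -
    have sub: "Pi\<^sub>E J D \<subseteq> Pi\<^sub>E J R" using D by (rule PiE_mono)
    have "measure \<nu> (\<Union>w\<in>Pi\<^sub>E J D. C w) = (\<Sum>w\<in>Pi\<^sub>E J D. measure \<nu> (C w))"
    proof (rule finite_measure_finite_Union)
      show "finite (Pi\<^sub>E J D)" using sub finR finite_subset by blast
      show "C ` Pi\<^sub>E J D \<subseteq> sets \<nu>" using C_sets sub by blast
      show "disjoint_family_on C (Pi\<^sub>E J D)" using disj sub disjoint_family_on_mono by blast
    qed
    also have "\<dots> = (\<Sum>w\<in>Pi\<^sub>E J D. measure \<nu> (C w0))"
      using same[OF _ w0] sub by (intro sum.cong) auto
    finally show ?thesis by simp
  qed
  have cyl: "prod_emb I M J (Pi\<^sub>E J D) = (\<Union>w\<in>Pi\<^sub>E J D. C w)"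
    if D: "\<And>j. j \<in> J \<Longrightarrow> D j \<subseteq> R j" for D
  proof (intro equalityI subsetI)
    fix z assume z: "z \<in> prod_emb I M J (Pi\<^sub>E J D)"
    then have "z \<in> Pi\<^sub>E I R" "restrict z J \<in> Pi\<^sub>E J D"
      by (auto simp: prod_emb_def M_def R_def space_uniform_count_measure)
    then show "z \<in> (\<Union>w\<in>Pi\<^sub>E J D. C w)"
      by (intro UN_I[of "restrict z J"]) (auto simp: C_def)
  next
    fix z assume "z \<in> (\<Union>w\<in>Pi\<^sub>E J D. C w)"
    then obtain w where w: "w \<in> Pi\<^sub>E J D" "z \<in> Pi\<^sub>E I R" "\<forall>j\<in>J. z j = w j"
      by (auto simp: C_def)
    then have "restrict z J = w" by (auto simp: PiE_iff extensional_def restrict_def)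
    then show "z \<in> prod_emb I M J (Pi\<^sub>E J D)"
      using w by (auto simp: prod_emb_def M_def R_def space_uniform_count_measure)
  qed
  have "(\<Union>w\<in>Pi\<^sub>E J R. C w) = space \<nu>"
    unfolding cyl[of R, OF subset_refl, symmetric] space using J(2)
    by (auto simp: prod_emb_def M_def R_def space_uniform_count_measure PiE_iff subset_eq)
  \<comment> \<open>The cylinders through all points of the finite product are disjoint and cover
    the space, and they have equal mass.\<close>
  then have "card (Pi\<^sub>E J R) * measure \<nu> (C w0) = 1"
    using union[of R] prob_space by simp
  moreover have "card (Pi\<^sub>E J R) \<noteq> 0" using finR neR by simp
  ultimately have "measure \<nu> (C w0) = 1 / card (Pi\<^sub>E J R)"
    by (simp add: field_simps)
  then show ?thesis
    using union[of E] cyl[of E] E by (simp add: R_def)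
qed

text \<open>The cylinder formula depends on the measure only through invariance. Since
  \<open>root_measure\<close> is itself invariant, the formula applies to both measures, and
  cylinders determine a probability on the product.\<close>

lemma flip_invariant_unique:
  assumes \<nu>: "prob_space \<nu>" and sets: "sets \<nu> = sets (root_measure I c)"
    and inv: "\<And>s. s \<in> I \<rightarrow> {1, -1} \<Longrightarrow> distr \<nu> \<nu> (flip I s) = \<nu>"
  shows "\<nu> = root_measure I c"
proof -
  let ?M = "\<lambda>i. uniform_count_measure (sqroots (c i))"
  let ?N = "root_measure I c"
  interpret \<nu>: prob_space \<nu> by (rule \<nu>)
  interpret N: prob_space ?N by (rule prob_space_root_measure)
  show ?thesis
  proof (rule measure_eqI_PiM_infinite[where I = I and M = ?M])
    show "sets \<nu> = sets (PiM I ?M)" "sets ?N = sets (PiM I ?M)"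
      using sets by (simp_all add: root_measure_def)
    show "finite_measure \<nu>" by (rule \<nu>.finite_measure_axioms)
    fix E J assume J: "finite J" "J \<subseteq> I" and "\<And>i. i \<in> J \<Longrightarrow> E i \<in> sets (?M i)"
    then have E: "\<And>j. j \<in> J \<Longrightarrow> E j \<subseteq> sqroots (c j)"
      by (simp add: sets_uniform_count_measure)
    show "emeasure \<nu> (prod_emb I ?M J (Pi\<^sub>E J E)) = emeasure ?N (prod_emb I ?M J (Pi\<^sub>E J E))"
      using flip_invariant_cylinder[OF \<nu> sets inv J, of E, OF _ E]
        flip_invariant_cylinder[OF prob_space_root_measure refl root_measure_flip J, of E, OF _ E]
      by (simp add: \<nu>.emeasure_eq_measure N.emeasure_eq_measure)
  qed
qed

text \<open>By compactness \<open>{w. a < v w}\<close> is a countable union of finite unions of basic sets.  This is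
  why every Baire set of a fibre lies in the \<open>\<sigma>\<close>-algebra generated by the coordinates.\<close>

lemma borel_measurable_compact_base:
  fixes v :: "'a \<Rightarrow> real"
  assumes W: "compact_space W" and M: "space M = topspace W"
    and base: "\<And>U w. openin W U \<Longrightarrow> w \<in> U \<Longrightarrow> \<exists>B\<in>sets M. openin W B \<and> w \<in> B \<and> B \<subseteq> U"
    and v: "continuous_map W euclideanreal v"
  shows "v \<in> borel_measurable M"
  unfolding borel_measurable_iff_greater
proof
  fix a
  define U where "U = {w \<in> topspace W. v w \<in> {a<..}}"
  \<comment> \<open>\<open>U\<close> is open and need not be compact. It is exhausted by these
    closed, hence compact, sets, whose thresholds lie strictly above \<open>a\<close>.\<close>
  define K where "K n = {w \<in> topspace W. v w \<in> {a + 1 / real (Suc n)..}}" for n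
  have "openin W U"
    unfolding U_def by (rule openin_continuous_map_preimage[OF v]) auto
  have "\<exists>B. B \<in> sets M \<and> openin W B \<and> w \<in> B \<and> B \<subseteq> U" if "w \<in> U" for w
    using base[OF \<open>openin W U\<close> that] unfolding Bex_def .
  then have "\<forall>w\<in>U. \<exists>B. B \<in> sets M \<and> openin W B \<and> w \<in> B \<and> B \<subseteq> U"
    by (rule ballI)
  from bchoice[OF this] obtain B
    where B: "\<And>w. w \<in> U \<Longrightarrow> B w \<in> sets M \<and> openin W (B w) \<and> w \<in> B w \<and> B w \<subseteq> U"
    by blast
  have KU: "K n \<subseteq> U" for n
  proof
    fix w assume "w \<in> K n"
    then have "w \<in> topspace W" "a + 1 / real (Suc n) \<le> v w" by (auto simp: K_def)
    moreover have "0 < 1 / real (Suc n)" by simp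
    ultimately have "a < v w" by linarith
    then show "w \<in> U" using \<open>w \<in> topspace W\<close> by (simp add: U_def)
  qed
  have "\<exists>D\<in>sets M. K n \<subseteq> D \<and> D \<subseteq> U" for n
  proof -
    have "closedin W (K n)"
      unfolding K_def by (rule closedin_continuous_map_preimage[OF v]) auto
    then have "compactin W (K n)"
      by (rule closedin_compact_space[OF W])
    moreover have "\<forall>V\<in>B ` K n. openin W V"
      using B KU by blast
    moreover have "K n \<subseteq> \<Union>(B ` K n)"
    proof
      fix w assume "w \<in> K n"
      then show "w \<in> \<Union>(B ` K n)" using B KU by (intro UN_I[of w]) auto
    qed
    ultimately have "\<exists>\<F>. finite \<F> \<and> \<F> \<subseteq> B ` K n \<and> K n \<subseteq> \<Union>\<F>"
      unfolding compactin_def by blast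
    then obtain \<F> where \<F>: "finite \<F>" "\<F> \<subseteq> B ` K n" "K n \<subseteq> \<Union>\<F>"
      by blast
    have "V \<in> sets M \<and> V \<subseteq> U" if "V \<in> \<F>" for V
      using that \<F>(2) B KU by blast
    then have "\<Union>\<F> \<in> sets M" "\<Union>\<F> \<subseteq> U"
      using \<F>(1) by (auto intro!: sets.finite_Union)
    then show ?thesis using \<F>(3) by blast
  qed
  then have "\<forall>n. \<exists>D. D \<in> sets M \<and> K n \<subseteq> D \<and> D \<subseteq> U" by blast
  from choice[OF this] obtain D where D: "\<And>n. D n \<in> sets M" "\<And>n. K n \<subseteq> D n" "\<And>n. D n \<subseteq> U"
    by blast
  have "U \<subseteq> (\<Union>n. K n)"
  proof
    fix w assume w: "w \<in> U"
    then have "0 < v w - a" by (simp add: U_def)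
    then obtain n where "1 / real (Suc n) < v w - a"
      by (rule nat_approx_posE)
    then have "w \<in> K n" using w unfolding K_def U_def by simp
    then show "w \<in> (\<Union>n. K n)" by (rule UN_I[OF UNIV_I])
  qed
  then have "{w \<in> space M. a < v w} = (\<Union>n. D n)"
  proof -
    have "{w \<in> space M. a < v w} = U"
      unfolding U_def M greaterThan_iff by (rule refl)
    also have "U = (\<Union>n. D n)"
    proof
      show "U \<subseteq> (\<Union>n. D n)"
        by (rule subset_trans[OF \<open>U \<subseteq> (\<Union>n. K n)\<close>]) (rule UN_mono[OF subset_refl D(2)])
      show "(\<Union>n. D n) \<subseteq> U" by (rule UN_least) (rule D(3))
    qed
    finally show ?thesis .
  qed
  then show "{w \<in> space M. a < v w} \<in> sets M"
    using D(1) by auto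
qed

text \<open>A basic open box restricts only finitely many coordinates, and every subset of a finite
  root set is measurable. Hence basic boxes are measurable cylinders, and the compactness argument
  applies.\<close>

lemma borel_measurable_root_measure:
  fixes v :: "('i \<Rightarrow> complex) \<Rightarrow> real"
  assumes v: "continuous_map (subtopology (product_topology (\<lambda>i. euclidean) I) (\<Pi>\<^sub>E i\<in>I. sqroots (c i)))
      euclideanreal v"
  shows "v \<in> borel_measurable (root_measure I c)"
proof -
  let ?R = "\<lambda>i. top_of_set (sqroots (c i))"
  define W where "W = product_topology ?R I"
  have W: "subtopology (product_topology (\<lambda>i. euclidean) I) (\<Pi>\<^sub>E i\<in>I. sqroots (c i)) = W"
    unfolding W_def by (rule subtopology_product_topology)
  show ?thesis
  proof (rule borel_measurable_compact_base)
    show "continuous_map W euclideanreal v" using v unfolding W .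
    have "compact_space (?R i)" for i
      by (simp add: compact_space_subtopology finite_imp_compact finite_sqroots)
    then show "compact_space W" by (simp add: W_def compact_space_product_topology)
    show "space (root_measure I c) = topspace W"
      by (simp add: W_def space_root_measure)
    fix U w assume "openin W U" "w \<in> U"
    then obtain V where V: "finite {i \<in> I. V i \<noteq> topspace (?R i)}" "\<forall>i\<in>I. openin (?R i) (V i)"
        "w \<in> Pi\<^sub>E I V" "Pi\<^sub>E I V \<subseteq> U"
      unfolding W_def openin_product_topology_alt by blast
    have VR: "V i \<subseteq> sqroots (c i)" if "i \<in> I" for i
      using V(2) that openin_subset[of "?R i" "V i"] by simp
    let ?J = "{i \<in> I. V i \<noteq> topspace (?R i)}"
    have "prod_emb I (\<lambda>i. uniform_count_measure (sqroots (c i))) ?J (Pi\<^sub>E ?J V) \<in> sets (root_measure I c)"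
      unfolding root_measure_def
      using V(1) VR by (intro sets_PiM_I) (auto simp: sets_uniform_count_measure)
    also have "prod_emb I (\<lambda>i. uniform_count_measure (sqroots (c i))) ?J (Pi\<^sub>E ?J V) = Pi\<^sub>E I V"
    proof (rule Set.set_eqI)
      fix z
      show "z \<in> prod_emb I (\<lambda>i. uniform_count_measure (sqroots (c i))) ?J (Pi\<^sub>E ?J V) \<longleftrightarrow> z \<in> Pi\<^sub>E I V"
        using VR by (simp add: prod_emb_def space_uniform_count_measure PiE_iff subset_eq) blast
    qed
    finally have "Pi\<^sub>E I V \<in> sets (root_measure I c)" .
    moreover have "openin W (Pi\<^sub>E I V)"
      unfolding W_def openin_PiE_gen using V(1,2) by blast
    ultimately show "\<exists>B\<in>sets (root_measure I c). openin W B \<and> w \<in> B \<and> B \<subseteq> U"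
      using V by blast
  qed
qed

section \<open>Baire sets of a fibre and the invariant measure\<close>

lemma space_baire_of [simp]: "space (baire_of Y) = topspace Y"
  unfolding baire_of_def by (rule space_measure_of) auto

lemma borel_measurable_baire_real:
  fixes u :: "'y \<Rightarrow> real"
  assumes "continuous_map Y euclideanreal u"
  shows "u \<in> borel_measurable (baire_of Y)"
proof (rule borel_measurableI)
  fix U :: "real set" assume "open U"
  then have "u -` U \<inter> topspace Y \<in> sigma_sets (topspace Y)
      {u -` U \<inter> topspace Y |u U. continuous_map Y euclideanreal u \<and> open U}"
    using assms by (intro sigma_sets.Basic) blast
  then show "u -` U \<inter> space (baire_of Y) \<in> sets (baire_of Y)"
    unfolding space_baire_of unfolding baire_of_def by (subst sets_measure_of) auto
qed

lemma borel_measurable_baire_complex: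
  fixes g :: "'y \<Rightarrow> complex"
  assumes "continuous_map Y euclidean g"
  shows "g \<in> borel_measurable (baire_of Y)"
proof -
  have "continuous_map Y euclideanreal (Re \<circ> g)" "continuous_map Y euclideanreal (Im \<circ> g)"
    by (rule continuous_map_compose[OF assms]; simp add: continuous_on_Re continuous_on_Im)+
  then show ?thesis
    unfolding borel_measurable_complex_iff by (simp add: borel_measurable_baire_real o_def)
qed

lemma measurable_baire_of:
  assumes f: "f \<in> space M \<rightarrow> topspace Y"
    and u: "\<And>u. continuous_map Y euclideanreal u \<Longrightarrow> (\<lambda>x. u (f x)) \<in> borel_measurable M"
  shows "f \<in> measurable M (baire_of Y)"
  unfolding baire_of_def
proof (rule measurable_measure_of)
  show "f \<in> space M \<rightarrow> topspace Y" by (rule f)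
  fix V assume "V \<in> {u -` U \<inter> topspace Y |u U. continuous_map Y euclideanreal u \<and> open U}"
  then obtain u U where U: "V = u -` U \<inter> topspace Y" "continuous_map Y euclideanreal u" "open U"
    by blast
  have "f -` V \<inter> space M = (\<lambda>x. u (f x)) -` U \<inter> space M"
    using f U(1) by auto
  also have "\<dots> \<in> sets M"
    using u[OF U(2)] U(3) by (intro measurable_sets) auto
  finally show "f -` V \<inter> space M \<in> sets M" .
qed auto

lemma topspace_ext_space:
  "y \<in> topspace (ext_space X F) \<longleftrightarrow>
    fst y \<in> topspace X \<and> snd y \<in> extensional F \<and> (\<forall>f\<in>F. (snd y f)\<^sup>2 = f (fst y))"
  unfolding ext_space_def topspace_subtopology topspace_prod_topology topspace_product_topology
  by (simp add: mem_Times_iff PiE_def)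

lemma ext_fibre_eq:
  assumes "x \<in> topspace X"
  shows "ext_fibre X F x = {x} \<times> (\<Pi>\<^sub>E f\<in>F. sqroots (f x))"
proof (rule Set.set_eqI)
  fix y
  have "y \<in> ext_fibre X F x \<longleftrightarrow>
      fst y = x \<and> snd y \<in> extensional F \<and> (\<forall>f\<in>F. (snd y f)\<^sup>2 = f x)"
    unfolding ext_fibre_def mem_Collect_eq topspace_ext_space using assms by metis
  then show "y \<in> ext_fibre X F x \<longleftrightarrow> y \<in> {x} \<times> (\<Pi>\<^sub>E f\<in>F. sqroots (f x))"
    unfolding mem_Times_iff PiE_iff sqroots_def mem_Collect_eq singleton_iff by metis
qed

lemma topspace_fibre: "topspace (subtopology (ext_space X F) (ext_fibre X F x)) = ext_fibre X F x"
  unfolding topspace_subtopology ext_fibre_def by blast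

lemma continuous_map_ext_fst: "continuous_map (ext_space X F) X fst"
  unfolding ext_space_def by (intro continuous_map_from_subtopology continuous_map_fst)

lemma continuous_map_ext_coord:
  assumes "f \<in> F"
  shows "continuous_map (ext_space X F) euclidean (\<lambda>y. snd y f)"
proof -
  have "continuous_map (prod_topology X (product_topology (\<lambda>f. euclidean) F)) euclidean ((\<lambda>w. w f) \<circ> snd)"
    by (rule continuous_map_compose[OF continuous_map_snd continuous_map_product_coordinates[OF assms]])
  then show ?thesis
    unfolding ext_space_def o_def by (rule continuous_map_from_subtopology)
qed

text \<open>The harder half of the identification of the fibre with the product: a continuous
  function on the fibre, transported to the product of root sets, is measurable for the coordinate
  \<open>\<sigma>\<close>-algebra by compactness.\<close>

lemma measurable_fibre_Pair:
  assumes x: "x \<in> topspace X"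
  shows "Pair x \<in> measurable (root_measure F (\<lambda>f. f x)) (baire_of (subtopology (ext_space X F) (ext_fibre X F x)))"
proof (rule measurable_baire_of, unfold topspace_fibre)
  show "Pair x \<in> space (root_measure F (\<lambda>f. f x)) \<rightarrow> ext_fibre X F x"
    by (auto simp: ext_fibre_eq[OF x] space_root_measure)
  fix u assume u: "continuous_map (subtopology (ext_space X F) (ext_fibre X F x)) euclideanreal u"
  let ?W = "subtopology (product_topology (\<lambda>f. euclidean) F) (\<Pi>\<^sub>E f\<in>F. sqroots (f x))"
  have "continuous_map ?W (prod_topology X (product_topology (\<lambda>f. euclidean) F)) (\<lambda>w. (x, w))"
    by (intro continuous_map_pairedI continuous_map_from_subtopology) (simp_all add: x)
  then have "continuous_map ?W (subtopology (ext_space X F) (ext_fibre X F x)) (Pair x)"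
    unfolding ext_space_def continuous_map_in_subtopology ext_fibre_eq[OF x]
    by (simp add: image_subset_iff sqroots_def PiE_iff)
  from continuous_map_compose[OF this u]
  show "(\<lambda>w. u (x, w)) \<in> borel_measurable (root_measure F (\<lambda>f. f x))"
    by (intro borel_measurable_root_measure) (simp add: o_def)
qed

text \<open>The easier half: each coordinate is continuous, hence Baire measurable, and every subset
  of a root set is finite, hence Borel.\<close>

lemma measurable_fibre_snd:
  assumes x: "x \<in> topspace X"
  shows "snd \<in> measurable (baire_of (subtopology (ext_space X F) (ext_fibre X F x))) (root_measure F (\<lambda>f. f x))"
    (is "snd \<in> measurable ?B _")
proof -
  have "(\<lambda>y f. snd y f) \<in> measurable ?B (root_measure F (\<lambda>f. f x))"
    unfolding root_measure_def
  proof (rule measurable_PiM_single')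
    show "(\<lambda>y f. snd y f) \<in> space ?B \<rightarrow> (\<Pi>\<^sub>E f\<in>F. space (uniform_count_measure (sqroots (f x))))"
      unfolding space_baire_of topspace_fibre
      by (auto simp: ext_fibre_eq[OF x] space_uniform_count_measure)
    fix f assume f: "f \<in> F"
    have meas: "(\<lambda>y. snd y f) \<in> borel_measurable ?B"
      by (intro borel_measurable_baire_complex continuous_map_from_subtopology continuous_map_ext_coord f)
    show "(\<lambda>y. snd y f) \<in> measurable ?B (uniform_count_measure (sqroots (f x)))"
    proof (rule measurableI)
      show "snd y f \<in> space (uniform_count_measure (sqroots (f x)))" if "y \<in> space ?B" for y
        using that f unfolding space_baire_of topspace_fibre
        by (auto simp: ext_fibre_eq[OF x] space_uniform_count_measure)
      fix E assume "E \<in> sets (uniform_count_measure (sqroots (f x)))"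
      then have "E \<subseteq> sqroots (f x)" by (simp add: sets_uniform_count_measure)
      then have "finite E" using finite_sqroots finite_subset by blast
      then have "E \<in> sets borel" by (simp add: borel_closed finite_imp_closed)
      then show "(\<lambda>y. snd y f) -` E \<inter> space ?B \<in> sets ?B"
        using meas by (rule measurable_sets[rotated])
    qed
  qed
  then show ?thesis by simp
qed

text \<open>On the fibre the sign change factors through the product as \<open>Pair x\<close>, after
  \<open>flip\<close>, after \<open>snd\<close>; this avoids a separate continuity argument.\<close>

lemma measurable_sign_change:
  assumes x: "x \<in> topspace X" and s: "s \<in> F \<rightarrow> {1, -1}"
  shows "sign_change F s \<in> measurable (baire_of (subtopology (ext_space X F) (ext_fibre X F x)))
    (baire_of (subtopology (ext_space X F) (ext_fibre X F x)))" (is "_ \<in> measurable ?B ?B")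
proof -
  have "(\<lambda>y. (x, flip F s (snd y))) \<in> measurable ?B ?B"
    using measurable_compose[OF measurable_compose[OF measurable_fibre_snd[OF x] measurable_flip[OF s]]
        measurable_fibre_Pair[OF x]] .
  moreover have "sign_change F s y = (x, flip F s (snd y))" if "y \<in> space ?B" for y
    using that unfolding space_baire_of topspace_fibre
    by (auto simp: ext_fibre_eq[OF x] sign_change_def flip_def)
  ultimately show ?thesis by (rule measurable_cong[THEN iffD2, rotated])
qed

text \<open>Pushing an invariant measure forward along \<open>snd\<close>, and the product measure along
  \<open>Pair x\<close>, transfers existence and uniqueness from \<^const>\<open>root_measure\<close>.\<close>

lemma ex1_invariant_prob:
  assumes x: "x \<in> topspace X"
  shows "\<exists>!\<mu>. invariant_prob X F x \<mu>"
proof -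
  let ?B = "baire_of (subtopology (ext_space X F) (ext_fibre X F x))"
  let ?N = "root_measure F (\<lambda>f. f x)"
  note e = measurable_fibre_Pair[OF x, of F] and sn = measurable_fibre_snd[OF x, of F]
  note \<sigma> = measurable_sign_change[OF x, of _ F] and fl = measurable_flip[of _ F "\<lambda>f. f x"]
  have spB: "space ?B = ext_fibre X F x"
    unfolding space_baire_of topspace_fibre ..
  show ?thesis
  proof (rule ex1I)
    let ?\<mu> = "distr ?N ?B (Pair x)"
    have "distr ?\<mu> ?\<mu> (sign_change F s) = ?\<mu>" if s: "s \<in> F \<rightarrow> {1, -1}" for s
    proof -
      have "distr ?\<mu> ?\<mu> (sign_change F s) = distr ?\<mu> ?B (sign_change F s)"
        by (rule distr_cong) simp_all
      also have "\<dots> = distr ?N ?B (sign_change F s \<circ> Pair x)"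
        by (rule distr_distr[OF \<sigma>[OF s] e])
      also have "sign_change F s \<circ> Pair x = Pair x \<circ> flip F s"
        by (auto simp: sign_change_def flip_def)
      also have "distr ?N ?B (Pair x \<circ> flip F s) = distr (distr ?N ?N (flip F s)) ?B (Pair x)"
        by (rule distr_distr[OF e fl[OF s], symmetric])
      finally show ?thesis unfolding root_measure_flip[OF s] .
    qed
    then show "invariant_prob X F x ?\<mu>"
      unfolding invariant_prob_def
      using prob_space.prob_space_distr[OF prob_space_root_measure e] by (simp add: spB del: space_baire_of)
    fix \<mu> assume inv: "invariant_prob X F x \<mu>"
    then have \<mu>: "prob_space \<mu>" "space \<mu> = ext_fibre X F x" "sets \<mu> = sets ?B"
      and \<mu>s: "\<And>s. s \<in> F \<rightarrow> {1, -1} \<Longrightarrow> distr \<mu> \<mu> (sign_change F s) = \<mu>"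
      unfolding invariant_prob_def by blast+
    have sn\<mu>: "snd \<in> measurable \<mu> ?N"
      unfolding measurable_cong_sets[OF \<mu>(3) refl] by (rule sn)
    have \<sigma>\<mu>: "sign_change F s \<in> measurable \<mu> \<mu>" if "s \<in> F \<rightarrow> {1, -1}" for s
      unfolding measurable_cong_sets[OF \<mu>(3) \<mu>(3)] by (rule \<sigma>[OF that])
    let ?\<nu> = "distr \<mu> ?N snd"
    have "?\<nu> = ?N"
    proof (rule flip_invariant_unique)
      show "prob_space ?\<nu>" by (rule prob_space.prob_space_distr[OF \<mu>(1) sn\<mu>])
      fix s :: "('a \<Rightarrow> complex) \<Rightarrow> complex" assume s: "s \<in> F \<rightarrow> {1, -1}"
      have "distr ?\<nu> ?\<nu> (flip F s) = distr ?\<nu> ?N (flip F s)"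
        by (rule distr_cong) simp_all
      also have "\<dots> = distr \<mu> ?N (flip F s \<circ> snd)"
        by (rule distr_distr[OF fl[OF s] sn\<mu>])
      also have "flip F s \<circ> snd = snd \<circ> sign_change F s"
        by (auto simp: sign_change_def flip_def)
      also have "distr \<mu> ?N (snd \<circ> sign_change F s) = distr (distr \<mu> \<mu> (sign_change F s)) ?N snd"
        by (rule distr_distr[OF sn\<mu> \<sigma>\<mu>[OF s], symmetric])
      finally show "distr ?\<nu> ?\<nu> (flip F s) = ?\<nu>" unfolding \<mu>s[OF s] .
    qed simp
    \<comment> \<open>On the fibre, \<open>Pair x \<circ> snd\<close> is the identity, so an
      invariant measure can be recovered from its image on the product.\<close>
    have "\<mu> = distr \<mu> \<mu> (\<lambda>y. y)" by simp
    also have "\<dots> = distr \<mu> ?B (Pair x \<circ> snd)"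
    proof (rule distr_cong)
      fix y assume "y \<in> space \<mu>"
      then have "fst y = x" unfolding \<mu>(2) ext_fibre_eq[OF x] by (simp add: mem_Times_iff)
      then show "y = (Pair x \<circ> snd) y" by (simp add: prod_eq_iff)
    qed (simp_all only: \<mu>(3))
    also have "\<dots> = distr ?\<nu> ?B (Pair x)"
      by (rule distr_distr[OF e sn\<mu>, symmetric])
    finally show "\<mu> = ?\<mu>" unfolding \<open>?\<nu> = ?N\<close> .
  qed
qed

lemma invariant_prob_fibre_measure:
  "x \<in> topspace X \<Longrightarrow> invariant_prob X F x (fibre_measure X F x)"
  unfolding fibre_measure_def by (rule theI') (rule ex1_invariant_prob)

section \<open>The single extension\<close>

text \<open>Here \<open>f\<close> is not known to be continuous: the approximants form a uniform
  Cauchy sequence in \<open>A\<close>, whose limit must be \<open>f\<close>. It is applied to fibre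
  averages.\<close>

lemma unif_approx_closed:
  assumes X: "compact_space X" and A: "closedin (unif_top X) A"
    and f: "f \<in> extensional (topspace X)" "unif_approx X A f"
  shows "f \<in> A"
proof -
  let ?r = "\<lambda>n. 1 / real (Suc n)"
  have "\<forall>n. \<exists>b. b \<in> A \<and> (\<forall>x\<in>topspace X. cmod (f x - b x) \<le> ?r n)"
  proof
    fix n
    have "0 < ?r n" by simp
    then show "\<exists>b. b \<in> A \<and> (\<forall>x\<in>topspace X. cmod (f x - b x) \<le> ?r n)"
      using f(2) unfolding unif_approx_def by blast
  qed
  from choice[OF this] obtain b
    where b: "\<And>n. b n \<in> A" "\<And>n x. x \<in> topspace X \<Longrightarrow> cmod (f x - b n x) \<le> ?r n"
    by blast
  have r0: "(\<lambda>n. ?r n + ?r n) \<longlonglongrightarrow> 0"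
    using tendsto_add[OF lim_1_over_n lim_1_over_n, THEN LIMSEQ_Suc] by simp
  obtain k where k: "k \<in> A" "\<And>n x. x \<in> topspace X \<Longrightarrow> cmod (k x - b n x) \<le> ?r n + ?r n"
  proof (rule unif_approx_limit[OF X A b(1) _ r0])
    fix m n :: nat and x assume mn: "n \<le> m" and x: "x \<in> topspace X"
    have "cmod (b m x - b n x) \<le> cmod (f x - b n x) + cmod (f x - b m x)"
      using norm_triangle_ineq4[of "f x - b n x" "f x - b m x"] by simp
    also have "\<dots> \<le> ?r n + ?r m" by (intro add_mono b x)
    also have "\<dots> \<le> ?r n + ?r n"
      using mn by (intro add_left_mono frac_le) simp_all
    finally show "cmod (b m x - b n x) \<le> ?r n + ?r n" .
  qed (rule that)
  have "f = k"
  proof (rule extensionalityI[OF f(1)])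
    show "k \<in> extensional (topspace X)"
      using k(1) A closedin_unif_top[OF X, of A] cfun_extensional by blast
    fix x assume x: "x \<in> topspace X"
    have "cmod (f x - k x) \<le> ?r n + (?r n + ?r n)" for n
      using norm_triangle_ineq4[of "f x - b n x" "k x - b n x"] b(2)[OF x, of n] k(2)[OF x, of n] by simp
    moreover have "(\<lambda>n. ?r n + (?r n + ?r n)) \<longlonglongrightarrow> 0"
      using tendsto_add[OF lim_1_over_n[THEN LIMSEQ_Suc] r0] by simp
    ultimately have "cmod (f x - k x) \<le> 0"
      by (intro LIMSEQ_le_const) auto
    then show "f x = k x" by simp
  qed
  then show ?thesis using k(1) by simp
qed

section \<open>Generated subalgebras and multipliers\<close>

lemma closed_subalgebra_cfun:
  assumes X: "compact_space X"
  shows "closed_subalgebra X (cfun X)"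
proof -
  have "closedin (unif_top X) (cfun X)"
    using closedin_topspace[of "unif_top X"] unfolding topspace_unif_top[OF X] .
  then show ?thesis
    unfolding closed_subalgebra_def using cfun_ops by blast
qed

text \<open>\<open>G \<subseteq> cfun X\<close> makes \<open>cfun X\<close> a member of the
  intersected family, which is therefore nonempty.\<close>

lemma closed_subalgebra_generated:
  assumes X: "compact_space X" and G: "G \<subseteq> cfun X"
  shows "closed_subalgebra X (generated_algebra X G)"
proof -
  let ?F = "{B. closed_subalgebra X B \<and> G \<subseteq> B}"
  have "closedin (unif_top X) (\<Inter>?F)"
    using closed_subalgebra_cfun[OF X] G
    by (intro closedin_Inter) (auto simp: closed_subalgebraD(1))
  moreover have "f \<in> \<Inter>?F" if "\<And>B. B \<in> ?F \<Longrightarrow> f \<in> B" for f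
    using that by (rule InterI)
  ultimately show ?thesis
    unfolding generated_algebra_def closed_subalgebra_def[of X "\<Inter>?F"]
    by (intro conjI allI ballI InterI) (auto intro: closed_subalgebraD(2-4) simp del: restrict_apply)
qed

lemma generated_algebra_least: "closed_subalgebra X C \<Longrightarrow> G \<subseteq> C \<Longrightarrow> generated_algebra X G \<subseteq> C"
  unfolding generated_algebra_def by blast

lemma generated_algebra_generators: "G \<subseteq> generated_algebra X G"
  unfolding generated_algebra_def by blast

lemma unif_approx_fadd:
  assumes D: "\<And>b b'. b \<in> D \<Longrightarrow> b' \<in> D \<Longrightarrow> fadd X b b' \<in> D"
    and f: "unif_approx X D f" and g: "unif_approx X D g"
  shows "unif_approx X D (fadd X f g)"
  unfolding unif_approx_def
proof (intro allI impI)
  fix e :: real assume "e > 0"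
  then have e: "e / 2 > 0" by simp
  obtain b where b: "b \<in> D" "\<forall>x\<in>topspace X. cmod (f x - b x) \<le> e / 2"
    using f e unfolding unif_approx_def by blast
  obtain c where c: "c \<in> D" "\<forall>x\<in>topspace X. cmod (g x - c x) \<le> e / 2"
    using g e unfolding unif_approx_def by blast
  have "cmod (fadd X f g x - fadd X b c x) \<le> e" if x: "x \<in> topspace X" for x
  proof -
    have "cmod (fadd X f g x - fadd X b c x) = cmod ((f x - b x) + (g x - c x))"
      using x by (simp add: algebra_simps)
    also have "\<dots> \<le> e / 2 + e / 2"
      using b(2) c(2) x by (intro norm_triangle_le add_mono) auto
    finally show ?thesis by simp
  qed
  then show "\<exists>b\<in>D. \<forall>x\<in>topspace X. cmod (fadd X f g x - b x) \<le> e"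
    using D[OF b(1) c(1)] by (intro bexI[of _ "fadd X b c"]) auto
qed

lemma unif_approx_fmul:
  assumes X: "compact_space X" and g: "g \<in> cfun X" and f: "unif_approx X D f"
    and D: "\<And>b. b \<in> D \<Longrightarrow> fmul X g b \<in> D'"
  shows "unif_approx X D' (fmul X g f)"
proof -
  obtain C where C: "0 \<le> C" "\<And>x. x \<in> topspace X \<Longrightarrow> cmod (g x) \<le> C"
    using cfun_bounded[OF X g] by blast
  show ?thesis
  proof (rule unif_approx_image[OF f C(1)])
    fix b e assume b: "b \<in> D" "0 \<le> e" "\<forall>x\<in>topspace X. cmod (f x - b x) \<le> e"
    have "cmod (fmul X g f x - fmul X g b x) \<le> C * e" if x: "x \<in> topspace X" for x
    proof -
      have "cmod (fmul X g f x - fmul X g b x) = cmod (g x) * cmod (f x - b x)"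
        using x by (simp add: norm_mult[symmetric] algebra_simps)
      also have "\<dots> \<le> C * e"
        using C b x by (intro mult_mono) auto
      finally show ?thesis .
    qed
    then show "fmul X g b \<in> D' \<and> (\<forall>x\<in>topspace X. cmod (fmul X g f x - fmul X g b x) \<le> C * e)"
      using D[OF b(1)] by blast
  qed
qed

text \<open>A device to bound a generated algebra by the closed span \<open>K\<close> of
  \<open>D\<close> without multiplying two elements of \<open>K\<close>. Once the generators
  multiply \<open>K\<close> into itself, so does the whole generated algebra; applying this to the
  constant 1 puts the algebra inside \<open>K\<close>.\<close>

lemma closed_subalgebra_multiplier:
  assumes X: "compact_space X" and D: "D \<subseteq> cfun X"
    and add: "\<And>b b'. b \<in> D \<Longrightarrow> b' \<in> D \<Longrightarrow> fadd X b b' \<in> D"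
    and const: "\<And>b c. b \<in> D \<Longrightarrow> fscale X c b \<in> D"
  defines "K \<equiv> {g \<in> cfun X. unif_approx X D g}"
  shows "closed_subalgebra X {g \<in> cfun X. \<forall>k\<in>K. fmul X g k \<in> K}" (is "closed_subalgebra X ?C")
proof -
  have "K = unif_top X closure_of D"
    unfolding K_def closure_of_unif_top[OF X D] ..
  then have K: "closedin (unif_top X) K" by simp
  have Kc: "K \<subseteq> cfun X" by (auto simp: K_def)
  have Kadd: "fadd X k l \<in> K" if "k \<in> K" "l \<in> K" for k l
  proof -
    have "unif_approx X D k" "unif_approx X D l" using that by (simp_all add: K_def)
    then have "unif_approx X D (fadd X k l)" by (rule unif_approx_fadd[rotated]) (rule add)
    then show ?thesis using that cfun_ops(1)[of k X l] by (simp add: K_def)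
  qed
  have "closedin (unif_top X) ?C"
    unfolding closedin_unif_top[OF X]
  proof (intro conjI ballI impI)
    fix g assume g: "g \<in> cfun X" "unif_approx X ?C g"
    have "fmul X g k \<in> K" if k: "k \<in> K" for k
    proof -
      have kc: "k \<in> cfun X" using k Kc by blast
      \<comment> \<open>Now the multiplier varies and \<open>k\<close> is the fixed bounded factor,
        so the order of the factors is exchanged.\<close>
      have comm: "fmul X k f = fmul X f k" for f by (auto simp: mult.commute)
      have "unif_approx X K (fmul X k g)"
        by (rule unif_approx_fmul[OF X kc g(2)]) (use k in \<open>simp add: comm del: restrict_apply\<close>)
      then show ?thesis
        unfolding comm by (intro unif_approx_closed[OF X K]) auto
    qed
    then show "g \<in> ?C" using g(1) by simp
  qed auto
  moreover have "fconst X c \<in> ?C" for c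
  proof -
    have "fmul X (fconst X c) k \<in> K" if "k \<in> K" for k
    proof -
      have "fmul X (fconst X c) b \<in> D" if "b \<in> D" for b
      proof -
        have "fmul X (fconst X c) b = fscale X c b" by auto
        then show ?thesis using const[OF that, of c] by simp
      qed
      then have "unif_approx X D (fmul X (fconst X c) k)"
        using that by (intro unif_approx_fmul[OF X cfun_ops(3)]) (auto simp: K_def)
      moreover have "fmul X (fconst X c) k \<in> cfun X"
        using that Kc by (intro cfun_ops(2)[OF cfun_ops(3)]) blast
      ultimately show ?thesis by (simp add: K_def)
    qed
    then show ?thesis using cfun_ops(3)[where X = X and c = c] by simp
  qed
  moreover have "fadd X f g \<in> ?C" if fg: "f \<in> ?C" "g \<in> ?C" for f g
  proof -
    have "fmul X (fadd X f g) k \<in> K" if "k \<in> K" for k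
    proof -
      have "fmul X (fadd X f g) k = fadd X (fmul X f k) (fmul X g k)"
        by (auto simp: algebra_simps)
      then show ?thesis using Kadd[of "fmul X f k" "fmul X g k"] fg that by simp
    qed
    then show ?thesis using fg cfun_ops(1)[of f X g] by simp
  qed
  moreover have "fmul X f g \<in> ?C" if fg: "f \<in> ?C" "g \<in> ?C" for f g
  proof -
    have "fmul X (fmul X f g) k \<in> K" if "k \<in> K" for k
    proof -
      have "fmul X (fmul X f g) k = fmul X f (fmul X g k)"
        by (auto simp: algebra_simps)
      moreover have "fmul X g k \<in> K" using fg that by blast
      then have "fmul X f (fmul X g k) \<in> K" using fg by blast
      ultimately show ?thesis by (simp only:)
    qed
    then show ?thesis using fg cfun_ops(2)[of f X g] by simp
  qed
  ultimately show ?thesis unfolding closed_subalgebra_def by blast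
qed

text \<open>A set of coordinates suffices because a repeated coordinate is absorbed into the
  coefficient: its square is the pullback of \<open>f\<close>.\<close>

definition monomial :: "'x topology \<Rightarrow> ('x \<Rightarrow> complex) set \<Rightarrow> ('x \<Rightarrow> complex) \<Rightarrow> ('x \<Rightarrow> complex) set
    \<Rightarrow> 'x ext_point \<Rightarrow> complex" where
  "monomial X F a S = (\<lambda>y\<in>topspace (ext_space X F). a (fst y) * (\<Prod>f\<in>S. snd y f))"

text \<open>Sums are the only closure rule; scalars and factors from \<open>A\<close> go into the
  coefficients.\<close>

inductive_set monomial_span ::
    "'x topology \<Rightarrow> ('x \<Rightarrow> complex) set \<Rightarrow> ('x \<Rightarrow> complex) set \<Rightarrow> ('x ext_point \<Rightarrow> complex) set"
  for X A F where
    base: "a \<in> A \<Longrightarrow> finite S \<Longrightarrow> S \<subseteq> F \<Longrightarrow> monomial X F a S \<in> monomial_span X A F"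
  | add: "d \<in> monomial_span X A F \<Longrightarrow> d' \<in> monomial_span X A F \<Longrightarrow>
      fadd (ext_space X F) d d' \<in> monomial_span X A F"

text \<open>In the tower, compactness of the extension space is inherited from the next stage, to
  which it is homeomorphic.\<close>

locale single_extension =
  fixes X :: "'x topology" and A F :: "('x \<Rightarrow> complex) set"
  assumes A: "uniform_algebra X A" and F: "F \<subseteq> A" and cE: "compact_space (ext_space X F)"
begin

abbreviation E where "E \<equiv> ext_space X F"
abbreviation B where "B \<equiv> ext_algebra X A F"
abbreviation T where "T \<equiv> avg_op X F"
abbreviation coord where "coord f \<equiv> \<lambda>y\<in>topspace E. snd y f"
abbreviation D where "D \<equiv> monomial_span X A F"

section \<open>The averaging operator on the extension algebra\<close>

lemmas cX = uniform_algebraD(1)[OF A]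
lemmas subA = uniform_algebraD(3)[OF A]
lemmas opA = closed_subalgebraD(2-5)[OF subA]
lemmas cfA = subsetD[OF uniform_algebraD(4)[OF A]]

lemma E_fst: "y \<in> topspace E \<Longrightarrow> fst y \<in> topspace X"
  by (simp add: topspace_ext_space)

lemma E_coord: "y \<in> topspace E \<Longrightarrow> f \<in> F \<Longrightarrow> snd y f * snd y f = f (fst y)"
  by (simp add: topspace_ext_space power2_eq_square)

lemma pb_cfun: "a \<in> A \<Longrightarrow> pullback E fst a \<in> cfun E"
  by (rule pullback_cfun[OF continuous_map_ext_fst cfA])

lemma coord_cfun:
  assumes "f \<in> F"
  shows "coord f \<in> cfun E"
proof -
  have "continuous_map E euclidean (coord f)"
    by (rule continuous_map_eq[OF continuous_map_ext_coord[OF assms]]) simp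
  then show ?thesis unfolding cfun_def by simp
qed

lemma gens: "pullback E fst ` A \<union> (\<lambda>f. coord f) ` F \<subseteq> cfun E"
  using pb_cfun coord_cfun by blast

lemma subB: "closed_subalgebra E B"
  unfolding ext_algebra_def by (rule closed_subalgebra_generated[OF cE gens])

lemmas opB = closed_subalgebraD(2-5)[OF subB]
lemmas cfB = subsetD[OF closed_subalgebra_subset_cfun[OF cE subB]]

lemma pb_B: "a \<in> A \<Longrightarrow> pullback E fst a \<in> B"
  unfolding ext_algebra_def by (rule subsetD[OF generated_algebra_generators UnI1[OF imageI]])

lemma coord_B: "f \<in> F \<Longrightarrow> coord f \<in> B"
  unfolding ext_algebra_def by (rule subsetD[OF generated_algebra_generators UnI2]) (rule imageI)

lemma B_least:
  assumes "closed_subalgebra E C" "\<And>a. a \<in> A \<Longrightarrow> pullback E fst a \<in> C" "\<And>f. f \<in> F \<Longrightarrow> coord f \<in> C"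
  shows "B \<subseteq> C"
  unfolding ext_algebra_def by (rule generated_algebra_least[OF assms(1)]) (use assms(2,3) in blast)

lemma fibre_subset: "y \<in> ext_fibre X F x \<Longrightarrow> y \<in> topspace E \<and> fst y = x"
  by (simp add: ext_fibre_def)

lemma fibre_measure_props:
  assumes x: "x \<in> topspace X"
  shows "prob_space (fibre_measure X F x)"
    and "space (fibre_measure X F x) = ext_fibre X F x"
    and "g \<in> cfun E \<Longrightarrow> g \<in> borel_measurable (fibre_measure X F x)"
    and "g \<in> cfun E \<Longrightarrow> integrable (fibre_measure X F x) g"
    and "s \<in> F \<rightarrow> {1, -1} \<Longrightarrow> g \<in> cfun E \<Longrightarrow>
      (\<integral>y. g (sign_change F s y) \<partial>fibre_measure X F x) = (\<integral>y. g y \<partial>fibre_measure X F x)"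
proof -
  let ?\<mu> = "fibre_measure X F x"
  let ?B = "baire_of (subtopology (ext_space X F) (ext_fibre X F x))"
  have inv: "invariant_prob X F x ?\<mu>" by (rule invariant_prob_fibre_measure[OF x])
  then show prob: "prob_space ?\<mu>" and sp: "space ?\<mu> = ext_fibre X F x"
    by (simp_all add: invariant_prob_def)
  have sets: "sets ?\<mu> = sets ?B" using inv by (simp only: invariant_prob_def)
  interpret prob_space ?\<mu> by (rule prob)
  show meas: "g \<in> borel_measurable ?\<mu>" if "g \<in> cfun E" for g
    unfolding measurable_cong_sets[OF sets refl]
    using that by (intro borel_measurable_baire_complex continuous_map_from_subtopology) (simp add: cfun_def)
  show "integrable ?\<mu> g" if g: "g \<in> cfun E" for g
  proof -
    obtain C where C: "\<And>y. y \<in> topspace E \<Longrightarrow> cmod (g y) \<le> C"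
      using cfun_bounded[OF cE g] by blast
    show ?thesis
      by (rule integrable_const_bound[where B = C]) (use C fibre_subset meas[OF g] sp in auto)
  qed
  show "(\<integral>y. g (sign_change F s y) \<partial>?\<mu>) = (\<integral>y. g y \<partial>?\<mu>)" if s: "s \<in> F \<rightarrow> {1, -1}" and g: "g \<in> cfun E"
  proof -
    have \<sigma>: "sign_change F s \<in> measurable ?\<mu> ?\<mu>"
      unfolding measurable_cong_sets[OF sets sets] by (rule measurable_sign_change[OF x s])
    have "distr ?\<mu> ?\<mu> (sign_change F s) = ?\<mu>"
      using inv s by (simp only: invariant_prob_def)
    then show ?thesis
      using integral_distr[OF \<sigma> meas[OF g]] by simp
  qed
qed

lemma T_apply: "x \<in> topspace X \<Longrightarrow> T g x = (\<integral>y. g y \<partial>fibre_measure X F x)"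
  by (simp add: avg_op_def)

lemma T_ext: "T g \<in> extensional (topspace X)"
  by (simp add: avg_op_def)

lemma T_eqI:
  assumes "x \<in> topspace X" "\<And>y. y \<in> topspace E \<Longrightarrow> fst y = x \<Longrightarrow> g y = k y"
  shows "T g x = T k x"
  unfolding T_apply[OF assms(1)]
  by (rule Bochner_Integration.integral_cong[OF refl])
    (use assms(2) fibre_subset fibre_measure_props(2)[OF assms(1)] in blast)

lemma T_const:
  assumes "x \<in> topspace X" "\<And>y. y \<in> topspace E \<Longrightarrow> fst y = x \<Longrightarrow> g y = c"
  shows "T g x = c"
proof -
  interpret prob_space "fibre_measure X F x" by (rule fibre_measure_props(1)[OF assms(1)])
  have "T g x = T (\<lambda>_. c) x" by (rule T_eqI[OF assms])
  then show ?thesis using prob_space by (simp add: T_apply[OF assms(1)])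
qed

lemma T_add:
  assumes "g \<in> cfun E" "k \<in> cfun E"
  shows "T (fadd E g k) = fadd X (T g) (T k)"
proof (rule extensionalityI[OF T_ext])
  fix x assume x: "x \<in> topspace X"
  have "T (fadd E g k) x = T (\<lambda>y. g y + k y) x"
    by (rule T_eqI[OF x]) simp
  then show "T (fadd E g k) x = fadd X (T g) (T k) x"
    using x fibre_measure_props(4)[OF x assms(1)] fibre_measure_props(4)[OF x assms(2)]
    by (simp add: T_apply)
qed simp

text \<open>A function pulled back from the base is constant on each fibre and leaves the integral.
  Scaling by a constant is a special case.\<close>

lemma T_module:
  assumes "g \<in> cfun E"
  shows "T (fmul E (pullback E fst a) g) = fmul X a (T g)"
proof (rule extensionalityI[OF T_ext])
  fix x assume x: "x \<in> topspace X"
  have "T (fmul E (pullback E fst a) g) x = T (\<lambda>y. a x * g y) x"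
    by (rule T_eqI[OF x]) simp
  then show "T (fmul E (pullback E fst a) g) x = fmul X a (T g) x"
    using x by (simp add: T_apply)
qed simp

lemma T_scale:
  assumes "g \<in> cfun E"
  shows "T (fscale E c g) = fscale X c (T g)"
proof -
  have "fmul E (pullback E fst (fconst X c)) g = fscale E c g"
    by (rule restrict_ext) (simp add: E_fst)
  moreover have "fmul X (fconst X c) (T g) = fscale X c (T g)"
    by (rule restrict_ext) simp
  ultimately show ?thesis using T_module[OF assms, of "fconst X c"] by (simp only:)
qed

lemma T_bound:
  assumes g: "g \<in> cfun E" and C: "\<And>y. y \<in> topspace E \<Longrightarrow> cmod (g y) \<le> C" and x: "x \<in> topspace X"
  shows "cmod (T g x) \<le> C"
proof -
  interpret prob_space "fibre_measure X F x" by (rule fibre_measure_props(1)[OF x])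
  have "cmod (T g x) \<le> (\<integral>y. cmod (g y) \<partial>fibre_measure X F x)"
    unfolding T_apply[OF x] by (rule integral_norm_bound)
  also have "\<dots> \<le> (\<integral>y. C \<partial>fibre_measure X F x)"
  proof (rule integral_mono)
    show "integrable (fibre_measure X F x) (\<lambda>y. cmod (g y))"
      by (rule integrable_norm[OF fibre_measure_props(4)[OF x g]])
    show "cmod (g y) \<le> C" if "y \<in> space (fibre_measure X F x)" for y
      using that C fibre_subset unfolding fibre_measure_props(2)[OF x] by blast
  qed simp
  finally show ?thesis using prob_space by simp
qed

lemma T_contract:
  assumes g: "g \<in> cfun E" and k: "k \<in> cfun E"
    and e: "\<And>y. y \<in> topspace E \<Longrightarrow> cmod (g y - k y) \<le> e" and x: "x \<in> topspace X"
  shows "cmod (T g x - T k x) \<le> e"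
proof -
  have k': "fscale E (-1) k \<in> cfun E"
    using closed_subalgebraD(5)[OF closed_subalgebra_cfun[OF cE] k] .
  have "T (fadd E g (fscale E (-1) k)) x = T g x - T k x"
    using x by (simp only: T_add[OF g k'] T_scale[OF k]) simp
  moreover have "cmod (T (fadd E g (fscale E (-1) k)) x) \<le> e"
    by (rule T_bound[OF cfun_ops(1)[OF g k'] _ x]) (use e in simp)
  ultimately show ?thesis by simp
qed

lemma T_pb:
  assumes a: "a \<in> A"
  shows "T (pullback E fst a) = a"
proof (rule extensionalityI[OF T_ext cfun_extensional[OF cfA[OF a]]])
  fix x assume "x \<in> topspace X"
  then show "T (pullback E fst a) x = a x" by (rule T_const) simp
qed

lemma monomial_insert:
  assumes "f \<in> F" "finite S"
  shows "f \<notin> S \<Longrightarrow> fmul E (coord f) (monomial X F a S) = monomial X F a (insert f S)"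
    and "f \<in> S \<Longrightarrow> fmul E (coord f) (monomial X F a S) = monomial X F (fmul X a f) (S - {f})"
proof -
  show "fmul E (coord f) (monomial X F a S) = monomial X F a (insert f S)" if "f \<notin> S"
    unfolding monomial_def
  proof (rule restrict_ext)
    fix y assume "y \<in> topspace E"
    then show "coord f y * (\<lambda>y\<in>topspace E. a (fst y) * (\<Prod>f\<in>S. snd y f)) y
        = a (fst y) * (\<Prod>f\<in>insert f S. snd y f)"
      using assms(2) that by (simp add: algebra_simps)
  qed
  show "fmul E (coord f) (monomial X F a S) = monomial X F (fmul X a f) (S - {f})" if "f \<in> S"
    unfolding monomial_def
  proof (rule restrict_ext)
    fix y assume y: "y \<in> topspace E"
    have "(\<Prod>f\<in>S. snd y f) = snd y f * (\<Prod>f\<in>S - {f}. snd y f)"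
      by (rule prod.remove[OF assms(2) that])
    then have "coord f y * (\<lambda>y\<in>topspace E. a (fst y) * (\<Prod>f\<in>S. snd y f)) y
        = a (fst y) * (snd y f * snd y f) * (\<Prod>f\<in>S - {f}. snd y f)"
      using y by (simp add: algebra_simps)
    then show "coord f y * (\<lambda>y\<in>topspace E. a (fst y) * (\<Prod>f\<in>S. snd y f)) y
        = fmul X a f (fst y) * (\<Prod>f\<in>S - {f}. snd y f)"
      unfolding E_coord[OF y assms(1)] using E_fst[OF y] by simp
  qed
qed

lemma monomial_empty: "monomial X F a {} = pullback E fst a"
  unfolding monomial_def pullback_def compose_def by (rule restrict_ext) simp

lemma fmul_pb_monomial: "fmul E (pullback E fst b) (monomial X F a S) = monomial X F (fmul X b a) S"
  unfolding monomial_def by (rule restrict_ext) (simp add: E_fst algebra_simps)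

lemma monomial_cfun:
  assumes a: "a \<in> A" and S: "finite S" "S \<subseteq> F"
  shows "monomial X F a S \<in> cfun E"
  using S
proof (induction S)
  case empty
  show ?case unfolding monomial_empty by (rule pb_cfun[OF a])
next
  case (insert f S)
  then have "f \<in> F" "monomial X F a S \<in> cfun E" by simp_all
  from cfun_ops(2)[OF coord_cfun[OF this(1)] this(2)] show ?case
    unfolding monomial_insert(1)[OF \<open>f \<in> F\<close> insert.hyps(1,2)] .
qed

lemma span_cfun: "D \<subseteq> cfun E"
proof
  fix d assume "d \<in> D"
  then show "d \<in> cfun E"
    by induction (auto intro: monomial_cfun cfun_ops(1) simp del: restrict_apply)
qed

lemma T_monomial:
  assumes a: "a \<in> A" and S: "finite S" "S \<subseteq> F" "S \<noteq> {}"
  shows "T (monomial X F a S) = fconst X 0"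
proof (rule extensionalityI[OF T_ext])
  fix x assume x: "x \<in> topspace X"
  let ?g = "monomial X F a S"
  have g: "?g \<in> cfun E" by (rule monomial_cfun[OF a S(1,2)])
  obtain f where f: "f \<in> S" using S(3) by blast
  \<comment> \<open>Changing the sign of one single coordinate that occurs in the monomial reverses
    the sign of the monomial, while the measure is invariant; so the average equals its own
    negative.\<close>
  define s where "s k = (if k = f then -1 else 1 :: complex)" for k
  have s: "s \<in> F \<rightarrow> {1, -1}" by (simp add: s_def)
  have "?g (sign_change F s y) = - ?g y" if y: "y \<in> topspace E" for y
  proof -
    have y': "sign_change F s y \<in> topspace E"
      using y by (simp add: sign_change_def topspace_ext_space power_mult_distrib s_def)
    have "(\<Prod>k\<in>S. snd (sign_change F s y) k) = (\<Prod>k\<in>S. s k * snd y k)"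
      using S(2) by (intro prod.cong) (auto simp: sign_change_def)
    also have "\<dots> = (\<Prod>k\<in>S. s k) * (\<Prod>k\<in>S. snd y k)" by (rule prod.distrib)
    also have "(\<Prod>k\<in>S. s k) = -1"
      unfolding prod.remove[OF S(1) f] by (simp add: s_def)
    finally have "(\<Prod>k\<in>S. snd (sign_change F s y) k) = - (\<Prod>k\<in>S. snd y k)" by simp
    then show ?thesis
      using y y' by (simp add: monomial_def) (simp add: sign_change_def)
  qed
  then have "T ?g x = T (\<lambda>y. - ?g y) x"
    using fibre_measure_props(5)[OF x s g] T_eqI[OF x, of "\<lambda>y. ?g (sign_change F s y)" "\<lambda>y. - ?g y"]
    by (simp add: T_apply[OF x])
  then have "T ?g x = - T ?g x" by (simp add: T_apply[OF x])
  then show "T ?g x = fconst X 0 x" using x by simp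
qed simp

text \<open>The span of the monomials is stable under multiplication by each generator: a new
  coordinate is added to the index set, an old one is removed and its square goes into the
  coefficient. The multiplier argument then gives density.\<close>

lemma B_approx: "g \<in> B \<Longrightarrow> unif_approx E D g"
proof -
  define K where "K = {g \<in> cfun E. unif_approx E D g}"
  let ?C = "{g \<in> cfun E. \<forall>k\<in>K. fmul E g k \<in> K}"
  have pbD: "fmul E (pullback E fst b) d \<in> D" if b: "b \<in> A" and d: "d \<in> D" for b d
    using d
  proof induction
    case (base a S)
    then show ?case
      unfolding fmul_pb_monomial using opA(3)[OF b] by (intro monomial_span.base) auto
  next
    case (add d d')
    have "fmul E (pullback E fst b) (fadd E d d')
        = fadd E (fmul E (pullback E fst b) d) (fmul E (pullback E fst b) d')"
      by (rule restrict_ext) (simp add: algebra_simps)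
    then show ?case using add by (simp only: monomial_span.add)
  qed
  have coordD: "fmul E (coord f) d \<in> D" if f: "f \<in> F" and d: "d \<in> D" for f d
    using d
  proof induction
    case (base a S)
    show ?case
    proof (cases "f \<in> S")
      case True
      show ?thesis
        unfolding monomial_insert(2)[OF f base(2) True]
        using base F f opA(3)[of a f] by (intro monomial_span.base) auto
    next
      case False
      show ?thesis
        unfolding monomial_insert(1)[OF f base(2) False]
        using base f by (intro monomial_span.base) auto
    qed
  next
    case (add d d')
    have "fmul E (coord f) (fadd E d d') = fadd E (fmul E (coord f) d) (fmul E (coord f) d')"
      by (rule restrict_ext) (simp add: algebra_simps)
    then show ?case using add by (simp only: monomial_span.add)
  qed
  have scaleD: "fscale E c d \<in> D" if d: "d \<in> D" for c d
  proof -
    have "fmul E (pullback E fst (fconst X c)) d = fscale E c d"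
      by (rule restrict_ext) (simp add: E_fst)
    then show ?thesis using pbD[OF opA(1)[of c] d] by (simp only:)
  qed
  have mulK: "fmul E g k \<in> K" if g: "g \<in> cfun E" "\<And>d. d \<in> D \<Longrightarrow> fmul E g d \<in> D" and k: "k \<in> K" for g k
  proof -
    have k': "k \<in> cfun E" "unif_approx E D k" using k by (simp_all add: K_def)
    show ?thesis
      unfolding K_def using cfun_ops(2)[OF g(1) k'(1)] unif_approx_fmul[OF cE g(1) k'(2) g(2)] by blast
  qed
  have "B \<subseteq> ?C"
  proof (rule B_least)
    show "closed_subalgebra E ?C"
      unfolding K_def by (rule closed_subalgebra_multiplier[OF cE span_cfun monomial_span.add scaleD])
    show "pullback E fst a \<in> ?C" if "a \<in> A" for a
      using pb_cfun[OF that] mulK[OF pb_cfun[OF that] pbD[OF that]] by blast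
    show "coord f \<in> ?C" if "f \<in> F" for f
      using coord_cfun[OF that] mulK[OF coord_cfun[OF that] coordD[OF that]] by blast
  qed
  moreover assume g: "g \<in> B"
  \<comment> \<open>The constant 1 is the monomial with empty index set; multiplying it by
    \<open>g\<close> returns \<open>g\<close>.\<close>
  moreover have "fconst E 1 \<in> K"
  proof -
    have "monomial X F (fconst X 1) {} = fconst E 1"
      unfolding monomial_def by (rule restrict_ext) (simp add: E_fst)
    moreover have "monomial X F (fconst X 1) {} \<in> D"
      by (rule monomial_span.base[OF opA(1)]) simp_all
    ultimately have "fconst E 1 \<in> D" by (simp only:)
    then show ?thesis unfolding K_def using span_cfun unif_approx_self by blast
  qed
  ultimately have "fmul E g (fconst E 1) \<in> K" by blast
  moreover have "fmul E g (fconst E 1) = g"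
    using cfun_extensional[OF cfB[OF g]] by (intro extensionalityI[where A = "topspace E"]) simp_all
  ultimately show "unif_approx E D g" by (simp add: K_def)
qed

text \<open>On a monomial the average is the coefficient or zero, so the span goes into
  \<open>A\<close>; contractivity extends this to the closure and makes \<open>T g\<close>
  continuous.\<close>

lemma T_A:
  assumes g: "g \<in> B"
  shows "T g \<in> A"
proof (rule unif_approx_closed[OF cX closed_subalgebraD(1)[OF subA] T_ext])
  have TD: "T d \<in> A" if "d \<in> D" for d
    using that
  proof induction
    case (base a S)
    show ?case
    proof (cases "S = {}")
      case True
      then show ?thesis using base(1) by (simp only: monomial_empty T_pb)
    next
      case False
      then show ?thesis using opA(1) by (simp only: T_monomial[OF base False])
    qed
  next
    case (add d d')
    then show ?case using opA(2) span_cfun by (simp only: T_add subset_eq)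
  qed
  show "unif_approx X A (T g)"
  proof (rule unif_approx_image[OF B_approx[OF g], of 1])
    fix b e assume b: "b \<in> D" "\<forall>y\<in>topspace E. cmod (g y - b y) \<le> e"
    then have "cmod (T g x - T b x) \<le> e" if "x \<in> topspace X" for x
      using T_contract[OF cfB[OF g] subsetD[OF span_cfun b(1)] _ that] by blast
    then show "T b \<in> A \<and> (\<forall>y\<in>topspace X. cmod (T g y - T b y) \<le> 1 * e)"
      using TD[OF b(1)] by simp
  qed simp
qed

text \<open>This is where \<open>F \<subseteq> I\<close> enters multiplicativity. Multiplying a
  monomial by the coordinate of \<open>f\<close> leaves a nonempty index set, and hence average
  zero, except for the index set \<open>{f}\<close>; there the average is \<open>a f\<close>, which
  lies in \<open>I\<close>.\<close>

lemma T_coord: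
  assumes f: "f \<in> F" and I: "unif_ideal X A I" and FI: "F \<subseteq> I" and k: "k \<in> B"
  shows "T (fmul E (coord f) k) \<in> I"
proof -
  note I' = unif_idealD[OF I]
  have TD: "T (fmul E (coord f) d) \<in> I" if "d \<in> D" for d
    using that
  proof induction
    case (base a S)
    show ?case
    proof (cases "S = {f}")
      case True
      have "fmul E (coord f) (monomial X F a S) = pullback E fst (fmul X a f)"
        using monomial_insert(2)[OF f base(2), of a] by (simp only: True) (simp add: monomial_empty)
      moreover have "fmul X a f \<in> A" using opA(3)[OF base(1)] F f by blast
      moreover have "fmul X a f = fmul X f a" by (rule restrict_ext) simp
      moreover have "fmul X f a \<in> I" using I'(4)[OF subsetD[OF FI f] base(1)] .
      ultimately show ?thesis by (simp only: T_pb)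
    next
      case False
      have "T (fmul E (coord f) (monomial X F a S)) = fconst X 0"
      proof (cases "f \<in> S")
        case True
        then have "S - {f} \<noteq> {}" using False by blast
        then show ?thesis
          unfolding monomial_insert(2)[OF f base(2) True]
          using base F f opA(3)[OF base(1)] by (intro T_monomial) auto
      next
        case False
        then show ?thesis
          unfolding monomial_insert(1)[OF f base(2) False]
          using base f by (intro T_monomial) auto
      qed
      then show ?thesis using I'(2) by (simp only:)
    qed
  next
    case (add d d')
    have "fmul E (coord f) (fadd E d d') = fadd E (fmul E (coord f) d) (fmul E (coord f) d')"
      by (rule restrict_ext) (simp add: algebra_simps)
    moreover have "fmul E (coord f) d \<in> cfun E" "fmul E (coord f) d' \<in> cfun E"
      using cfun_ops(2)[OF coord_cfun[OF f]] add(1,2) span_cfun by blast+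
    ultimately show ?case using I'(3)[OF add(3,4)] by (simp only: T_add)
  qed
  obtain C where C: "0 \<le> C" "\<And>y. y \<in> topspace E \<Longrightarrow> cmod (coord f y) \<le> C"
    using cfun_bounded[OF cE coord_cfun[OF f]] by blast
  have "unif_approx X I (T (fmul E (coord f) k))"
  proof (rule unif_approx_image[OF B_approx[OF k] C(1), where R = "\<lambda>k. T (fmul E (coord f) k)"])
    fix d e assume d: "d \<in> D" "0 \<le> e" "\<forall>y\<in>topspace E. cmod (k y - d y) \<le> e"
    have "cmod (T (fmul E (coord f) k) x - T (fmul E (coord f) d) x) \<le> C * e" if x: "x \<in> topspace X" for x
    proof (rule T_contract[OF _ _ _ x])
      show "fmul E (coord f) k \<in> cfun E" "fmul E (coord f) d \<in> cfun E"
        using cfun_ops(2)[OF coord_cfun[OF f]] cfB[OF k] subsetD[OF span_cfun d(1)] by blast+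
      fix y assume y: "y \<in> topspace E"
      have "cmod (fmul E (coord f) k y - fmul E (coord f) d y) = cmod (coord f y) * cmod (k y - d y)"
        using y by (simp add: norm_mult[symmetric] algebra_simps)
      also have "\<dots> \<le> C * e"
        using C(2)[OF y] d y by (intro mult_mono C(1)) auto
      finally show "cmod (fmul E (coord f) k y - fmul E (coord f) d y) \<le> C * e" .
    qed
    then show "T (fmul E (coord f) d) \<in> I \<and>
        (\<forall>x\<in>topspace X. cmod (T (fmul E (coord f) k) x - T (fmul E (coord f) d) x) \<le> C * e)"
      using TD[OF d(1)] by blast
  qed
  then show ?thesis
    using I'(5) T_A[OF opB(3)[OF coord_B[OF f] k]] by blast
qed

text \<open>The functions \<open>g\<close> with \<open>T (g k) - T g T k \<in> I\<close> for all \<open>k\<close> form a closed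
  subalgebra, so it suffices to look at generators.\<close>

lemma T_mult:
  assumes I: "unif_ideal X A I" and FI: "F \<subseteq> I" and g: "g \<in> B" and k: "k \<in> B"
  shows "(\<lambda>x\<in>topspace X. T (fmul E g k) x - T g x * T k x) \<in> I"
proof -
  note I' = unif_idealD[OF I]
  define \<delta> where "\<delta> g k = (\<lambda>x\<in>topspace X. T (fmul E g k) x - T g x * T k x)" for g k
  let ?C = "{g \<in> B. \<forall>k\<in>B. \<delta> g k \<in> I}"
  have \<delta>A: "\<delta> g k \<in> A" if "g \<in> B" "k \<in> B" for g k
  proof -
    have "\<delta> g k = fadd X (T (fmul E g k)) (fscale X (-1) (fmul X (T g) (T k)))"
      unfolding \<delta>_def by (rule restrict_ext) simp
    also have "\<dots> \<in> A"
      using that by (intro opA opB T_A)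
    finally show ?thesis .
  qed
  have pbC: "pullback E fst a \<in> ?C" if a: "a \<in> A" for a
  proof -
    have "\<delta> (pullback E fst a) k \<in> I" if "k \<in> B" for k
    proof -
      have "\<delta> (pullback E fst a) k = fconst X 0"
        unfolding \<delta>_def T_module[OF cfB[OF that]] T_pb[OF a] by (rule restrict_ext) simp
      then show ?thesis using I'(2) by (simp only:)
    qed
    then show ?thesis using pb_B[OF a] by blast
  qed
  have coordC: "coord f \<in> ?C" if f: "f \<in> F" for f
  proof -
    have "monomial X F (fconst X 1) {f} = coord f"
      unfolding monomial_def by (rule restrict_ext) (simp add: E_fst)
    \<comment> \<open>As the coordinate itself averages to zero, its defect against \<open>k\<close>
      is just the average of the product.\<close>
    then have T0: "T (coord f) = fconst X 0"
      using T_monomial[OF opA(1), of "{f}" 1] f by (simp only:) simp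
    have "\<delta> (coord f) k \<in> I" if "k \<in> B" for k
    proof -
      have "\<delta> (coord f) k = T (fmul E (coord f) k)"
        unfolding \<delta>_def T0 by (rule extensionalityI[OF restrict_extensional T_ext]) simp
      then show ?thesis using T_coord[OF f I FI that] by (simp only:)
    qed
    then show ?thesis using coord_B[OF f] by blast
  qed
  have "closed_subalgebra E ?C"
    unfolding closed_subalgebra_def
  proof (intro conjI allI ballI)
    show "closedin (unif_top E) ?C"
      unfolding closedin_unif_top[OF cE]
    proof (intro conjI ballI impI)
      show "?C \<subseteq> cfun E" using cfB by blast
      fix g assume g: "g \<in> cfun E" "unif_approx E ?C g"
      have gB: "g \<in> B"
        by (rule closed_subalgebra_approx[OF cE subB g(1) unif_approx_mono[OF g(2)]]) blast
      have "\<delta> g k \<in> I" if k: "k \<in> B" for k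
      proof -
        obtain C where C: "0 \<le> C" "\<And>y. y \<in> topspace E \<Longrightarrow> cmod (k y) \<le> C"
          using cfun_bounded[OF cE cfB[OF k]] by blast
        have "unif_approx X I (\<delta> g k)"
        proof (rule unif_approx_image[OF g(2), where R = "\<lambda>g. \<delta> g k"])
          \<comment> \<open>One \<open>C\<close> bounds the change in the average of the product,
            the other the change in the product of the averages.\<close>
          show "0 \<le> C + C" using C(1) by simp
          fix b e assume b: "b \<in> ?C" "0 \<le> e" "\<forall>y\<in>topspace E. cmod (g y - b y) \<le> e"
          then have bB: "b \<in> B" by blast
          have "cmod (\<delta> g k x - \<delta> b k x) \<le> (C + C) * e" if x: "x \<in> topspace X" for x
          proof -
            have 1: "cmod (T (fmul E g k) x - T (fmul E b k) x) \<le> e * C"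
            proof (rule T_contract[OF cfB[OF opB(3)[OF gB k]] cfB[OF opB(3)[OF bB k]] _ x])
              fix y assume y: "y \<in> topspace E"
              have "cmod (fmul E g k y - fmul E b k y) = cmod (g y - b y) * cmod (k y)"
                using y by (simp add: norm_mult[symmetric] algebra_simps)
              also have "\<dots> \<le> e * C"
                using C(2)[OF y] b(2,3) y by (intro mult_mono) auto
              finally show "cmod (fmul E g k y - fmul E b k y) \<le> e * C" .
            qed
            have "cmod (T g x - T b x) \<le> e"
              by (rule T_contract[OF g(1) cfB[OF bB] _ x]) (use b(3) in blast)
            moreover have "cmod (T k x) \<le> C"
              by (rule T_bound[OF cfB[OF k] C(2) x])
            ultimately have 2: "cmod ((T g x - T b x) * T k x) \<le> e * C"
              unfolding norm_mult using b(2) by (intro mult_mono) auto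
            have "\<delta> g k x - \<delta> b k x
                = (T (fmul E g k) x - T (fmul E b k) x) - (T g x - T b x) * T k x"
              using x unfolding \<delta>_def by (simp only: restrict_apply' algebra_simps)
            also have "cmod \<dots> \<le> e * C + e * C"
              using norm_triangle_ineq4 1 2 by (rule order_trans[OF _ add_mono])
            finally show ?thesis by (simp only: algebra_simps)
          qed
          then show "\<delta> b k \<in> I \<and> (\<forall>x\<in>topspace X. cmod (\<delta> g k x - \<delta> b k x) \<le> (C + C) * e)"
            using b(1) k by blast
        qed
        then show ?thesis using I'(5) \<delta>A[OF gB k] by blast
      qed
      then show "g \<in> ?C" using gB by blast
    qed
    show "fconst E c \<in> ?C" for c
    proof -
      have "pullback E fst (fconst X c) = fconst E c"
        unfolding pullback_def compose_def by (rule restrict_ext) (simp add: E_fst)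
      then show ?thesis using pbC[OF opA(1)[of c]] by (simp only:)
    qed
    fix g g' assume g: "g \<in> ?C" "g' \<in> ?C"
    then have gB: "g \<in> B" "g' \<in> B" by blast+
    have "\<delta> (fadd E g g') k \<in> I" if k: "k \<in> B" for k
    proof -
      have *: "fmul E (fadd E g g') k = fadd E (fmul E g k) (fmul E g' k)"
        by (rule restrict_ext) (simp add: algebra_simps)
      have "\<delta> (fadd E g g') k = fadd X (\<delta> g k) (\<delta> g' k)"
        unfolding \<delta>_def * T_add[OF cfB[OF opB(3)[OF gB(1) k]] cfB[OF opB(3)[OF gB(2) k]]]
          T_add[OF cfB[OF gB(1)] cfB[OF gB(2)]]
        by (rule restrict_ext) (simp only: restrict_apply' algebra_simps)
      moreover have "fadd X (\<delta> g k) (\<delta> g' k) \<in> I"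
        using g k by (intro I'(3)) blast+
      ultimately show ?thesis by (simp only:)
    qed
    then show "fadd E g g' \<in> ?C" using opB(2)[OF gB] by blast
    have "\<delta> (fmul E g g') k \<in> I" if k: "k \<in> B" for k
    proof -
      have *: "fmul E (fmul E g g') k = fmul E g (fmul E g' k)"
        by (rule restrict_ext) simp
      \<comment> \<open>The cocycle identity \<open>\<delta> (g g') k = \<delta> g (g' k) + T g
        \<delta> g' k - T k \<delta> g g'\<close>; each defect on the right has \<open>g\<close> or
        \<open>g'\<close> as its first argument.\<close>
      have "\<delta> (fmul E g g') k = fadd X (\<delta> g (fmul E g' k))
          (fadd X (fmul X (\<delta> g' k) (T g)) (fmul X (\<delta> g g') (fscale X (-1) (T k))))"
        unfolding \<delta>_def * by (rule restrict_ext) (simp add: algebra_simps)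
      moreover have "\<dots> \<in> I"
        using g k gB by (intro I'(3) I'(4) opA(4) T_A) (use opB(3)[OF gB(2) k] in blast)+
      ultimately show ?thesis by (simp only:)
    qed
    then show "fmul E g g' \<in> ?C" using opB(3)[OF gB] by blast
  qed
  then have "B \<subseteq> ?C" by (rule B_least[OF _ pbC coordC])
  then show ?thesis using g k unfolding \<delta>_def by blast
qed

text \<open>Where all \<open>f\<close> vanish, the equations for the coordinates have only the root
  zero. The fibre is then a single point, and its average is the value there.\<close>

lemma T_hull:
  assumes y: "y \<in> topspace E" and F0: "\<And>f. f \<in> F \<Longrightarrow> f (fst y) = 0"
  shows "T g (fst y) = g y"
proof (rule T_const[OF E_fst[OF y]])
  fix y' assume y': "y' \<in> topspace E" "fst y' = fst y"
  have "snd y' = snd y"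
  proof (rule extensionalityI[where A = F])
    show "snd y' \<in> extensional F" "snd y \<in> extensional F"
      using y y' by (simp_all add: topspace_ext_space)
    fix f assume "f \<in> F"
    then have "snd y f * snd y f = 0" "snd y' f * snd y' f = 0"
      using E_coord[OF y, of f] E_coord[OF y'(1), of f] F0[of f] y'(2) by (simp_all only:)
    then show "snd y' f = snd y f" by simp
  qed
  then have "y' = y" using y'(2) by (simp add: prod_eq_iff)
  then show "g y' = g y" by simp
qed

end

section \<open>The tower\<close>

text \<open>The composite defect telescopes into \<open>T\<close> of the defect of \<open>V\<close>,
  which is in \<open>I\<close> because \<open>V\<close> is multiplicative modulo
  \<open>lift I\<close>, plus the defect of \<open>T\<close> at \<open>V g\<close> and
  \<open>V k\<close>. The evaluation properties match because the hull of \<open>lift I\<close> is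
  the preimage of the hull of \<open>I\<close>. The map \<open>r\<close> is separate since the maps
  of a system compose only on the points of the spaces.\<close>

lemma (in ideal_retraction) ideal_retraction_comp:
  assumes R: "ideal_retraction Y B Z C q V (lift I)"
    and r: "continuous_map Z X r" "\<And>w. w \<in> topspace Z \<Longrightarrow> r w = p (q w)"
  shows "ideal_retraction X A Z C r (\<lambda>g. T (V g)) I"
proof -
  interpret R: ideal_retraction Y B Z C q V "lift I" by (rule R)
  have pbr: "pullback Z r f = pullback Z q (pullback Y p f)" for f
    by (rule extensionalityI[where A = "topspace Z"]) (simp_all add: r(2) R.pY)
  show ?thesis
  proof
    show "uniform_algebra X A" "uniform_algebra Z C" by (rule A, rule R.B)
    show "continuous_map Z X r" by (rule r(1))
    have "r ` topspace Z = p ` (q ` topspace Z)"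
      unfolding image_image by (rule image_cong[OF refl]) (rule r(2))
    then show "r ` topspace Z = topspace X" by (simp only: R.onto onto)
    show "pullback Z r f \<in> C" if "f \<in> A" for f
      unfolding pbr by (rule R.pb[OF pb[OF that]])
    show "T (V (pullback Z r f)) = f" if "f \<in> A" for f
      unfolding pbr R.T_pb[OF pb[OF that]] by (rule T_pb[OF that])
    show "closed_ideal X A I" by (rule I)
    fix g assume g: "g \<in> C"
    show "T (V g) \<in> A" by (rule T[OF R.T[OF g]])
    show "T (V (fscale Z c g)) = fscale X c (T (V g))" for c
      by (simp only: R.T_scale[OF g] T_scale[OF R.T[OF g]])
    show "cmod (T (V g) x) \<le> e" if "\<forall>w\<in>topspace Z. cmod (g w) \<le> e" "x \<in> topspace X" for e x
      using T_bound[OF R.T[OF g] _ that(2)] R.T_bound[OF g that(1)] by blast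
    show "T (V g) (r w) = g w" if w: "w \<in> topspace Z" "r w \<in> zero_hull X I" for w
    proof -
      have "q w \<in> topspace Y" "p (q w) \<in> zero_hull X I"
        using R.pY[OF w(1)] w r(2) by simp_all
      then have "q w \<in> zero_hull Y (lift I)" unfolding zero_hull_lift by simp
      then have "V g (q w) = g w" by (rule R.T_hull[OF g w(1)])
      moreover have "T (V g) (p (q w)) = V g (q w)"
        by (rule T_hull[OF R.T[OF g]]) fact+
      ultimately show ?thesis by (simp only: r(2)[OF w(1)])
    qed
    fix k assume k: "k \<in> C"
    show "T (V (fadd Z g k)) = fadd X (T (V g)) (T (V k))"
      by (simp only: R.T_add[OF g k] T_add[OF R.T[OF g] R.T[OF k]])
    note VgVk = opB(3)[OF R.T[OF g] R.T[OF k]] and Vgk = R.T[OF R.opB(3)[OF g k]]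
    have "(\<lambda>y\<in>topspace Y. V (fmul Z g k) y - fmul Y (V g) (V k) y)
        = (\<lambda>y\<in>topspace Y. V (fmul Z g k) y - V g y * V k y)"
      by (rule restrict_ext) simp
    then have "(\<lambda>y\<in>topspace Y. V (fmul Z g k) y - fmul Y (V g) (V k) y) \<in> lift I"
      using R.T_mult[OF g k] by (simp only:)
    then have "(\<lambda>x\<in>topspace X. T (V (fmul Z g k)) x - T (fmul Y (V g) (V k)) x) \<in> I"
      unfolding lift_I_diff[OF Vgk VgVk] .
    moreover have "(\<lambda>x\<in>topspace X. T (fmul Y (V g) (V k)) x - T (V g) x * T (V k) x) \<in> I"
      by (rule T_mult[OF R.T[OF g] R.T[OF k]])
    ultimately have "fadd X (\<lambda>x\<in>topspace X. T (V (fmul Z g k)) x - T (fmul Y (V g) (V k)) x)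
        (\<lambda>x\<in>topspace X. T (fmul Y (V g) (V k)) x - T (V g) x * T (V k) x) \<in> I"
      by (rule unif_idealD(3)[OF idI])
    also have "fadd X (\<lambda>x\<in>topspace X. T (V (fmul Z g k)) x - T (fmul Y (V g) (V k)) x)
        (\<lambda>x\<in>topspace X. T (fmul Y (V g) (V k)) x - T (V g) x * T (V k) x)
      = (\<lambda>x\<in>topspace X. T (V (fmul Z g k)) x - T (V g) x * T (V k) x)"
      by (rule restrict_ext) (simp only: restrict_apply' algebra_simps)
    finally show "(\<lambda>x\<in>topspace X. T (V (fmul Z g k)) x - T (V g) x * T (V k) x) \<in> I" .
  qed
qed

text \<open>The stage \<open>Y\<close> is only homeomorphic to the extension space. Transport along
  the inverse of \<open>H\<close>, called \<open>u\<close>, commutes with the pointwise operations,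
  so everything follows from the averaging operator. As \<open>F \<subseteq> J\<close>, all
  functions in \<open>F\<close> vanish over the hull of \<open>J\<close>.\<close>

lemma (in single_extension) ideal_retraction_step:
  assumes C: "uniform_algebra Y C" and H: "homeomorphic_map Y E H" and CB: "C = pullback Y H ` B"
    and q: "continuous_map Y X q" "q ` topspace Y = topspace X" "\<And>y. y \<in> topspace Y \<Longrightarrow> q y = fst (H y)"
    and J: "closed_ideal X A J" and FJ: "F \<subseteq> J"
  shows "ideal_retraction X A Y C q (\<lambda>g. T (pullback E (inv_into (topspace Y) H) g)) J"
proof -
  define v where "v = inv_into (topspace Y) H"
  define u where "u g = pullback E v g" for g :: "'a \<Rightarrow> complex"
  have HE: "H ` topspace Y = topspace E" and inj: "inj_on H (topspace Y)"
    using H by (auto simp: homeomorphic_eq_everything_map)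
  have v: "v y \<in> topspace Y" "H (v y) = y" if "y \<in> topspace E" for y
    using that unfolding v_def HE[symmetric] by (rule inv_into_into, rule f_inv_into_f)
  have vH: "v (H w) = w" if "w \<in> topspace Y" for w
    unfolding v_def by (rule inv_into_f_f[OF inj that])
  have HY: "H w \<in> topspace E" if "w \<in> topspace Y" for w
    using that HE by blast
  have u_apply: "u g y = g (v y)" if "y \<in> topspace E" for g y
    using that by (simp add: u_def)
  have u_ext: "u g \<in> extensional (topspace E)" for g by (simp add: u_def)
  have uB: "u g \<in> B" if g: "g \<in> C" for g
  proof -
    obtain k where k: "k \<in> B" "g = pullback Y H k" using g CB by blast
    have "u g = k"
    proof (rule extensionalityI[OF u_ext cfun_extensional[OF cfB[OF k(1)]]])
      show "u g y = k y" if "y \<in> topspace E" for y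
        using v[OF that] by (simp add: u_apply[OF that] k(2))
    qed
    then show ?thesis using k(1) by (simp only:)
  qed
  have iJ: "unif_ideal X A J" using J closed_ideal_iff[OF cX subA] by simp
  have "ideal_retraction X A Y C q (\<lambda>g. T (u g)) J"
  proof
    show "uniform_algebra X A" "uniform_algebra Y C" by (rule A, rule C)
    show "continuous_map Y X q" "q ` topspace Y = topspace X" "closed_ideal X A J" by fact+
    show "pullback Y q f \<in> C" if f: "f \<in> A" for f
    proof -
      have "pullback Y q f = pullback Y H (pullback E fst f)"
        by (rule extensionalityI[where A = "topspace Y"]) (simp_all add: q(3) HY)
      then show ?thesis unfolding CB using pb_B[OF f] by blast
    qed
    show "T (u (pullback Y q f)) = f" if f: "f \<in> A" for f
    proof -
      have "u (pullback Y q f) = pullback E fst f"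
        by (rule extensionalityI[OF u_ext]) (simp_all add: u_apply q(3) v)
      then show ?thesis using T_pb[OF f] by (simp only:)
    qed
    fix g assume g: "g \<in> C"
    show "T (u g) \<in> A" by (rule T_A[OF uB[OF g]])
    show "T (u (fscale Y c g)) = fscale X c (T (u g))" for c
    proof -
      have "u (fscale Y c g) = fscale E c (u g)"
        by (rule extensionalityI[OF u_ext restrict_extensional]) (simp add: u_apply v)
      then show ?thesis using T_scale[OF cfB[OF uB[OF g]]] by (simp only:)
    qed
    show "cmod (T (u g) x) \<le> e" if e: "\<forall>y\<in>topspace Y. cmod (g y) \<le> e" and x: "x \<in> topspace X" for e x
      by (rule T_bound[OF cfB[OF uB[OF g]] _ x]) (use e v(1) in \<open>simp add: u_apply\<close>)
    show "T (u g) (q y) = g y" if y: "y \<in> topspace Y" "q y \<in> zero_hull X J" for y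
    proof -
      have "f (fst (H y)) = 0" if "f \<in> F" for f
        using y FJ that unfolding zero_hull_def q(3)[OF y(1)] by blast
      then have "T (u g) (fst (H y)) = u g (H y)" by (rule T_hull[OF HY[OF y(1)]])
      then show ?thesis by (simp only: q(3)[OF y(1)] u_apply[OF HY[OF y(1)]] vH[OF y(1)])
    qed
    fix k assume k: "k \<in> C"
    show "T (u (fadd Y g k)) = fadd X (T (u g)) (T (u k))"
    proof -
      have "u (fadd Y g k) = fadd E (u g) (u k)"
        by (rule extensionalityI[OF u_ext restrict_extensional]) (simp add: u_apply v)
      then show ?thesis using T_add[OF cfB[OF uB[OF g]] cfB[OF uB[OF k]]] by (simp only:)
    qed
    have "u (fmul Y g k) = fmul E (u g) (u k)"
      by (rule extensionalityI[OF u_ext restrict_extensional]) (simp add: u_apply v)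
    then show "(\<lambda>x\<in>topspace X. T (u (fmul Y g k)) x - T (u g) x * T (u k) x) \<in> J"
      using T_mult[OF iJ FJ uB[OF g] uB[OF k]] by (simp only:)
  qed
  then show ?thesis unfolding u_def v_def .
qed

text \<open>Lets later estimates keep whatever constant arises. The choice of \<open>e\<close> would
  give \<open>d \<le> d / 2\<close>; the summand 1 avoids division by zero, and the absolute value
  covers every sign of \<open>C\<close>.\<close>

lemma eq_if_norm_diff_le:
  fixes a b :: complex
  assumes "\<And>e. 0 < e \<Longrightarrow> cmod (a - b) \<le> C * e"
  shows "a = b"
proof (rule ccontr)
  assume "a \<noteq> b"
  define d where "d = cmod (a - b)"
  have d: "0 < d" using \<open>a \<noteq> b\<close> by (simp add: d_def)
  then have "0 < d / (2 * (\<bar>C\<bar> + 1))" by simp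
  from assms[OF this] have "d \<le> C * (d / (2 * (\<bar>C\<bar> + 1)))" by (simp only: d_def)
  also have "\<dots> \<le> (\<bar>C\<bar> + 1) * (d / (2 * (\<bar>C\<bar> + 1)))"
    using d by (intro mult_right_mono) auto
  also have "\<dots> = d / 2" by (simp add: field_simps)
  finally show False using d by simp
qed

lemma norm_mult_diff_le:
  fixes a b c d :: complex
  assumes "cmod a \<le> C" "cmod d \<le> D" "cmod (b - d) \<le> e" "cmod (a - c) \<le> e" "0 \<le> e"
  shows "cmod (a * b - c * d) \<le> (C + D) * e"
proof -
  have "a * b - c * d = a * (b - d) + (a - c) * d" by (simp add: algebra_simps)
  also have "cmod \<dots> \<le> cmod a * cmod (b - d) + cmod (a - c) * cmod d"
    by (rule order_trans[OF norm_triangle_ineq]) (simp add: norm_mult)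
  also have "\<dots> \<le> C * e + e * D"
    using assms by (intro add_mono mult_mono) (auto intro: order_trans[OF norm_ge_zero])
  finally show ?thesis by (simp add: algebra_simps)
qed

section \<open>The transfinite induction\<close>

locale ideal_tower = root_system \<tau> X A p F h
  for \<tau> :: "'i::wellorder" and X :: "'i \<Rightarrow> 'x topology" and A :: "'i \<Rightarrow> ('x \<Rightarrow> complex) set"
    and p :: "'i \<Rightarrow> 'i \<Rightarrow> 'x \<Rightarrow> 'x" and F :: "'i \<Rightarrow> ('x \<Rightarrow> complex) set"
    and h :: "'i \<Rightarrow> 'x \<Rightarrow> 'x ext_point" +
  fixes I\<^sub>0 :: "('x \<Rightarrow> complex) set"
  assumes I\<^sub>0: "closed_ideal (X ord_zero) (A ord_zero) I\<^sub>0"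
    and contains: "\<delta> < \<tau> \<Longrightarrow> F \<delta> \<subseteq> tower_ideal X A p F h I\<^sub>0 \<delta>"
begin

abbreviation z :: 'i where "z \<equiv> ord_zero"
abbreviation Tw :: "'i \<Rightarrow> ('x \<Rightarrow> complex) \<Rightarrow> 'x \<Rightarrow> complex" where "Tw \<equiv> tower_op X A p F h z"
abbreviation pb :: "'i \<Rightarrow> 'i \<Rightarrow> ('x \<Rightarrow> complex) \<Rightarrow> 'x \<Rightarrow> complex" where "pb \<delta> \<beta> \<equiv> pullback (X \<beta>) (p \<delta> \<beta>)"

text \<open>The second clause strengthens the induction hypothesis. Without compatibility of the
  earlier operators, the prescription defining the operator at a limit would not be known to be
  consistent.\<close>

definition stage_retraction :: "'i \<Rightarrow> bool" where
  "stage_retraction \<beta> \<longleftrightarrow>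
    ideal_retraction (X z) (A z) (X \<beta>) (A \<beta>) (p z \<beta>) (Tw \<beta>) I\<^sub>0 \<and>
    (\<forall>\<delta>\<le>\<beta>. \<forall>f\<in>A \<delta>. Tw \<beta> (pb \<delta> \<beta> f) = Tw \<delta> f)"

lemma z_le: "z \<le> \<beta>"
  unfolding ord_zero_def by (rule Least_le) (rule TrueI)

lemma p_in: "\<delta> \<le> \<beta> \<Longrightarrow> \<beta> \<le> \<tau> \<Longrightarrow> y \<in> topspace (X \<beta>) \<Longrightarrow> p \<delta> \<beta> y \<in> topspace (X \<delta>)"
  using maps_onto[of \<delta> \<beta>] by blast

lemma pb_in:
  assumes "\<delta> \<le> \<beta>" "\<beta> \<le> \<tau>" "f \<in> A \<delta>"
  shows "pb \<delta> \<beta> f \<in> A \<beta>"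
  using pullback_hom[OF assms(1,2)] assms(3) by (auto simp: alg_hom_def lin_map_def)

lemma pb_comp:
  assumes "\<delta> \<le> \<epsilon>" "\<epsilon> \<le> \<beta>" "\<beta> \<le> \<tau>"
  shows "pb \<epsilon> \<beta> (pb \<delta> \<epsilon> f) = pb \<delta> \<beta> f"
  by (rule extensionalityI[where A = "topspace (X \<beta>)"])
    (use assms in \<open>simp_all add: p_in maps_comp\<close>)

lemma Aext: "\<beta> \<le> \<tau> \<Longrightarrow> f \<in> A \<beta> \<Longrightarrow> f \<in> extensional (topspace (X \<beta>))"
  using uniform_algebraD(4)[OF algebras] cfun_extensional by blast

lemma pb_id: "\<beta> \<le> \<tau> \<Longrightarrow> f \<in> A \<beta> \<Longrightarrow> pb \<beta> \<beta> f = f"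
  by (rule extensionalityI[where A = "topspace (X \<beta>)"]) (simp_all add: Aext maps_id)

lemma Tw_zero: "Tw z = (\<lambda>g. g)"
  by (simp add: tower_op.simps)

lemma stage_retraction_zero: "stage_retraction z"
  unfolding stage_retraction_def Tw_zero
proof (intro conjI allI impI ballI)
  have zt: "z \<le> \<tau>" by (rule z_le)
  note Z = algebras[OF zt]
  have idI: "unif_ideal (X z) (A z) I\<^sub>0"
    using I\<^sub>0 closed_ideal_iff[OF uniform_algebraD(1,3)[OF Z]] by blast
  show "ideal_retraction (X z) (A z) (X z) (A z) (p z z) (\<lambda>g. g) I\<^sub>0"
  proof
    show "uniform_algebra (X z) (A z)" by (rule Z)
    show "continuous_map (X z) (X z) (p z z)" by (rule maps_continuous[OF order_refl zt])
    show "p z z ` topspace (X z) = topspace (X z)" by (rule maps_onto[OF order_refl zt])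
    show "closed_ideal (X z) (A z) I\<^sub>0" by (rule I\<^sub>0)
    show "pb z z f \<in> A z" "pb z z f = f" if "f \<in> A z" for f
      using that pb_id[OF zt that] by simp_all
    show "(\<lambda>x\<in>topspace (X z). fmul (X z) g k x - g x * k x) \<in> I\<^sub>0" for g k
    proof -
      have "(\<lambda>x\<in>topspace (X z). fmul (X z) g k x - g x * k x) = fconst (X z) 0"
        by (rule restrict_ext) simp
      then show ?thesis using unif_idealD(2)[OF idI] by (simp only:)
    qed
    show "g (p z z y) = g y" if "y \<in> topspace (X z)" for g :: "'x \<Rightarrow> complex" and y
      by (simp only: maps_id[OF zt that])
  qed blast+
  fix \<delta> f assume "\<delta> \<le> z" "f \<in> A \<delta>"
  then have "\<delta> = z" using z_le[of \<delta>] by simp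
  then show "pb \<delta> z f = Tw \<delta> f" using pb_id[OF zt, of f] \<open>f \<in> A \<delta>\<close> by (simp add: Tw_zero)
qed

text \<open>The ideal of stage \<open>\<delta>\<close> is \<open>lift I\<^sub>0\<close> for the
  retraction already obtained, so the hypothesis on \<open>F \<delta>\<close> is exactly what the
  averaging step needs, and the composition lemma applies.\<close>

lemma stage_retraction_succ:
  assumes \<delta>\<beta>: "is_succ_of \<beta> \<delta>" and \<beta>: "\<beta> \<le> \<tau>" and IH: "stage_retraction \<delta>"
  shows "stage_retraction \<beta>"
proof -
  have lt: "\<delta> < \<beta>" and \<beta>_eq: "\<beta> = ord_succ \<delta>" using \<delta>\<beta> by (auto simp: is_succ_of_def)
  then have \<delta>\<tau>: "\<delta> < \<tau>" "\<delta> \<le> \<tau>" using \<beta> by auto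
  have below: "\<epsilon> \<le> \<delta>" if "\<epsilon> < \<beta>" for \<epsilon>
  proof (rule ccontr)
    assume "\<not> \<epsilon> \<le> \<delta>"
    then have "ord_succ \<delta> \<le> \<epsilon>" using ord_succ_least[of \<delta> \<epsilon>] by simp
    then show False using that \<beta>_eq by simp
  qed
  interpret R: ideal_retraction "X z" "A z" "X \<delta>" "A \<delta>" "p z \<delta>" "Tw \<delta>" "I\<^sub>0"
    using IH unfolding stage_retraction_def by blast
  have Tw_comp: "Tw \<delta> (pb \<epsilon> \<delta> f) = Tw \<epsilon> f" if "\<epsilon> \<le> \<delta>" "f \<in> A \<epsilon>" for \<epsilon> f
    using IH that unfolding stage_retraction_def by blast
  have "compact_space (ext_space (X \<delta>) (F \<delta>))"
    using homeomorphic_compact_space[OF homeomorphic_map_imp_homeomorphic_space[OF succ_space[OF \<delta>\<tau>(1)]]]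
      uniform_algebraD(1)[OF algebras[OF \<beta>]] \<beta>_eq by blast
  then interpret S: single_extension "X \<delta>" "A \<delta>" "F \<delta>"
    using algebras[OF \<delta>\<tau>(2)] succ_functions[OF \<delta>\<tau>(1)] by unfold_locales blast+
  have "F \<delta> \<subseteq> R.lift I\<^sub>0"
    using contains[OF \<delta>\<tau>(1)] unfolding tower_ideal_def R.lift_def .
  have step: "ideal_retraction (X \<delta>) (A \<delta>) (X \<beta>) (A \<beta>) (p \<delta> \<beta>) (step_op X F h \<delta>) (R.lift I\<^sub>0)"
    unfolding step_op_def \<beta>_eq
  proof (rule S.ideal_retraction_step)
    show "uniform_algebra (X (ord_succ \<delta>)) (A (ord_succ \<delta>))"
      using algebras[OF \<beta>] by (simp only: \<beta>_eq)
    show "homeomorphic_map (X (ord_succ \<delta>)) S.E (h \<delta>)" by (rule succ_space[OF \<delta>\<tau>(1)])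
    show "A (ord_succ \<delta>) = pullback (X (ord_succ \<delta>)) (h \<delta>) ` S.B" by (rule succ_algebra[OF \<delta>\<tau>(1)])
    show "continuous_map (X (ord_succ \<delta>)) (X \<delta>) (p \<delta> (ord_succ \<delta>))"
      using maps_continuous[OF less_imp_le[OF lt] \<beta>] by (simp only: \<beta>_eq)
    show "p \<delta> (ord_succ \<delta>) ` topspace (X (ord_succ \<delta>)) = topspace (X \<delta>)"
      using maps_onto[OF less_imp_le[OF lt] \<beta>] by (simp only: \<beta>_eq)
    show "p \<delta> (ord_succ \<delta>) y = fst (h \<delta> y)" if "y \<in> topspace (X (ord_succ \<delta>))" for y
      by (rule succ_map[OF \<delta>\<tau>(1) that])
    show "closed_ideal (X \<delta>) (A \<delta>) (R.lift I\<^sub>0)" by (rule R.closed_ideal_lift_I)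
    show "F \<delta> \<subseteq> R.lift I\<^sub>0" by fact
  qed
  then interpret V: ideal_retraction "X \<delta>" "A \<delta>" "X \<beta>" "A \<beta>" "p \<delta> \<beta>" "step_op X F h \<delta>" "R.lift I\<^sub>0" .
  have Tw\<beta>: "Tw \<beta> = (\<lambda>g. Tw \<delta> (step_op X F h \<delta> g))"
    using lt z_le[of \<delta>] \<delta>\<beta> by (subst tower_op.simps) (auto simp: ord_pred_eq o_def)
  have "ideal_retraction (X z) (A z) (X \<beta>) (A \<beta>) (p z \<beta>) (Tw \<beta>) I\<^sub>0"
    unfolding Tw\<beta>
  proof (rule R.ideal_retraction_comp[OF step])
    show "continuous_map (X \<beta>) (X z) (p z \<beta>)" by (rule maps_continuous[OF z_le \<beta>])
    show "p z \<beta> w = p z \<delta> (p \<delta> \<beta> w)" if "w \<in> topspace (X \<beta>)" for w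
      using maps_comp[OF z_le _ \<beta> that, of \<delta>] lt by simp
  qed
  moreover have "Tw \<beta> (pb \<epsilon> \<beta> f) = Tw \<epsilon> f" if e: "\<epsilon> \<le> \<beta>" "f \<in> A \<epsilon>" for \<epsilon> f
  proof (cases "\<epsilon> = \<beta>")
    case True
    then show ?thesis using pb_id[OF \<beta>] e(2) by simp
  next
    case False
    then have le: "\<epsilon> \<le> \<delta>" using below e(1) by simp
    \<comment> \<open>Pulling back from \<open>\<epsilon>\<close> to \<open>\<beta>\<close> passes
      through \<open>\<delta>\<close>, and averaging undoes the last pullback.\<close>
    have "step_op X F h \<delta> (pb \<epsilon> \<beta> f) = pb \<epsilon> \<delta> f"
      using V.T_pb[OF pb_in[OF le \<delta>\<tau>(2) e(2)]] pb_comp[OF le less_imp_le[OF lt] \<beta>] by (simp only:)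
    then show ?thesis unfolding Tw\<beta> using Tw_comp[OF le e(2)] by (simp only:)
  qed
  ultimately show ?thesis unfolding stage_retraction_def by blast
qed

text \<open>A map \<open>L\<close> is built by approximating \<open>g\<close> with functions of
  lower stages and taking the limit of their images. Its properties are inherited through the
  approximants, and it is identified with \<open>limit_op\<close> by showing that it is the only map
  meeting the description.\<close>

lemma stage_retraction_limit:
  assumes lim: "is_limit \<gamma>" and \<gamma>: "\<gamma> \<le> \<tau>" and IH: "\<And>\<delta>. \<delta> < \<gamma> \<Longrightarrow> stage_retraction \<delta>"
  shows "stage_retraction \<gamma>"
proof -
  let ?Y = "X \<gamma>" and ?X = "X z"
  have z\<gamma>: "z < \<gamma>" using lim z_le[of \<gamma>] by (auto simp: is_limit_def)
  have le\<tau>: "\<delta> \<le> \<tau>" if "\<delta> < \<gamma>" for \<delta> using that \<gamma> by simp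
  have zt: "z \<le> \<tau>" by (rule z_le)
  note UX = algebras[OF zt] and UY = algebras[OF \<gamma>]
  note cX = uniform_algebraD(1)[OF UX] and cY = uniform_algebraD(1)[OF UY]
  note opX = closed_subalgebraD(2-5)[OF uniform_algebraD(3)[OF UX]]
  note opY = closed_subalgebraD(2-5)[OF uniform_algebraD(3)[OF UY]]
  note clX = closed_subalgebraD(1)[OF uniform_algebraD(3)[OF UX]]
  note cfX = subsetD[OF uniform_algebraD(4)[OF UX]] and cfY = subsetD[OF uniform_algebraD(4)[OF UY]]
  have idI: "unif_ideal ?X (A z) I\<^sub>0"
    using I\<^sub>0 closed_ideal_iff[OF uniform_algebraD(1,3)[OF UX]] by blast
  have R: "ideal_retraction ?X (A z) (X \<delta>) (A \<delta>) (p z \<delta>) (Tw \<delta>) I\<^sub>0" if "\<delta> < \<gamma>" for \<delta>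
    using IH[OF that] unfolding stage_retraction_def by blast
  have Tw_comp: "Tw \<delta> (pb \<epsilon> \<delta> f) = Tw \<epsilon> f" if "\<epsilon> \<le> \<delta>" "\<delta> < \<gamma>" "f \<in> A \<epsilon>" for \<epsilon> \<delta> f
    using IH[OF that(2)] that(1,3) unfolding stage_retraction_def by blast

  \<comment> \<open>That is, \<open>g\<close> is uniformly within \<open>e\<close> of the pullback
    of \<open>f\<close>.\<close>
  define close where "close g \<delta> f e \<longleftrightarrow> (\<forall>y\<in>topspace ?Y. cmod (g y - f (p \<delta> \<gamma> y)) \<le> e)" for g \<delta> f e
  have closeD: "cmod (g y - f (p \<delta> \<gamma> y)) \<le> e" if "close g \<delta> f e" "y \<in> topspace ?Y" for g \<delta> f e y
    using that unfolding close_def by blast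
  have raise: "pb \<delta> m f \<in> A m" "close g m (pb \<delta> m f) e \<longleftrightarrow> close g \<delta> f e" "Tw m (pb \<delta> m f) = Tw \<delta> f"
    if "\<delta> \<le> m" "m < \<gamma>" "f \<in> A \<delta>" for \<delta> m f g e
  proof -
    show "pb \<delta> m f \<in> A m" by (rule pb_in[OF that(1) le\<tau>[OF that(2)] that(3)])
    show "Tw m (pb \<delta> m f) = Tw \<delta> f" by (rule Tw_comp[OF that])
    have "pb \<delta> m f (p m \<gamma> y) = f (p \<delta> \<gamma> y)" if "y \<in> topspace ?Y" for y
      using p_in[OF less_imp_le[OF \<open>m < \<gamma>\<close>] \<gamma> that] maps_comp[OF \<open>\<delta> \<le> m\<close> less_imp_le[OF \<open>m < \<gamma>\<close>] \<gamma> that]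
      by simp
    then show "close g m (pb \<delta> m f) e \<longleftrightarrow> close g \<delta> f e" unfolding close_def by simp
  qed
  have approx: "\<exists>\<delta> f. \<delta> < \<gamma> \<and> f \<in> A \<delta> \<and> close g \<delta> f e" if g: "g \<in> A \<gamma>" and e: "0 < e" for g e
  proof -
    let ?U = "\<Union>\<alpha>\<in>{..<\<gamma>}. pb \<alpha> \<gamma> ` A \<alpha>"
    have "?U \<subseteq> cfun ?Y"
      using pb_in[OF less_imp_le \<gamma>] cfY by auto
    then have "unif_approx ?Y ?U g"
      using g unfolding limit_algebra[OF lim \<gamma>] closure_of_unif_top[OF cY \<open>?U \<subseteq> cfun ?Y\<close>] by simp
    from mp[OF spec[OF this[unfolded unif_approx_def]] e]
    obtain u where u: "u \<in> ?U" "\<forall>y\<in>topspace ?Y. cmod (g y - u y) \<le> e"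
      by (rule bexE)
    from u(1) obtain \<delta> f where "\<delta> < \<gamma>" "f \<in> A \<delta>" "u = pb \<delta> \<gamma> f"
      unfolding UN_iff image_iff lessThan_iff by blast
    moreover have "close g \<delta> f e"
      unfolding close_def
    proof
      fix y assume "y \<in> topspace ?Y"
      then show "cmod (g y - f (p \<delta> \<gamma> y)) \<le> e"
        using bspec[OF u(2), of y] pullback_apply[of y ?Y "p \<delta> \<gamma>" f] \<open>u = pb \<delta> \<gamma> f\<close> by (simp only:)
    qed
    ultimately show ?thesis by blast
  qed
  \<comment> \<open>Both approximants are raised to the larger of the two stages, where one
    contraction acts on both. Surjectivity of the map from stage \<open>\<gamma>\<close> turns an
    estimate upstairs into one on the whole of that stage.\<close>
  have transfer: "cmod (Tw \<delta> f x - Tw \<epsilon> f' x) \<le> e + e'"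
    if f: "\<delta> < \<gamma>" "f \<in> A \<delta>" "close g \<delta> f e" and f': "\<epsilon> < \<gamma>" "f' \<in> A \<epsilon>" "close g \<epsilon> f' e'"
      and x: "x \<in> topspace ?X" for g \<delta> \<epsilon> f f' e e' x
  proof -
    define m where "m = max \<delta> \<epsilon>"
    have m: "\<delta> \<le> m" "\<epsilon> \<le> m" "m < \<gamma>" using f f' by (auto simp: m_def)
    interpret R: ideal_retraction ?X "A z" "X m" "A m" "p z m" "Tw m" "I\<^sub>0" by (rule R[OF m(3)])
    let ?f = "pb \<delta> m f" and ?f' = "pb \<epsilon> m f'"
    have "cmod (?f w - ?f' w) \<le> e + e'" if w: "w \<in> topspace (X m)" for w
    proof -
      obtain y where y: "y \<in> topspace ?Y" "w = p m \<gamma> y"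
        using w maps_onto[OF less_imp_le[OF m(3)] \<gamma>] by blast
      have "cmod (g y - ?f w) \<le> e" "cmod (g y - ?f' w) \<le> e'"
        using closeD[of g m ?f e y] closeD[of g m ?f' e' y] raise(2)[OF m(1,3) f(2)] raise(2)[OF m(2,3) f'(2)]
          f(3) f'(3) y by simp_all
      moreover have "?f w - ?f' w = (g y - ?f' w) - (g y - ?f w)" by simp
      ultimately show ?thesis using norm_triangle_ineq4[of "g y - ?f' w" "g y - ?f w"] by simp
    qed
    then have "cmod (Tw m ?f x - Tw m ?f' x) \<le> e + e'"
      using R.T_contract[OF raise(1)[OF m(1,3) f(2)] raise(1)[OF m(2,3) f'(2)] _ x] by blast
    then show ?thesis by (simp only: raise(3)[OF m(1,3) f(2)] raise(3)[OF m(2,3) f'(2)])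
  qed

  \<comment> \<open>Quantifying over all approximants makes the value independent of the chosen
    sequence, so that linearity and multiplicativity can be tested with convenient
    approximants.\<close>
  define near where "near g k \<longleftrightarrow> (\<forall>\<delta> f e x. \<delta> < \<gamma> \<longrightarrow> f \<in> A \<delta> \<longrightarrow> close g \<delta> f e \<longrightarrow>
    x \<in> topspace ?X \<longrightarrow> cmod (k x - Tw \<delta> f x) \<le> e)" for g k
  have "\<exists>k. k \<in> A z \<and> near g k" if g: "g \<in> A \<gamma>" for g
  proof -
    let ?r = "\<lambda>n. 1 / real (Suc n)"
    have "\<forall>n. \<exists>\<delta>f. fst \<delta>f < \<gamma> \<and> snd \<delta>f \<in> A (fst \<delta>f) \<and> close g (fst \<delta>f) (snd \<delta>f) (?r n)"
      using approx[OF g] by simp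
    from choice[OF this] obtain \<delta>f
      where \<delta>f: "\<And>n. fst (\<delta>f n) < \<gamma>" "\<And>n. snd (\<delta>f n) \<in> A (fst (\<delta>f n))"
        "\<And>n. close g (fst (\<delta>f n)) (snd (\<delta>f n)) (?r n)" by blast
    define t where "t n = Tw (fst (\<delta>f n)) (snd (\<delta>f n))" for n
    have r0: "(\<lambda>n. ?r n + ?r n) \<longlonglongrightarrow> 0"
      using tendsto_add[OF lim_1_over_n lim_1_over_n, THEN LIMSEQ_Suc] by simp
    obtain k where k: "k \<in> A z" "\<And>n x. x \<in> topspace ?X \<Longrightarrow> cmod (k x - t n x) \<le> ?r n + ?r n"
    proof (rule unif_approx_limit[OF cX clX _ _ r0])
      show "t n \<in> A z" for n
        unfolding t_def by (rule ideal_retraction.T[OF R[OF \<delta>f(1)] \<delta>f(2)])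
      fix m n :: nat and x assume mn: "n \<le> m" and x: "x \<in> topspace ?X"
      have "cmod (t m x - t n x) \<le> ?r m + ?r n"
        unfolding t_def by (rule transfer[OF \<delta>f(1) \<delta>f(2) \<delta>f(3) \<delta>f(1) \<delta>f(2) \<delta>f(3) x])
      also have "\<dots> \<le> ?r n + ?r n"
        using mn by (intro add_right_mono frac_le) simp_all
      finally show "cmod (t m x - t n x) \<le> ?r n + ?r n" .
    qed (rule that)
    have "near g k"
      unfolding near_def
    proof (intro allI impI)
      fix \<delta> f e x assume f: "\<delta> < \<gamma>" "f \<in> A \<delta>" "close g \<delta> f e" and x: "x \<in> topspace ?X"
      have "cmod (k x - Tw \<delta> f x) \<le> (?r n + ?r n) + (?r n + e)" for n
      proof -
        have "cmod (t n x - Tw \<delta> f x) \<le> ?r n + e"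
          unfolding t_def by (rule transfer[OF \<delta>f(1) \<delta>f(2) \<delta>f(3) f x])
        then show ?thesis
          using k(2)[OF x, of n] norm_triangle_ineq[of "k x - t n x" "t n x - Tw \<delta> f x"] by simp
      qed
      moreover have "(\<lambda>n. (?r n + ?r n) + (?r n + e)) \<longlonglongrightarrow> 0 + (0 + e)"
        by (intro tendsto_add r0 tendsto_const lim_1_over_n[THEN LIMSEQ_Suc])
      ultimately show "cmod (k x - Tw \<delta> f x) \<le> e"
        by (intro LIMSEQ_le_const[where X = "\<lambda>n. (?r n + ?r n) + (?r n + e)"]) auto
    qed
    then show ?thesis using k(1) by blast
  qed
  then have "\<forall>g\<in>A \<gamma>. \<exists>k. k \<in> A z \<and> near g k" by blast
  from bchoice[OF this] obtain L0 where L0: "\<forall>g\<in>A \<gamma>. L0 g \<in> A z \<and> near g (L0 g)" by blast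
  \<comment> \<open>\<open>limit_op\<close> asks for a map that is \<open>undefined\<close> outside
    the algebra; this is what makes uniqueness possible.\<close>
  define L where "L = restrict L0 (A \<gamma>)"
  have LA: "L g \<in> A z" if "g \<in> A \<gamma>" for g
    using L0 that by (simp add: L_def)
  have Lnear: "cmod (L g x - Tw \<delta> f x) \<le> e"
    if "g \<in> A \<gamma>" "\<delta> < \<gamma>" "f \<in> A \<delta>" "close g \<delta> f e" "x \<in> topspace ?X" for g \<delta> f e x
    using L0 that unfolding near_def L_def by simp
  have Lext: "L g \<in> extensional (topspace ?X)" if "g \<in> A \<gamma>" for g
    by (rule Aext[OF zt LA[OF that]])
  have Lpb: "L (pb \<delta> \<gamma> f) = Tw \<delta> f" if f: "\<delta> < \<gamma>" "f \<in> A \<delta>" for \<delta> f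
  proof (rule extensionalityI)
    have pbA: "pb \<delta> \<gamma> f \<in> A \<gamma>" by (rule pb_in[OF less_imp_le[OF f(1)] \<gamma> f(2)])
    then show "L (pb \<delta> \<gamma> f) \<in> extensional (topspace ?X)" by (rule Lext)
    show "Tw \<delta> f \<in> extensional (topspace ?X)"
      by (rule Aext[OF zt ideal_retraction.T[OF R[OF f(1)] f(2)]])
    show "L (pb \<delta> \<gamma> f) x = Tw \<delta> f x" if "x \<in> topspace ?X" for x
      \<comment> \<open>A pullback is approximated by its original with error zero, whence
        equality.\<close>
      using Lnear[OF pbA f, of 0 x] that by (simp add: close_def)
  qed
  \<comment> \<open>Operations on two functions need approximants at one common stage.\<close>
  have approx2: "\<exists>m f f'. m < \<gamma> \<and> f \<in> A m \<and> close g m f e \<and> f' \<in> A m \<and> close g' m f' e"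
    if g: "g \<in> A \<gamma>" "g' \<in> A \<gamma>" and e: "0 < e" for g g' e
  proof -
    obtain \<delta> f where f: "\<delta> < \<gamma>" "f \<in> A \<delta>" "close g \<delta> f e" using approx[OF g(1) e] by blast
    obtain \<epsilon> f' where f': "\<epsilon> < \<gamma>" "f' \<in> A \<epsilon>" "close g' \<epsilon> f' e" using approx[OF g(2) e] by blast
    have m: "\<delta> \<le> max \<delta> \<epsilon>" "\<epsilon> \<le> max \<delta> \<epsilon>" "max \<delta> \<epsilon> < \<gamma>" using f f' by auto
    show ?thesis
      using m(3) raise(1)[OF m(1,3) f(2)] raise(1)[OF m(2,3) f'(2)]
        iffD2[OF raise(2)[OF m(1,3) f(2)] f(3)] iffD2[OF raise(2)[OF m(2,3) f'(2)] f'(3)] by blast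
  qed
  \<comment> \<open>Both arguments are replaced by approximants at a stage \<open>m\<close>, where
    \<open>Tw m\<close> is additive. The sum contributes an error of \<open>2 e\<close> and each
    summand one of \<open>e\<close>, so the total is \<open>4 e\<close>.\<close>
  have L_add: "L (fadd ?Y g g') = fadd ?X (L g) (L g')" if g: "g \<in> A \<gamma>" "g' \<in> A \<gamma>" for g g'
  proof (rule extensionalityI[OF Lext[OF opY(2)[OF g]] restrict_extensional])
    fix x assume x: "x \<in> topspace ?X"
    show "L (fadd ?Y g g') x = fadd ?X (L g) (L g') x"
    proof (rule eq_if_norm_diff_le)
      fix e :: real assume e: "0 < e"
      obtain m f f' where m: "m < \<gamma>" and f: "f \<in> A m" "close g m f e" and f': "f' \<in> A m" "close g' m f' e"
        using approx2[OF g e] by blast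
      interpret R: ideal_retraction ?X "A z" "X m" "A m" "p z m" "Tw m" "I\<^sub>0" by (rule R[OF m])
      have "close (fadd ?Y g g') m (fadd (X m) f f') (e + e)"
        unfolding close_def
      proof
        fix y assume y: "y \<in> topspace ?Y"
        have "cmod ((g y - f (p m \<gamma> y)) + (g' y - f' (p m \<gamma> y))) \<le> e + e"
          by (intro norm_triangle_le add_mono closeD[OF f(2) y] closeD[OF f'(2) y])
        then show "cmod (fadd ?Y g g' y - fadd (X m) f f' (p m \<gamma> y)) \<le> e + e"
          using y p_in[OF less_imp_le[OF m] \<gamma> y] by (simp add: algebra_simps)
      qed
      from Lnear[OF opY(2)[OF g] m R.opB(2)[OF f(1) f'(1)] this x]
      have 1: "cmod (L (fadd ?Y g g') x - (Tw m f x + Tw m f' x)) \<le> e + e"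
        using x by (simp only: R.T_add[OF f(1) f'(1)] restrict_apply')
      have 2: "cmod (L g x - Tw m f x) \<le> e" "cmod (L g' x - Tw m f' x) \<le> e"
        using Lnear[OF g(1) m f x] Lnear[OF g(2) m f' x] .
      have "L (fadd ?Y g g') x - (L g x + L g' x) = (L (fadd ?Y g g') x - (Tw m f x + Tw m f' x))
          - ((L g x - Tw m f x) + (L g' x - Tw m f' x))" by simp
      also have "cmod \<dots> \<le> (e + e) + (e + e)"
        by (intro order_trans[OF norm_triangle_ineq4] add_mono 1 norm_triangle_le 2)
      finally show "cmod (L (fadd ?Y g g') x - fadd ?X (L g) (L g') x) \<le> 4 * e"
        using x by simp
    qed
  qed
  have L_scale: "L (fscale ?Y c g) = fscale ?X c (L g)" if g: "g \<in> A \<gamma>" for c g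
  proof (rule extensionalityI[OF Lext[OF opY(4)[OF g]] restrict_extensional])
    fix x assume x: "x \<in> topspace ?X"
    show "L (fscale ?Y c g) x = fscale ?X c (L g) x"
    proof (rule eq_if_norm_diff_le)
      fix e :: real assume e: "0 < e"
      obtain m f where m: "m < \<gamma>" and f: "f \<in> A m" "close g m f e"
        using approx[OF g e] by blast
      interpret R: ideal_retraction ?X "A z" "X m" "A m" "p z m" "Tw m" "I\<^sub>0" by (rule R[OF m])
      have "close (fscale ?Y c g) m (fscale (X m) c f) (cmod c * e)"
        unfolding close_def
      proof
        fix y assume y: "y \<in> topspace ?Y"
        have "cmod (c * (g y - f (p m \<gamma> y))) \<le> cmod c * e"
          unfolding norm_mult by (intro mult_left_mono closeD[OF f(2) y]) simp
        then show "cmod (fscale ?Y c g y - fscale (X m) c f (p m \<gamma> y)) \<le> cmod c * e"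
          using y p_in[OF less_imp_le[OF m] \<gamma> y] by (simp add: algebra_simps)
      qed
      from Lnear[OF opY(4)[OF g] m R.opB(4)[OF f(1)] this x]
      have 1: "cmod (L (fscale ?Y c g) x - c * Tw m f x) \<le> cmod c * e"
        using x by (simp only: R.T_scale[OF f(1)] restrict_apply')
      have 2: "cmod (c * (L g x - Tw m f x)) \<le> cmod c * e"
        unfolding norm_mult by (intro mult_left_mono Lnear[OF g m f x]) simp
      have "L (fscale ?Y c g) x - c * L g x
          = (L (fscale ?Y c g) x - c * Tw m f x) - c * (L g x - Tw m f x)"
        by (simp add: algebra_simps)
      also have "cmod \<dots> \<le> cmod c * e + cmod c * e"
        by (intro order_trans[OF norm_triangle_ineq4] add_mono 1 2)
      finally show "cmod (L (fscale ?Y c g) x - fscale ?X c (L g) x) \<le> (2 * cmod c) * e"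
        using x by (simp add: mult_ac)
    qed
  qed
  have L_bound: "cmod (L g x) \<le> c" if g: "g \<in> A \<gamma>" and c: "\<forall>y\<in>topspace ?Y. cmod (g y) \<le> c"
    and x: "x \<in> topspace ?X" for g c x
  proof (rule field_le_epsilon)
    fix e :: real assume e: "0 < e"
    then have e2: "0 < e / 2" by simp
    obtain m f where m: "m < \<gamma>" and f: "f \<in> A m" "close g m f (e / 2)"
      using approx[OF g e2] by blast
    interpret R: ideal_retraction ?X "A z" "X m" "A m" "p z m" "Tw m" "I\<^sub>0" by (rule R[OF m])
    have "cmod (f w) \<le> c + e / 2" if w: "w \<in> topspace (X m)" for w
    proof -
      obtain y where y: "y \<in> topspace ?Y" "w = p m \<gamma> y"
        using w maps_onto[OF less_imp_le[OF m] \<gamma>] by blast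
      have "cmod (g y) \<le> c" "cmod (g y - f w) \<le> e / 2"
        using c y(1) closeD[OF f(2) y(1)] y(2) by simp_all
      then show ?thesis
        using norm_triangle_ineq4[of "g y" "g y - f w"] by simp
    qed
    then have "cmod (Tw m f x) \<le> c + e / 2" using R.T_bound[OF f(1) _ x] by blast
    then show "cmod (L g x) \<le> c + e"
      using Lnear[OF g m f x] norm_triangle_ineq[of "L g x - Tw m f x" "Tw m f x"] by simp
  qed
  have L_hull: "L g (p z \<gamma> y) = g y" if g: "g \<in> A \<gamma>" and y: "y \<in> topspace ?Y" "p z \<gamma> y \<in> zero_hull ?X I\<^sub>0" for g y
  proof (rule eq_if_norm_diff_le)
    fix e :: real assume e: "0 < e"
    obtain m f where m: "m < \<gamma>" and f: "f \<in> A m" "close g m f e"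
      using approx[OF g e] by blast
    interpret R: ideal_retraction ?X "A z" "X m" "A m" "p z m" "Tw m" "I\<^sub>0" by (rule R[OF m])
    have eq: "p z m (p m \<gamma> y) = p z \<gamma> y"
      by (rule maps_comp[OF z_le less_imp_le[OF m] \<gamma> y(1)])
    have "Tw m f (p z m (p m \<gamma> y)) = f (p m \<gamma> y)"
      by (rule R.T_hull[OF f(1) p_in[OF less_imp_le[OF m] \<gamma> y(1)]]) (simp only: eq y(2))
    then have "Tw m f (p z \<gamma> y) = f (p m \<gamma> y)" by (simp only: eq)
    moreover have "cmod (L g (p z \<gamma> y) - Tw m f (p z \<gamma> y)) \<le> e"
      by (rule Lnear[OF g m f p_in[OF z_le \<gamma> y(1)]])
    ultimately have "cmod (L g (p z \<gamma> y) - f (p m \<gamma> y)) \<le> e" by simp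
    then show "cmod (L g (p z \<gamma> y) - g y) \<le> 2 * e"
      using closeD[OF f(2) y(1)] norm_triangle_ineq4[of "L g (p z \<gamma> y) - f (p m \<gamma> y)" "g y - f (p m \<gamma> y)"]
      by simp
  qed
  have L_mult: "(\<lambda>x\<in>topspace ?X. L (fmul ?Y g k) x - L g x * L k x) \<in> I\<^sub>0"
    if g: "g \<in> A \<gamma>" and k: "k \<in> A \<gamma>" for g k
  proof -
    let ?d = "\<lambda>x\<in>topspace ?X. L (fmul ?Y g k) x - L g x * L k x"
    have "?d = fadd ?X (L (fmul ?Y g k)) (fscale ?X (-1) (fmul ?X (L g) (L k)))"
      by (rule restrict_ext) simp
    also have "\<dots> \<in> A z" by (intro opX LA opY g k)
    finally have dA: "?d \<in> A z" .
    obtain C where C: "0 \<le> C" "\<And>y. y \<in> topspace ?Y \<Longrightarrow> cmod (g y) \<le> C"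
      using cfun_bounded[OF cY cfY[OF g]] by blast
    obtain K where K: "0 \<le> K" "\<And>y. y \<in> topspace ?Y \<Longrightarrow> cmod (k y) \<le> K"
      using cfun_bounded[OF cY cfY[OF k]] by blast
    have "unif_approx ?X I\<^sub>0 ?d"
      unfolding unif_approx_def
    proof (intro allI impI)
      fix e0 :: real assume e0: "0 < e0"
      \<comment> \<open>With \<open>e \<le> 1\<close> the approximant \<open>f'\<close> is bounded
        by \<open>K + 1\<close>. The product upstairs and the product of the images each cost
        \<open>(C + (K + 1)) * e\<close>, hence the factor 2.\<close>
      define N where "N = 2 * (C + (K + 1))"
      have N: "0 < N" using C(1) K(1) by (simp add: N_def)
      define e where "e = min 1 (e0 / N)"
      have e: "0 < e" "e \<le> 1" "N * e \<le> e0"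
        using e0 N by (auto simp: e_def min_def field_simps)
      obtain m f f' where m: "m < \<gamma>" and f: "f \<in> A m" "close g m f e" and f': "f' \<in> A m" "close k m f' e"
        using approx2[OF g k e(1)] by blast
      interpret R: ideal_retraction ?X "A z" "X m" "A m" "p z m" "Tw m" "I\<^sub>0" by (rule R[OF m])
      have bf': "cmod (f' w) \<le> K + 1" if w: "w \<in> topspace (X m)" for w
      proof -
        obtain y where y: "y \<in> topspace ?Y" "w = p m \<gamma> y"
          using w maps_onto[OF less_imp_le[OF m] \<gamma>] by blast
        have "cmod (k y) \<le> K" "cmod (k y - f' w) \<le> e"
          using K(2) y closeD[OF f'(2) y(1)] by simp_all
        then show ?thesis
          using norm_triangle_ineq4[of "k y" "k y - f' w"] e(2) by simp
      qed
      have "close (fmul ?Y g k) m (fmul (X m) f f') ((C + (K + 1)) * e)"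
        unfolding close_def
      proof
        fix y assume y: "y \<in> topspace ?Y"
        have w: "p m \<gamma> y \<in> topspace (X m)" by (rule p_in[OF less_imp_le[OF m] \<gamma> y])
        have "cmod (g y * k y - f (p m \<gamma> y) * f' (p m \<gamma> y)) \<le> (C + (K + 1)) * e"
          by (rule norm_mult_diff_le[OF C(2)[OF y] bf'[OF w] closeD[OF f'(2) y] closeD[OF f(2) y] less_imp_le[OF e(1)]])
        then show "cmod (fmul ?Y g k y - fmul (X m) f f' (p m \<gamma> y)) \<le> (C + (K + 1)) * e"
          using y w by simp
      qed
      note 1 = Lnear[OF opY(3)[OF g k] m R.opB(3)[OF f(1) f'(1)] this]
      \<comment> \<open>The same defect formed at stage \<open>m\<close> lies in the ideal and
        approximates the defect of \<open>L\<close>; closedness of the ideal finishes the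
        argument.\<close>
      let ?b = "\<lambda>x\<in>topspace ?X. Tw m (fmul (X m) f f') x - Tw m f x * Tw m f' x"
      have "cmod (?d x - ?b x) \<le> e0" if x: "x \<in> topspace ?X" for x
      proof -
        have "cmod (Tw m f' x) \<le> K + 1"
          using R.T_bound[OF f'(1) _ x] bf' by blast
        moreover have "cmod (L g x) \<le> C" by (rule L_bound[OF g _ x]) (use C(2) in blast)
        ultimately have 2: "cmod (L g x * L k x - Tw m f x * Tw m f' x) \<le> (C + (K + 1)) * e"
          using Lnear[OF g m f x] Lnear[OF k m f' x] e(1) by (intro norm_mult_diff_le) simp_all
        have "?d x - ?b x = (L (fmul ?Y g k) x - Tw m (fmul (X m) f f') x)
            - (L g x * L k x - Tw m f x * Tw m f' x)"
          using x by (simp only: restrict_apply' algebra_simps)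
        also have "cmod \<dots> \<le> (C + (K + 1)) * e + (C + (K + 1)) * e"
          by (intro order_trans[OF norm_triangle_ineq4] add_mono 1 2 x)
        also have "\<dots> = N * e" by (simp add: N_def algebra_simps)
        finally show ?thesis using e(3) by simp
      qed
      then show "\<exists>b\<in>I\<^sub>0. \<forall>x\<in>topspace ?X. cmod (?d x - b x) \<le> e0"
        using R.T_mult[OF f(1) f'(1)] by (intro bexI[of _ ?b]) blast+
    qed
    then show ?thesis by (rule unif_idealD(5)[OF idI dA])
  qed
  have IR: "ideal_retraction ?X (A z) ?Y (A \<gamma>) (p z \<gamma>) L I\<^sub>0"
  proof
    show "uniform_algebra ?X (A z)" "uniform_algebra ?Y (A \<gamma>)" by (rule UX, rule UY)
    show "continuous_map ?Y ?X (p z \<gamma>)" by (rule maps_continuous[OF z_le \<gamma>])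
    show "p z \<gamma> ` topspace ?Y = topspace ?X" by (rule maps_onto[OF z_le \<gamma>])
    show "closed_ideal ?X (A z) I\<^sub>0" by (rule I\<^sub>0)
    show "pb z \<gamma> f \<in> A \<gamma>" if "f \<in> A z" for f by (rule pb_in[OF z_le \<gamma> that])
    show "L (pb z \<gamma> f) = f" if "f \<in> A z" for f
      using Lpb[OF z\<gamma> that] by (simp only: Tw_zero)
  qed (fact LA L_add L_scale L_bound L_mult L_hull)+
  then interpret L: ideal_retraction ?X "A z" ?Y "A \<gamma>" "p z \<gamma>" L "I\<^sub>0" .

  let ?P = "\<lambda>M. M \<in> extensional (A \<gamma>) \<and> lin_map (ualg ?Y (A \<gamma>)) (ualg ?X (A z)) M \<and>
    continuous_map (subtopology (unif_top ?Y) (A \<gamma>)) (unif_top ?X) M \<and>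
    (\<forall>\<delta>\<in>{z..<\<gamma>}. \<forall>f\<in>A \<delta>. M (pb \<delta> \<gamma> f) = Tw \<delta> f)"
  \<comment> \<open>Continuity is checked as the inclusion of images of closures in closures, which
    contractivity yields directly.\<close>
  have cont: "continuous_map (subtopology (unif_top ?Y) (A \<gamma>)) (unif_top ?X) L"
    unfolding continuous_map_eq_image_closure_subset
  proof (intro allI funcsetI)
    fix S g assume "g \<in> subtopology (unif_top ?Y) (A \<gamma>) closure_of S"
    then have g: "g \<in> A \<gamma>" "g \<in> unif_top ?Y closure_of (A \<gamma> \<inter> S)"
      unfolding closure_of_subtopology by blast+
    have sub: "A \<gamma> \<inter> S \<subseteq> cfun ?Y" using cfY by blast
    have sub': "L ` (A \<gamma> \<inter> S) \<subseteq> cfun ?X" using cfX LA by blast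
    have "unif_approx ?Y (A \<gamma> \<inter> S) g" using g(2) unfolding closure_of_unif_top[OF cY sub] by simp
    then have "unif_approx ?X (L ` (A \<gamma> \<inter> S)) (L g)"
    proof (rule unif_approx_image[where C = 1])
      fix b e assume b: "b \<in> A \<gamma> \<inter> S" "\<forall>y\<in>topspace ?Y. cmod (g y - b y) \<le> e"
      then have "cmod (L g x - L b x) \<le> e" if "x \<in> topspace ?X" for x
        using L.T_contract[OF g(1) _ b(2) that] by blast
      then show "L b \<in> L ` (A \<gamma> \<inter> S) \<and> (\<forall>x\<in>topspace ?X. cmod (L g x - L b x) \<le> 1 * e)"
        using b(1) by simp
    qed simp
    then have "L g \<in> unif_top ?X closure_of (L ` (A \<gamma> \<inter> S))"
      unfolding closure_of_unif_top[OF cX sub'] using cfX[OF LA[OF g(1)]] by simp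
    then show "L g \<in> unif_top ?X closure_of (L ` S)"
      by (rule subsetD[OF closure_of_mono, rotated]) blast
  qed
  have PL: "?P L"
  proof (intro conjI)
    show "L \<in> extensional (A \<gamma>)" by (simp add: L_def)
    show "lin_map (ualg ?Y (A \<gamma>)) (ualg ?X (A z)) L"
      unfolding lin_map_def carrier_ualg add_ualg smult_ualg
      by (intro conjI ballI allI funcsetI LA L_add L_scale)
    show "continuous_map (subtopology (unif_top ?Y) (A \<gamma>)) (unif_top ?X) L" by (rule cont)
    show "\<forall>\<delta>\<in>{z..<\<gamma>}. \<forall>f\<in>A \<delta>. L (pb \<delta> \<gamma> f) = Tw \<delta> f" using Lpb by simp
  qed
  \<comment> \<open>Two continuous maps into a Hausdorff space that agree on the dense union of
    pullbacks are equal on the algebra, and both are \<open>undefined\<close> elsewhere.\<close>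
  have uniq: "M = L" if M: "?P M" for M
  proof (rule extensionalityI[where A = "A \<gamma>"])
    show "M \<in> extensional (A \<gamma>)" "L \<in> extensional (A \<gamma>)" using M PL by blast+
    fix g assume g: "g \<in> A \<gamma>"
    let ?U = "\<Union>\<alpha>\<in>{..<\<gamma>}. pb \<alpha> \<gamma> ` A \<alpha>"
    have "?U \<subseteq> A \<gamma>" using pb_in[OF less_imp_le \<gamma>] by auto
    then have "g \<in> subtopology (unif_top ?Y) (A \<gamma>) closure_of ?U"
      using g limit_algebra[OF lim \<gamma>] unfolding closure_of_subtopology by (simp add: Int_absorb1)
    moreover have "M u = L u" if u: "u \<in> ?U" for u
    proof -
      from u obtain \<delta> f where "\<delta> < \<gamma>" "f \<in> A \<delta>" "u = pb \<delta> \<gamma> f"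
        unfolding UN_iff image_iff lessThan_iff by blast
      moreover have "\<delta> \<in> {z..<\<gamma>}" using \<open>\<delta> < \<gamma>\<close> z_le by simp
      ultimately show ?thesis using M Lpb by simp
    qed
    moreover have "continuous_map (subtopology (unif_top ?Y) (A \<gamma>)) (unif_top ?X) M"
      using M by blast
    ultimately show "M g = L g"
      using forall_in_closure_of_eq[OF _ Hausdorff_unif_top _ cont] by blast
  qed
  have "limit_op X A p z \<gamma> Tw = L"
    unfolding limit_op_def using PL uniq by (rule the_equality)
  moreover have "Tw \<gamma> = limit_op X A p z \<gamma> Tw"
  proof -
    have "\<not> \<gamma> \<le> z" "\<not> (\<exists>\<delta>. is_succ_of \<gamma> \<delta>)"
      using z\<gamma> lim unfolding is_limit_def by simp_all
    then show ?thesis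
      by (subst tower_op.simps) (simp only: if_False)
  qed
  ultimately have "Tw \<gamma> = L" by simp
  moreover have "L (pb \<delta> \<gamma> f) = Tw \<delta> f" if "\<delta> \<le> \<gamma>" "f \<in> A \<delta>" for \<delta> f
  proof (cases "\<delta> = \<gamma>")
    case True
    then show ?thesis using pb_id[OF \<gamma>] that(2) \<open>Tw \<gamma> = L\<close> by simp
  next
    case False
    then show ?thesis using that Lpb by simp
  qed
  ultimately show ?thesis unfolding stage_retraction_def using IR by simp
qed

lemma stage_retraction: "\<beta> \<le> \<tau> \<Longrightarrow> stage_retraction \<beta>"
proof (induction \<beta> rule: less_induct)
  case (less \<beta>)
  then have IH: "stage_retraction \<delta>" if "\<delta> < \<beta>" for \<delta> using that by simp
  consider "\<beta> = z" | \<delta> where "is_succ_of \<beta> \<delta>" | "is_limit \<beta>"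
    unfolding is_limit_def by blast
  then show ?case
  proof cases
    case 1
    then show ?thesis using stage_retraction_zero by simp
  next
    case 2
    then have "\<delta> < \<beta>" unfolding is_succ_of_def by blast
    then show ?thesis by (rule stage_retraction_succ[OF 2 less.prems IH])
  next
    case 3
    then show ?thesis using stage_retraction_limit[OF 3 less.prems IH] by blast
  qed
qed

end

theorem theorem6p8:
  fixes \<tau> :: "'i::wellorder"
    and X :: "'i \<Rightarrow> 'x topology"
    and A :: "'i \<Rightarrow> ('x \<Rightarrow> complex) set"
    and p :: "'i \<Rightarrow> 'i \<Rightarrow> 'x \<Rightarrow> 'x"
    and F :: "'i \<Rightarrow> ('x \<Rightarrow> complex) set"
    and h :: "'i \<Rightarrow> 'x \<Rightarrow> 'x ext_point"
    and I :: "'i \<Rightarrow> ('x \<Rightarrow> complex) set"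
    and S :: "'i \<Rightarrow> 'x set"
    and I\<^sub>0 :: "('x \<Rightarrow> complex) set"
    and S\<^sub>0 :: "'x set"
    and z :: 'i
  assumes system: "root_system \<tau> X A p F h"
    and z: "z = ord_zero"
    and I\<^sub>0: "closed_ideal (X z) (A z) I\<^sub>0"
    and S\<^sub>0: "S\<^sub>0 = zero_hull (X z) I\<^sub>0"
    and I: "I = tower_ideal X A p F h I\<^sub>0"
    and S: "S = tower_hull X p S\<^sub>0"
    and contains: "\<And>\<alpha>. \<alpha> < \<tau> \<Longrightarrow> F \<alpha> \<subseteq> I \<alpha>"
    and \<alpha>: "\<alpha> \<le> \<tau>"
  shows
    "homeomorphic_map (subtopology (X \<alpha>) (S \<alpha>)) (subtopology (X z) S\<^sub>0) (p z \<alpha>) \<and>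
     (\<exists>\<Phi>. isometric_iso (fun_nalg S\<^sub>0 (restrictions (A z) S\<^sub>0))
                        (fun_nalg (S \<alpha>) (restrictions (A \<alpha>) (S \<alpha>))) \<Phi> \<and>
         (\<forall>f\<in>A z. \<Phi> (restrict f S\<^sub>0) = restrict (pullback (X \<alpha>) (p z \<alpha>) f) (S \<alpha>))) \<and>
     closed_ideal (X \<alpha>) (A \<alpha>) (I \<alpha>) \<and>
     zero_hull (X \<alpha>) (I \<alpha>) = S \<alpha> \<and>
     I \<alpha> \<inter> pullback (X \<alpha>) (p z \<alpha>) ` A z = pullback (X \<alpha>) (p z \<alpha>) ` I\<^sub>0 \<and>
     (\<exists>\<phi>. isometric_iso (quot_nalg (ualg (X \<alpha>) (A \<alpha>)) (I \<alpha>))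
                        (quot_nalg (ualg (X z) (A z)) I\<^sub>0) \<phi>) \<and>
     (\<exists>\<Psi>. bij_betw \<Psi> {J. closed_ideal (X \<alpha>) (A \<alpha>) J \<and> I \<alpha> \<subseteq> J}
                      {J. closed_ideal (X z) (A z) J \<and> I\<^sub>0 \<subseteq> J} \<and>
          (\<forall>J K. closed_ideal (X \<alpha>) (A \<alpha>) J \<and> I \<alpha> \<subseteq> J \<and>
                 closed_ideal (X \<alpha>) (A \<alpha>) K \<and> I \<alpha> \<subseteq> K \<longrightarrow>
                 (J \<subseteq> K \<longleftrightarrow> \<Psi> J \<subseteq> \<Psi> K)))"
proof -
  interpret root_system \<tau> X A p F h by (rule system)
  interpret ideal_tower \<tau> X A p F h I\<^sub>0
    using I\<^sub>0 contains unfolding z I by unfold_locales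
  interpret R: ideal_retraction "X z" "A z" "X \<alpha>" "A \<alpha>" "p z \<alpha>" "tower_op X A p F h z \<alpha>" "I\<^sub>0"
    using stage_retraction[OF \<alpha>] unfolding stage_retraction_def z by blast
  \<comment> \<open>By this identity and the next one, every conjunct is a statement about a single
    retraction from stage \<open>\<alpha>\<close> to stage zero.\<close>
  have S\<alpha>: "S \<alpha> = {y \<in> topspace (X \<alpha>). p z \<alpha> y \<in> zero_hull (X z) I\<^sub>0}"
    unfolding S S\<^sub>0 tower_hull_def z ..
  have I\<alpha>: "I \<alpha> = R.lift I\<^sub>0"
    unfolding I tower_ideal_def R.lift_def unfolding z ..
  show ?thesis
    unfolding S\<alpha> I\<alpha> S\<^sub>0
  proof (intro conjI)
    show "\<exists>\<Phi>. isometric_iso (fun_nalg (zero_hull (X z) I\<^sub>0) (restrictions (A z) (zero_hull (X z) I\<^sub>0)))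
        (fun_nalg R.hullY (restrictions (A \<alpha>) R.hullY)) \<Phi> \<and>
      (\<forall>f\<in>A z. \<Phi> (restrict f (zero_hull (X z) I\<^sub>0)) = restrict (pullback (X \<alpha>) (p z \<alpha>) f) R.hullY)"
      using R.restriction_iso by blast
    show "\<exists>\<phi>. isometric_iso (quot_nalg (ualg (X \<alpha>) (A \<alpha>)) (R.lift I\<^sub>0)) (quot_nalg (ualg (X z) (A z)) I\<^sub>0) \<phi>"
      using R.quotient_iso by blast
    \<comment> \<open>The witness is \<open>R.drop\<close>, which takes \<open>J\<close> to the
      functions of stage zero whose pullback lies in \<open>J\<close>.\<close>
    show "\<exists>\<Psi>. bij_betw \<Psi> {J. closed_ideal (X \<alpha>) (A \<alpha>) J \<and> R.lift I\<^sub>0 \<subseteq> J}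
        {J. closed_ideal (X z) (A z) J \<and> I\<^sub>0 \<subseteq> J} \<and>
      (\<forall>J K. closed_ideal (X \<alpha>) (A \<alpha>) J \<and> R.lift I\<^sub>0 \<subseteq> J \<and>
        closed_ideal (X \<alpha>) (A \<alpha>) K \<and> R.lift I\<^sub>0 \<subseteq> K \<longrightarrow> (J \<subseteq> K \<longleftrightarrow> \<Psi> J \<subseteq> \<Psi> K))"
      using R.ideal_correspondence by blast
  qed (fact R.homeomorphic_hull R.closed_ideal_lift_I R.zero_hull_lift R.lift_Int_pullback)+
qed

end
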